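(* Let $G$ be a connected graph and $x\in V(G)$. Then $(G,h_x)$ is not AT if and only if one of the following holds: (1) $G$ is a Gallai tree; or (2) $d(x)=1$; or (3) $d(x)=2$ and $G-x$ has a component that is a Gallai tree; or (4) $x$ is not a cutvertex, for the block $B$ of $G$ containing $x$ we have $(B,h_x)\in\mathcal{D}$, and every other block of $G$ is complete or an odd cycle; or (5) $x$ is a cutvertex, all but at most one $x$-lobe of $G$, say $A$, are Gallai trees, and either (i) $d_A(x)=1$; or (ii) $d_A(x)=2$ and $A-x$ is a Gallai tree; or (iii) for the block $B$ of $A$ containing $x$ we have $(B,h_x)\in\mathcal{D}$ and all $B$-lobes of $A$ are Gallai trees.
   Context: For an orientation $D$ of a graph, a spanning Eulerian subgraph is a spanning subgraph in which every vertex has indegree equal to outdegree; $EE(D)$ (resp. $EO(D)$) is the number of spanning Eulerian subgraphs with an even (resp. odd) number of edges. $D$ is AT if $EE(D)\ne EO(D)$. For $x\in V(G)$, $h_x(x)=1$ and $h_x(v)=0$ for $v\ne x$; $(G,h_x)$ is AT if $G$ has an AT orientation in which every vertex $v$ has outdegree at most $d_G(v)-h_x(v)-1$; for a subgraph $B$ containing $x$, $(B,h_x)$ uses degrees in $B$. A Gallai tree is a connected graph each of whose blocks is a complete graph or an odd cycle. An $x$-lobe of $G$ is a maximal subgraph $A$ such that $A-x$ is connected. For a block $B$, a $B$-lobe of $G$ is a maximal subgraph $A$ such that $A-B$ is connected and $A$ includes a single vertex of $B$. $\mathcal{D}$ is the set of pairs $(G,h_x)$ of the following types: (a) $G$ is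 obtained from $K_4$ on vertices $x,z_1,z_2,z_3$ by replacing each edge $xz_i$ with an $x$–$z_i$ path of odd length (internally disjoint, new internal vertices); (b) the same, but each path $x$–$z_i$ has even length at least 2; (c) $G$ is the Moser spindle (two disjoint triangles $abc$ and $a'b'c'$, the edge $aa'$, and a vertex $x$ adjacent to exactly $b,c,b',c'$) with $x$ its vertex of degree 4.
   Formalization: A B-lobe is additionally required to be connected itself; read literally, a component of A−B together with a nonadjacent vertex of B would also be a B-lobe, is never a Gallai tree, and would make case (5)(iii) fail for pairs that are not AT. *)

theory Defs
  imports "Graph_Theory.Kuratowski"
begin

text \<open>
  A finite simple graph is a \<^const>\<open>pair_graph\<close>: a finite loopless symmetric digraph in which
  the edge \<open>uv\<close> is the pair of arcs \<open>(u, v)\<close>, \<open>(v, u)\<close>. Orientations and Eulerian subgraphs are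
  arbitrary pair digraphs. The predicate \<^const>\<open>connected\<close> is false for the null graph.
\<close>

definition deg :: "'a pair_pre_digraph \<Rightarrow> 'a \<Rightarrow> nat" where
  "deg G v = card {u. (v, u) \<in> parcs G}"

definition del_verts :: "'a pair_pre_digraph \<Rightarrow> 'a set \<Rightarrow> 'a pair_pre_digraph" where
  "del_verts G S = \<lparr> pverts = pverts G - S, parcs = {(u, v) \<in> parcs G. u \<notin> S \<and> v \<notin> S} \<rparr>"

definition maximal_subgraph ::
    "'a pair_pre_digraph \<Rightarrow> ('a pair_pre_digraph \<Rightarrow> bool) \<Rightarrow> 'a pair_pre_digraph \<Rightarrow> bool" where
  "maximal_subgraph G P H \<longleftrightarrow>
     pair_graph H \<and> subgraph (with_proj H) (with_proj G) \<and> P H \<and>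
     (\<forall>H'. pair_graph H' \<and> subgraph (with_proj H') (with_proj G) \<and> P H' \<and>
           subgraph (with_proj H) (with_proj H') \<longrightarrow> H' = H)"

definition component :: "'a pair_pre_digraph \<Rightarrow> 'a pair_pre_digraph \<Rightarrow> bool" where
  "component G = maximal_subgraph G (\<lambda>C. connected (with_proj C))"

definition cutvertex :: "'a pair_pre_digraph \<Rightarrow> 'a \<Rightarrow> bool" where
  "cutvertex G v \<longleftrightarrow>
     v \<in> pverts G \<and> card {C. component G C} < card {C. component (del_verts G {v}) C}"

definition block :: "'a pair_pre_digraph \<Rightarrow> 'a pair_pre_digraph \<Rightarrow> bool" where
  "block G = maximal_subgraph G (\<lambda>B. connected (with_proj B) \<and> (\<forall>v. \<not> cutvertex B v))"

definition complete_graph :: "'a pair_pre_digraph \<Rightarrow> bool" where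
  "complete_graph G \<longleftrightarrow> (\<exists>n. complete_digraph n (with_proj G))"

definition cycle_graph :: "nat \<Rightarrow> 'a pair_pre_digraph \<Rightarrow> bool" where
  "cycle_graph n G \<longleftrightarrow> 3 \<le> n \<and>
     (\<exists>f. bij_betw f {..<n} (pverts G) \<and>
          parcs G = (\<Union>i<n. {(f i, f (Suc i mod n)), (f (Suc i mod n), f i)}))"

definition odd_cycle :: "'a pair_pre_digraph \<Rightarrow> bool" where
  "odd_cycle G \<longleftrightarrow> (\<exists>n. odd n \<and> cycle_graph n G)"

definition gallai_tree :: "'a pair_pre_digraph \<Rightarrow> bool" where
  "gallai_tree G \<longleftrightarrow> pair_graph G \<and> connected (with_proj G) \<and>
     (\<forall>B. block G B \<longrightarrow> complete_graph B \<or> odd_cycle B)"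

definition orientation :: "'a pair_pre_digraph \<Rightarrow> 'a pair_pre_digraph \<Rightarrow> bool" where
  "orientation G D \<longleftrightarrow> pverts D = pverts G \<and>
     parcs D \<union> (parcs D)\<inverse> = parcs G \<and> parcs D \<inter> (parcs D)\<inverse> = {}"

definition eulerian_subgraphs :: "'a pair_pre_digraph \<Rightarrow> 'a pair_pre_digraph set" where
  "eulerian_subgraphs D = {H. spanning (with_proj H) (with_proj D) \<and>
     (\<forall>v \<in> pverts D. in_degree (with_proj H) v = out_degree (with_proj H) v)}"

definition EE :: "'a pair_pre_digraph \<Rightarrow> nat" where
  "EE D = card {H \<in> eulerian_subgraphs D. even (card (parcs H))}"

definition EO :: "'a pair_pre_digraph \<Rightarrow> nat" where
  "EO D = card {H \<in> eulerian_subgraphs D. odd (card (parcs H))}"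

definition AT_digraph :: "'a pair_pre_digraph \<Rightarrow> bool" where
  "AT_digraph D \<longleftrightarrow> EE D \<noteq> EO D"

definition h_vert :: "'a \<Rightarrow> 'a \<Rightarrow> nat" where
  "h_vert x v = (if v = x then 1 else 0)"

text \<open>The outdegree bound is an integer: it is negative if, e.g., \<open>h v = 1\<close> and \<open>v\<close> is a leaf.\<close>

definition AT_pair :: "'a pair_pre_digraph \<times> ('a \<Rightarrow> nat) \<Rightarrow> bool" where
  "AT_pair = (\<lambda>(G, h). \<exists>D. orientation G D \<and> AT_digraph D \<and>
     (\<forall>v \<in> pverts G. int (out_degree (with_proj D) v) \<le> int (deg G v) - int (h v) - 1))"

definition x_lobe :: "'a pair_pre_digraph \<Rightarrow> 'a \<Rightarrow> 'a pair_pre_digraph \<Rightarrow> bool" where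
  "x_lobe G x = maximal_subgraph G (\<lambda>A. connected (with_proj (del_verts A {x})))"

text \<open>
  A \<open>B\<close>-lobe is itself connected, i.e. its vertex in \<open>B\<close> is the one at which it is attached;
  otherwise a component of \<open>G - B\<close> together with any nonadjacent vertex of \<open>B\<close> would qualify.
\<close>

definition B_lobe ::
    "'a pair_pre_digraph \<Rightarrow> 'a pair_pre_digraph \<Rightarrow> 'a pair_pre_digraph \<Rightarrow> bool" where
  "B_lobe G B = maximal_subgraph G (\<lambda>A. connected (with_proj A) \<and>
     connected (with_proj (del_verts A (pverts B))) \<and> card (pverts A \<inter> pverts B) = 1)"

definition graph_of :: "'a set \<Rightarrow> ('a \<times> 'a) set \<Rightarrow> 'a pair_pre_digraph" where
  "graph_of V E = \<lparr> pverts = V, parcs = E \<union> E\<inverse> \<rparr>"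

definition path_edges :: "'a list \<Rightarrow> ('a \<times> 'a) set" where
  "path_edges p = set (zip p (tl p))"

text \<open>
  \<open>K\<^sub>4\<close> on \<open>x, z\<^sub>1, z\<^sub>2, z\<^sub>3\<close> with each edge \<open>xz\<^sub>i\<close> replaced by a path whose list of internal
  vertices is \<open>p\<^sub>i\<close>; that path has length \<open>Suc (length p\<^sub>i)\<close>.
\<close>

definition K4_paths ::
    "'a \<Rightarrow> 'a \<Rightarrow> 'a \<Rightarrow> 'a \<Rightarrow> 'a list \<Rightarrow> 'a list \<Rightarrow> 'a list \<Rightarrow> 'a pair_pre_digraph" where
  "K4_paths x z1 z2 z3 p1 p2 p3 =
     graph_of ({x, z1, z2, z3} \<union> set p1 \<union> set p2 \<union> set p3)
       ({(z1, z2), (z1, z3), (z2, z3)} \<union> path_edges (x # p1 @ [z1]) \<union>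
        path_edges (x # p2 @ [z2]) \<union> path_edges (x # p3 @ [z3]))"

definition moser_spindle ::
    "'a \<Rightarrow> 'a \<Rightarrow> 'a \<Rightarrow> 'a \<Rightarrow> 'a \<Rightarrow> 'a \<Rightarrow> 'a \<Rightarrow> 'a pair_pre_digraph" where
  "moser_spindle x a b c a' b' c' =
     graph_of {x, a, b, c, a', b', c'}
       {(a, b), (b, c), (a, c), (a', b'), (b', c'), (a', c'), (a, a'),
        (x, b), (x, c), (x, b'), (x, c')}"

inductive_set \<D> :: "('a pair_pre_digraph \<times> ('a \<Rightarrow> nat)) set" where
  odd_paths: "\<lbrakk> distinct ([x, z1, z2, z3] @ p1 @ p2 @ p3);
      \<forall>p \<in> {p1, p2, p3}. odd (Suc (length p)) \<rbrakk>
    \<Longrightarrow> (K4_paths x z1 z2 z3 p1 p2 p3, h_vert x) \<in> \<D>"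
| even_paths: "\<lbrakk> distinct ([x, z1, z2, z3] @ p1 @ p2 @ p3);
      \<forall>p \<in> {p1, p2, p3}. even (Suc (length p)) \<and> 2 \<le> Suc (length p) \<rbrakk>
    \<Longrightarrow> (K4_paths x z1 z2 z3 p1 p2 p3, h_vert x) \<in> \<D>"
| moser: "distinct [x, a, b, c, a', b', c']
    \<Longrightarrow> (moser_spindle x a b c a' b' c', h_vert x) \<in> \<D>"

end

theory Submission
  imports Defs
begin

text \<open>
  Up to sign, \<open>EE D - EO D\<close> is the coefficient of \<open>\<Prod>\<^sub>v y\<^sub>v ^ outdeg v\<close> in the graph polynomial
  \<open>\<Prod>(y\<^sub>u - y\<^sub>v)\<close>. Complementing exponents in the degrees, \<open>(G, h\<^sub>x)\<close> is AT iff some monomial with all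
  exponents at least \<open>1\<close>, and at least \<open>2\<close> at \<open>x\<close>, has a nonzero coefficient. The polynomial factors at
  cutvertices, which reduces the problem to a 2-connected graph \<open>x + T\<close>; if \<open>T\<close> is not a Gallai tree, then
  a good monomial of \<open>T\<close> extends to \<open>x + T\<close>.

  If \<open>T\<close> is a Gallai tree, consider the product of its polynomial with the linear form \<open>\<Sum>\<nu>\<^sub>u y\<^sub>u\<close>, where
  \<open>\<nu>\<close> is the indicator of the neighbourhood of \<open>x\<close>. If the product has no monomial divisible by all
  variables, this persists when a vertex of degree at least \<open>2\<close> is deleted, and when a vertex \<open>q\<close> of
  degree \<open>1\<close> with neighbour \<open>w\<close> is deleted and \<open>\<nu>\<^sub>w\<close> is replaced by \<open>\<nu>\<^sub>w - \<nu>\<^sub>q\<close>. Comparing different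
  deletions shows that \<open>\<nu>\<close> is constant on every leaf block off its cutvertex, and counting the neighbours
  of \<open>x\<close> in two leaf blocks leaves only complete graphs, subdivisions of \<open>K\<^sub>4\<close> and the Moser spindle. With \<open>1\<close> in
  place of \<open>2\<close> the same argument shows that the connected graphs without an AT orientation of positive
  indegrees are the Gallai trees.
\<close>

section \<open>Coefficients of the graph polynomial\<close>

text \<open>Up to sign, the polynomial of x + T has, as a polynomial in y_x, the polynomial of T as
  leading coefficient, and this times the sum of y_u over the neighbours u of x as next coefficient.
  If T has no good monomial, exponent deg x - 1 is the first one that can help: this is where the
  linear form comes from. Its vanishing decides the matter only if x has at most s + 1 neighbours,
  where s is the exponent demanded at x; otherwise it is merely necessary. In exchange it holds for
  every connected T' in T with more than s neighbours of x, because good monomials extend to larger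
  connected graphs. This family of conditions (\<open>hered\<close>) carries the counting.

  For s = 2 a leaf block leaves at most two neighbours of x on the far side, so two leaf blocks
  allow at most four. With three neighbours the form is decisive and yields the subdivisions of K4
  in both directions. With four only the spindle is left; there exponent deg x - 2 also occurs, so
  its coefficients are evaluated instead.

  On an induced path the form must have alternating sum 0. This is the source of the parities: odd
  cycles, and paths of equal parity in the subdivided K4.\<close>

text \<open>
  \<open>cf D d\<close> is the coefficient of \<open>\<Prod>\<^sub>v y\<^sub>v ^ d v\<close> in \<open>\<Prod>(y\<^sub>u - y\<^sub>v)\<close> over the arcs \<open>(u, v)\<close> of \<open>D\<close>; the set \<open>A\<close>
  consists of the arcs that contribute \<open>- y\<^sub>v\<close> to the monomial.
\<close>

definition expo :: "('a \<times> 'a) set \<Rightarrow> ('a \<times> 'a) set \<Rightarrow> 'a \<Rightarrow> nat" where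
  "expo D A v = card {e \<in> D - A. fst e = v} + card {e \<in> A. snd e = v}"

definition cf :: "('a \<times> 'a) set \<Rightarrow> ('a \<Rightarrow> nat) \<Rightarrow> int" where
  "cf D d = (\<Sum>A\<in>Pow D. if expo D A = d then (-1) ^ card A else 0)"

lemma expo_insert1:
  assumes "finite D" "e \<notin> D" "A \<subseteq> D"
  shows "expo (insert e D) A = (expo D A)(fst e := Suc (expo D A (fst e)))"
proof
  fix v
  have eq: "{a \<in> insert e D - A. fst a = v}
      = (if fst e = v then insert e {a \<in> D - A. fst a = v} else {a \<in> D - A. fst a = v})"
    using assms by auto
  show "expo (insert e D) A v = ((expo D A)(fst e := Suc (expo D A (fst e)))) v"
    using assms unfolding expo_def eq by auto
qed

lemma expo_insert2:
  assumes "finite D" "e \<notin> D" "A \<subseteq> D"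
  shows "expo (insert e D) (insert e A) = (expo D A)(snd e := Suc (expo D A (snd e)))"
proof
  fix v
  have eq: "{a \<in> insert e D - insert e A. fst a = v} = {a \<in> D - A. fst a = v}"
    using assms by auto
  have eq2: "{a \<in> insert e A. snd a = v}
      = (if snd e = v then insert e {a \<in> A. snd a = v} else {a \<in> A. snd a = v})"
    using assms by auto
  have "finite A" "e \<notin> A" using assms by (auto intro: finite_subset)
  then show "expo (insert e D) (insert e A) v = ((expo D A)(snd e := Suc (expo D A (snd e)))) v"
    using assms unfolding expo_def eq eq2 by auto
qed

lemma fun_upd_Suc_eq_iff:
  "g(u := Suc (g u)) = d \<longleftrightarrow> 0 < d u \<and> g = d(u := d u - 1)" for g d :: "'a \<Rightarrow> nat"
  by (auto simp: fun_eq_iff)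

lemma expo_empty: "expo {} {} = (\<lambda>_. 0)"
  by (auto simp: expo_def)

lemma cf_empty: "cf {} d = (if d = (\<lambda>_. 0) then 1 else 0)"
  unfolding cf_def by (auto simp: expo_empty)

text \<open>One more arc multiplies the polynomial by the tail variable minus the head variable. The
  guards keep truncated subtraction from producing a term where the exponent is already 0.\<close>

lemma cf_insert:
  assumes "finite D" "e \<notin> D"
  shows "cf (insert e D) d
    = (if 0 < d (fst e) then cf D (d(fst e := d (fst e) - 1)) else 0)
      - (if 0 < d (snd e) then cf D (d(snd e := d (snd e) - 1)) else 0)"
proof -
  let ?f = "\<lambda>D A. if expo D A = d then (-1::int) ^ card A else 0"
  have inj: "inj_on (insert e) (Pow D)"
    using assms(2) by (auto simp: inj_on_def)
  have disj: "Pow D \<inter> insert e ` Pow D = {}" using assms(2) by auto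
  have "cf (insert e D) d = sum (?f (insert e D)) (Pow D) + sum (?f (insert e D)) (insert e ` Pow D)"
    unfolding cf_def Pow_insert using assms(1) disj by (subst sum.union_disjoint) auto
  also have "sum (?f (insert e D)) (insert e ` Pow D) = (\<Sum>A\<in>Pow D. ?f (insert e D) (insert e A))"
    using inj by (simp add: sum.reindex)
  also have "\<dots> = (\<Sum>A\<in>Pow D. if 0 < d (snd e) then
        - (if expo D A = d(snd e := d (snd e) - 1) then (-1) ^ card A else 0) else 0)"
  proof (rule sum.cong[OF refl])
    fix A assume "A \<in> Pow D"
    then have A: "A \<subseteq> D" "finite A" "e \<notin> A" using assms by (auto intro: finite_subset)
    then show "?f (insert e D) (insert e A) = (if 0 < d (snd e) then
        - (if expo D A = d(snd e := d (snd e) - 1) then (-1) ^ card A else 0) else 0)"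
      by (auto simp: expo_insert2[OF assms A(1)] fun_upd_Suc_eq_iff)
  qed
  also have "\<dots> = - (if 0 < d (snd e) then cf D (d(snd e := d (snd e) - 1)) else 0)"
    by (simp add: cf_def sum_negf)
  also have "sum (?f (insert e D)) (Pow D) = (\<Sum>A\<in>Pow D. if 0 < d (fst e) then
        (if expo D A = d(fst e := d (fst e) - 1) then (-1) ^ card A else 0) else 0)"
    by (rule sum.cong[OF refl]) (auto simp: expo_insert1[OF assms] fun_upd_Suc_eq_iff)
  also have "\<dots> = (if 0 < d (fst e) then cf D (d(fst e := d (fst e) - 1)) else 0)"
    by (simp add: cf_def)
  finally show ?thesis by simp
qed

lemma cf_nonzeroE:
  assumes "cf D d \<noteq> 0"
  obtains A where "A \<subseteq> D" "expo D A = d"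
proof -
  have "\<exists>A\<in>Pow D. (if expo D A = d then (-1::int) ^ card A else 0) \<noteq> 0"
    using assms unfolding cf_def by (rule contrapos_np) (auto intro: sum.neutral)
  then show thesis using that by (auto split: if_splits)
qed

text \<open>Homogeneity: every arc contributes exactly one variable. It pins down the exponent at a
  shared vertex in \<open>AT_product\<close> and restricts the monomials to inspect for the triangle
  and the spindle.\<close>

lemma cf_sum:
  assumes "finite D" "finite W" "\<And>e. e \<in> D \<Longrightarrow> fst e \<in> W \<and> snd e \<in> W" "cf D d \<noteq> 0"
  shows "sum d W = card D"
  using assms(1,3,4)
proof (induction D arbitrary: d rule: finite_induct)
  case empty
  then show ?case by (auto simp: cf_empty split: if_splits)
next
  case (insert e D)
  have step: "sum d W = Suc (card D)" if "0 < d u" "u \<in> W" "cf D (d(u := d u - 1)) \<noteq> 0" for u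
  proof -
    have "sum (d(u := d u - 1)) W = card D" using insert that by blast
    moreover have "sum d W = d u + sum d (W - {u})"
      using assms(2) that by (simp add: sum.remove)
    moreover have "sum (d(u := d u - 1)) W = (d u - 1) + sum d (W - {u})"
      using assms(2) that by (simp add: sum.remove)
    ultimately show ?thesis using that by linarith
  qed
  have "(0 < d (fst e) \<and> cf D (d(fst e := d (fst e) - 1)) \<noteq> 0)
      \<or> (0 < d (snd e) \<and> cf D (d(snd e := d (snd e) - 1)) \<noteq> 0)"
    using insert.prems(2) insert.hyps by (auto simp: cf_insert split: if_splits)
  then show ?case using step insert by fastforce
qed

lemma cf_support:
  assumes "cf D d \<noteq> 0" "\<And>e. e \<in> D \<Longrightarrow> fst e \<noteq> v \<and> snd e \<noteq> v"
  shows "d v = 0"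
proof -
  obtain A where "A \<subseteq> D" "expo D A = d" using assms(1) by (rule cf_nonzeroE)
  then have "d v = card {e \<in> D - A. fst e = v} + card {e \<in> A. snd e = v}"
    by (auto simp: expo_def)
  moreover have 1: "{e \<in> D - A. fst e = v} = {}" using assms(2) by auto
  moreover have 2: "{e \<in> A. snd e = v} = {}" using assms(2) \<open>A \<subseteq> D\<close> by blast
  ultimately show ?thesis by (simp only: card.empty)
qed

section \<open>Expansion of the polynomial in a single variable\<close>

definition star_sign :: "'a \<Rightarrow> ('a \<times> 'a) set \<Rightarrow> int" where
  "star_sign q R = (-1) ^ card {e \<in> R. snd e = q}"

definition other_end :: "'a \<Rightarrow> 'a \<times> 'a \<Rightarrow> 'a" where
  "other_end q e = (if fst e = q then snd e else fst e)"

lemma star_sign_nonzero: "star_sign q R \<noteq> 0"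
  by (simp add: star_sign_def)

lemma star_sign_insert:
  assumes "finite R" "e \<notin> R"
  shows "star_sign q (insert e R) = (if snd e = q then - star_sign q R else star_sign q R)"
proof -
  have "{a \<in> insert e R. snd a = q} = (if snd e = q then insert e {a \<in> R. snd a = q} else {a \<in> R. snd a = q})"
    by auto
  then show ?thesis using assms by (auto simp: star_sign_def)
qed

text \<open>The arcs at \<open>q\<close> contribute factors \<open>y_q - y_u\<close> up to sign, so
  the degree in \<open>y_q\<close> is at most \<open>card R\<close>; taking \<open>y_q\<close> from
  every factor gives the top coefficient, and dropping it from exactly one factor gives the next.
  The three claims are proved together because the recursion for each uses the previous one. Writing
  \<open>Suc (d q)\<close> avoids subtracting from an empty star.\<close>

lemma cf_star:
  assumes "finite D" "\<And>e. e \<in> D \<Longrightarrow> fst e \<noteq> q \<and> snd e \<noteq> q"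
    and "finite R" "\<And>e. e \<in> R \<Longrightarrow> (fst e = q) \<noteq> (snd e = q)"
  shows "(card R < d q \<longrightarrow> cf (R \<union> D) d = 0)
    \<and> (d q = card R \<longrightarrow> cf (R \<union> D) d = star_sign q R * cf D (d(q := 0)))
    \<and> (Suc (d q) = card R \<longrightarrow> cf (R \<union> D) d = - star_sign q R *
      (\<Sum>e\<in>R. if 0 < d (other_end q e)
              then cf D (d(q := 0, other_end q e := d (other_end q e) - 1)) else 0))"
  using assms(3,4)
proof (induction R arbitrary: d rule: finite_induct)
  case empty
  have "cf D d = 0" if "0 < d q"
    using cf_support[of D d q] assms(2) that by fastforce
  moreover have "d(q := 0) = d" if "d q = 0" using that by auto
  ultimately show ?case by (simp add: star_sign_def)
next
  case (insert e R)
  have inc: "(fst e = q) \<noteq> (snd e = q)" and R: "\<And>e. e \<in> R \<Longrightarrow> (fst e = q) \<noteq> (snd e = q)"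
    using insert.prems by blast+
  note IH = insert.IH[OF R]
  note IH1 = IH[THEN conjunct1, rule_format]
    and IH2 = IH[THEN conjunct2, THEN conjunct1, rule_format]
    and IH3 = IH[THEN conjunct2, THEN conjunct2, rule_format]
  have fin: "finite (R \<union> D)" and e: "e \<notin> R \<union> D"
    using insert.hyps assms(1) assms(2)[of e] inc by auto
  define u where "u = other_end q e"
  have uq: "u \<noteq> q" using inc by (auto simp: u_def other_end_def)
  define s :: int where "s = (if snd e = q then -1 else 1)"
  have rec: "cf (insert e R \<union> D) d = s * ((if 0 < d q then cf (R \<union> D) (d(q := d q - 1)) else 0)
      - (if 0 < d u then cf (R \<union> D) (d(u := d u - 1)) else 0))" for d
    using inc cf_insert[OF fin e, of d] by (auto simp: s_def u_def other_end_def)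
  have sgn: "star_sign q (insert e R) = s * star_sign q R"
    using insert.hyps by (simp add: star_sign_insert s_def)
  have "cf (insert e R \<union> D) d = 0" if 1: "card (insert e R) < d q"
  proof -
    have "cf (R \<union> D) (d(q := d q - 1)) = 0" using 1 insert.hyps by (intro IH1) auto
    moreover have "cf (R \<union> D) (d(u := d u - 1)) = 0" using 1 insert.hyps uq by (intro IH1) auto
    ultimately show ?thesis unfolding rec by simp
  qed
  moreover have "cf (insert e R \<union> D) d = star_sign q (insert e R) * cf D (d(q := 0))"
    if 2: "d q = card (insert e R)"
  proof -
    have "cf (R \<union> D) (d(q := d q - 1)) = star_sign q R * cf D (d(q := 0))"
      using 2 insert.hyps by (subst IH2) auto
    moreover have "cf (R \<union> D) (d(u := d u - 1)) = 0" using 2 insert.hyps uq by (intro IH1) auto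
    ultimately show ?thesis unfolding rec sgn using 2 insert.hyps by simp
  qed
  moreover have "cf (insert e R \<union> D) d = - star_sign q (insert e R) *
      (\<Sum>e\<in>insert e R. if 0 < d (other_end q e)
              then cf D (d(q := 0, other_end q e := d (other_end q e) - 1)) else 0)"
    if 3: "Suc (d q) = card (insert e R)"
  proof -
    let ?g = "\<lambda>e. if 0 < d (other_end q e)
              then cf D (d(q := 0, other_end q e := d (other_end q e) - 1)) else 0"
    have dq: "d q = card R" using 3 insert.hyps by simp
    have a: "cf (R \<union> D) (d(u := d u - 1)) = star_sign q R * cf D (d(q := 0, u := d u - 1))"
      using dq uq by (subst IH2) (auto simp: fun_upd_twist)
    have b: "(if 0 < d q then cf (R \<union> D) (d(q := d q - 1)) else 0) = - star_sign q R * sum ?g R"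
    proof (cases "d q = 0")
      case True
      then show ?thesis using dq insert.hyps by simp
    next
      case False
      have oe: "\<And>e. e \<in> R \<Longrightarrow> other_end q e \<noteq> q" using R by (auto simp: other_end_def)
      show ?thesis using False dq oe
        by (subst IH3) (auto intro!: sum.cong)
    qed
    have c: "sum ?g (insert e R) = ?g e + sum ?g R" using insert.hyps by simp
    show ?thesis unfolding rec sgn b c using a by (auto simp: u_def algebra_simps)
  qed
  ultimately show ?case by blast
qed

section \<open>Products, reorientation and complementation\<close>

lemma expo_Un:
  assumes "finite D1" "finite D2" "D1 \<inter> D2 = {}" "A1 \<subseteq> D1" "A2 \<subseteq> D2"
  shows "expo (D1 \<union> D2) (A1 \<union> A2) = (\<lambda>v. expo D1 A1 v + expo D2 A2 v)"
proof
  fix v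
  have 1: "{e \<in> D1 \<union> D2 - (A1 \<union> A2). fst e = v} = {e \<in> D1 - A1. fst e = v} \<union> {e \<in> D2 - A2. fst e = v}"
    using assms by auto
  have 2: "{e \<in> A1 \<union> A2. snd e = v} = {e \<in> A1. snd e = v} \<union> {e \<in> A2. snd e = v}" by auto
  have "finite A1" "finite A2" using assms by (auto intro: finite_subset)
  moreover have "A1 \<inter> A2 = {}" using assms by auto
  ultimately have "card {e \<in> A1 \<union> A2. snd e = v} = card {e \<in> A1. snd e = v} + card {e \<in> A2. snd e = v}"
    unfolding 2 by (intro card_Un_disjoint) auto
  moreover have "card {e \<in> D1 \<union> D2 - (A1 \<union> A2). fst e = v}
      = card {e \<in> D1 - A1. fst e = v} + card {e \<in> D2 - A2. fst e = v}"
    unfolding 1 using assms by (intro card_Un_disjoint) auto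
  ultimately show "expo (D1 \<union> D2) (A1 \<union> A2) v = expo D1 A1 v + expo D2 A2 v"
    by (simp add: expo_def)
qed

text \<open>Coefficients of a product are convolutions. The summation runs over the exponent
  functions that arise from subsets of \<open>D1\<close>, a finite set containing the support of
  \<open>cf D1\<close>, because the type of all exponent functions need not be finite.\<close>

lemma cf_Un:
  assumes "finite D1" "finite D2" "D1 \<inter> D2 = {}"
  shows "cf (D1 \<union> D2) d = (\<Sum>d1 \<in> expo D1 ` Pow D1.
    if d1 \<le> d then cf D1 d1 * cf D2 (\<lambda>v. d v - d1 v) else 0)"
proof -
  let ?F = "\<lambda>A1 A2. if (\<lambda>v. expo D1 A1 v + expo D2 A2 v) = d
     then (-1::int) ^ card A1 * (-1) ^ card A2 else 0"
  let ?G = "\<lambda>d1 A1. if expo D1 A1 = d1 then (-1::int) ^ card A1 else 0"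
  let ?H = "\<lambda>d1. if d1 \<le> d then cf D2 (\<lambda>v. d v - d1 v) else 0"
  have bij: "bij_betw (\<lambda>(A1, A2). A1 \<union> A2) (Pow D1 \<times> Pow D2) (Pow (D1 \<union> D2))"
    by (rule bij_betw_byWitness[where f' = "\<lambda>A. (A \<inter> D1, A \<inter> D2)"]) (use assms(3) in auto)
  have inner: "(\<Sum>A2\<in>Pow D2. ?F A1 A2) = (-1) ^ card A1 * ?H (expo D1 A1)" if "A1 \<in> Pow D1" for A1
  proof -
    have "((\<lambda>v. expo D1 A1 v + expo D2 A2 v) = d)
        \<longleftrightarrow> expo D1 A1 \<le> d \<and> expo D2 A2 = (\<lambda>v. d v - expo D1 A1 v)" for A2
    proof -
      have "x + y = z \<longleftrightarrow> x \<le> z \<and> y = z - x" for x y z :: nat by linarith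
      then show ?thesis unfolding fun_eq_iff le_fun_def by blast
    qed
    then show ?thesis by (auto simp: cf_def sum_distrib_left intro!: sum.cong)
  qed
  have "cf (D1 \<union> D2) d = (\<Sum>(A1, A2)\<in>Pow D1 \<times> Pow D2. ?F A1 A2)"
    unfolding cf_def
  proof (subst sum.reindex_bij_betw[OF bij, symmetric], rule sum.cong[OF refl])
    fix p assume "p \<in> Pow D1 \<times> Pow D2"
    then obtain A1 A2 where p: "p = (A1, A2)" and A: "A1 \<subseteq> D1" "A2 \<subseteq> D2" by auto
    then have "finite A1" "finite A2" using assms by (auto intro: finite_subset)
    moreover have "A1 \<inter> A2 = {}" using A assms by auto
    ultimately show "(if expo (D1 \<union> D2) (case p of (A1, A2) \<Rightarrow> A1 \<union> A2) = d
        then (-1::int) ^ card (case p of (A1, A2) \<Rightarrow> A1 \<union> A2) else 0)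
        = (case p of (A1, A2) \<Rightarrow> ?F A1 A2)"
      using A expo_Un[OF assms] unfolding p by (simp add: card_Un_disjoint power_add)
  qed
  also have "\<dots> = (\<Sum>A1\<in>Pow D1. \<Sum>A2\<in>Pow D2. ?F A1 A2)"
    using assms by (simp add: sum.cartesian_product)
  also have "\<dots> = (\<Sum>A1\<in>Pow D1. (-1) ^ card A1 * ?H (expo D1 A1))"
    using inner by (intro sum.cong) auto
  also have "\<dots> = (\<Sum>A1\<in>Pow D1. \<Sum>d1\<in>expo D1 ` Pow D1. ?G d1 A1 * ?H d1)"
  proof (rule sum.cong[OF refl])
    fix A1 assume "A1 \<in> Pow D1"
    then have "(\<Sum>d1\<in>expo D1 ` Pow D1. ?G d1 A1 * ?H d1) = (\<Sum>d1\<in>{expo D1 A1}. ?G d1 A1 * ?H d1)"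
      using assms by (intro sum.mono_neutral_right) auto
    then show "(-1) ^ card A1 * ?H (expo D1 A1) = (\<Sum>d1\<in>expo D1 ` Pow D1. ?G d1 A1 * ?H d1)"
      by simp
  qed
  also have "\<dots> = (\<Sum>d1\<in>expo D1 ` Pow D1. cf D1 d1 * ?H d1)"
    unfolding cf_def by (subst sum.swap) (simp only: sum_distrib_right)
  finally show ?thesis by (auto intro!: sum.cong)
qed

lemma cf_flip:
  assumes "finite D" "(u, v) \<notin> D" "(v, u) \<notin> D"
  shows "cf (insert (v, u) D) d = - cf (insert (u, v) D) d"
  using assms by (simp add: cf_insert)

text \<open>Reversing an arc only negates its factor. The induction reverses the arcs of
  \<open>D\<close> that are absent from \<open>D'\<close> one at a time.\<close>

lemma cf_orientation_indep:
  assumes "finite D" "finite D'" "D \<inter> D\<inverse> = {}" "D' \<inter> D'\<inverse> = {}" "D \<union> D\<inverse> = D' \<union> D'\<inverse>"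
  shows "\<bar>cf D d\<bar> = \<bar>cf D' d\<bar>"
  using assms
proof (induction "card (D - D')" arbitrary: D rule: less_induct)
  case less
  show ?case
  proof (cases "D - D' = {}")
    case True
    have "D' \<subseteq> D"
    proof (rule subrelI)
      fix u v assume uv: "(u, v) \<in> D'"
      then have "(u, v) \<in> D \<or> (v, u) \<in> D" using less.prems by blast
      moreover have "(v, u) \<notin> D'" using uv less.prems by blast
      ultimately show "(u, v) \<in> D" using True by blast
    qed
    then show ?thesis using True by (metis Diff_eq_empty_iff subset_antisym)
  next
    case False
    then obtain u v where uv: "(u, v) \<in> D" "(u, v) \<notin> D'" by auto
    define D0 where "D0 = D - {(u, v)}"
    have D: "D = insert (u, v) D0" and n: "(u, v) \<notin> D0" "(v, u) \<notin> D0" "finite D0"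
      using uv less.prems by (auto simp: D0_def)
    have vu: "(v, u) \<in> D'" "u \<noteq> v" using uv less.prems(3,5) by blast+
    have c1: "card (insert (v, u) D0 - D') < card (D - D')"
      using uv vu less.prems by (intro psubset_card_mono) (auto simp: D0_def)
    have c2: "finite (insert (v, u) D0)" using n by simp
    have c3: "insert (v, u) D0 \<inter> (insert (v, u) D0)\<inverse> = {}"
    proof -
      have "D0 \<inter> D0\<inverse> = {}" using less.prems(3) unfolding D by blast
      then show ?thesis using vu(2) n by fast
    qed
    have c4: "insert (v, u) D0 \<union> (insert (v, u) D0)\<inverse> = D' \<union> D'\<inverse>"
      using less.prems(5) unfolding D by auto
    have "\<bar>cf (insert (v, u) D0) d\<bar> = \<bar>cf D' d\<bar>"
      by (rule less.hyps[OF c1 c2 less.prems(2) c3 less.prems(4) c4])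
    then show ?thesis unfolding D using cf_flip[OF n(3,1,2), of d] by simp
  qed
qed

text \<open>Replacing the choice \<open>A\<close> by \<open>D - A\<close> makes every arc contribute
  its other end, so the two exponents at a vertex add up to its degree, and the signs differ by the
  parity of \<open>card D\<close>.\<close>

lemma cf_complement:
  assumes "finite D" "d \<le> (\<lambda>v. card {e \<in> D. fst e = v} + card {e \<in> D. snd e = v})"
  shows "cf D (\<lambda>v. card {e \<in> D. fst e = v} + card {e \<in> D. snd e = v} - d v) = (-1) ^ card D * cf D d"
proof -
  let ?deg = "\<lambda>v. card {e \<in> D. fst e = v} + card {e \<in> D. snd e = v}"
  have ex: "expo D (D - A) v + expo D A v = ?deg v" if "A \<subseteq> D" for A v
  proof -
    have fA: "finite A" using that assms by (auto intro: finite_subset)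
    have 1: "{e \<in> D. fst e = v} = {e \<in> D - A. fst e = v} \<union> {e \<in> A. fst e = v}"
     and 2: "{e \<in> D. snd e = v} = {e \<in> D - A. snd e = v} \<union> {e \<in> A. snd e = v}"
     and 3: "D - (D - A) = A"
      using that by auto
    have "card {e \<in> D. fst e = v} = card {e \<in> D - A. fst e = v} + card {e \<in> A. fst e = v}"
      unfolding 1 using assms fA by (intro card_Un_disjoint) auto
    moreover have "card {e \<in> D. snd e = v} = card {e \<in> D - A. snd e = v} + card {e \<in> A. snd e = v}"
      unfolding 2 using assms fA by (intro card_Un_disjoint) auto
    ultimately show ?thesis by (simp add: expo_def 3)
  qed
  have bij: "bij_betw ((-) D) (Pow D) (Pow D)"
    by (rule bij_betw_byWitness[where f' = "(-) D"]) auto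
  have "cf D (\<lambda>v. ?deg v - d v) = (\<Sum>A\<in>Pow D. if expo D (D - A) = (\<lambda>v. ?deg v - d v) then (-1) ^ card (D - A) else 0)"
    unfolding cf_def by (subst sum.reindex_bij_betw[OF bij, symmetric]) simp
  also have "\<dots> = (\<Sum>A\<in>Pow D. (-1) ^ card D * (if expo D A = d then (-1) ^ card A else 0))"
  proof (rule sum.cong[OF refl])
    fix A assume A: "A \<in> Pow D"
    then have "card D = card A + card (D - A)"
      using assms by (metis PowD card_mono card_Diff_subset finite_subset le_add_diff_inverse)
    then have s: "(-1::int) ^ card (D - A) = (-1) ^ card D * (-1) ^ card A"
      by (simp add: power_add flip: power_mult_distrib)
    have "expo D (D - A) = (\<lambda>v. ?deg v - d v) \<longleftrightarrow> expo D A = d"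
    proof
      assume h: "expo D (D - A) = (\<lambda>v. ?deg v - d v)"
      show "expo D A = d"
      proof
        fix v show "expo D A v = d v"
          using ex[of A v] A fun_cong[OF h, of v] le_funD[OF assms(2), of v] by simp
      qed
    next
      assume h: "expo D A = d"
      show "expo D (D - A) = (\<lambda>v. ?deg v - d v)"
      proof
        fix v show "expo D (D - A) v = ?deg v - d v"
          using ex[of A v] A h by simp
      qed
    qed
    then show "(if expo D (D - A) = (\<lambda>v. ?deg v - d v) then (-1) ^ card (D - A) else 0)
       = (-1) ^ card D * (if expo D A = d then (-1::int) ^ card A else 0)"
      using s by simp
  qed
  finally show ?thesis by (simp add: cf_def sum_distrib_left)
qed

section \<open>Monomials bounded from below\<close>

text \<open>The value 2 encodes \<open>h_vert x\<close> after complementation; the value 1 is the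
  uniform bound that characterises Gallai trees. Keeping \<open>s\<close> as a parameter lets both
  questions share the leaf-block arguments.\<close>

definition demand :: "'a \<Rightarrow> nat \<Rightarrow> 'a \<Rightarrow> nat" where
  "demand x s v = (if v = x then s else 1)"

lemma demand_1: "demand x 1 = (\<lambda>_. 1)"
  by (auto simp: demand_def)

text \<open>One ambient orientation is fixed, and every graph in the argument is the subgraph
  induced on a vertex set. Deleting vertices is then set difference, and the direction of arcs
  affects signs only.\<close>

locale ograph =
  fixes D :: "('a \<times> 'a) set"
  assumes finite_D: "finite D"
    and asym_D: "(u, v) \<in> D \<Longrightarrow> (v, u) \<notin> D"
begin

definition adj :: "'a \<Rightarrow> 'a \<Rightarrow> bool" where
  "adj u v \<longleftrightarrow> (u, v) \<in> D \<or> (v, u) \<in> D"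

definition rs :: "'a set \<Rightarrow> ('a \<times> 'a) set" where
  "rs W = {e \<in> D. fst e \<in> W \<and> snd e \<in> W}"

definition nb :: "'a set \<Rightarrow> 'a \<Rightarrow> 'a set" where
  "nb W q = {u \<in> W. adj q u}"

definition AT :: "('a \<Rightarrow> nat) \<Rightarrow> 'a set \<Rightarrow> bool" where
  "AT f W \<longleftrightarrow> (\<exists>d. (\<forall>v\<in>W. f v \<le> d v) \<and> (\<forall>v. v \<notin> W \<longrightarrow> d v = 0) \<and> cf (rs W) d \<noteq> 0)"

abbreviation AT1 :: "'a set \<Rightarrow> bool" where
  "AT1 \<equiv> AT (\<lambda>_. 1)"

lemma adj_sym: "adj u v \<Longrightarrow> adj v u"
  by (auto simp: adj_def)

lemma adj_irrefl: "\<not> adj u u"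
  using asym_D by (auto simp: adj_def)

lemma finite_rs: "finite (rs W)"
  using finite_D by (auto simp: rs_def)

lemma finite_nb: "finite (nb W q)"
proof -
  have "nb W q \<subseteq> fst ` D \<union> snd ` D" by (force simp: nb_def adj_def)
  then show ?thesis using finite_D by (meson finite_UnI finite_imageI finite_subset)
qed

lemma nb_insert: "nb (insert v W) q = (if adj q v then insert v (nb W q) else nb W q)"
  by (auto simp: nb_def)

definition star :: "'a set \<Rightarrow> 'a \<Rightarrow> ('a \<times> 'a) set" where
  "star W q = {e \<in> D. fst e = q \<and> snd e \<in> W \<or> snd e = q \<and> fst e \<in> W}"

lemma star_facts:
  assumes "q \<notin> W"
  shows "rs (insert q W) = star W q \<union> rs W"
    and "finite (star W q)"
    and "\<And>e. e \<in> star W q \<Longrightarrow> (fst e = q) \<noteq> (snd e = q)"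
    and "\<And>e. e \<in> rs W \<Longrightarrow> fst e \<noteq> q \<and> snd e \<noteq> q"
    and "bij_betw (other_end q) (star W q) (nb W q)"
proof -
  show "rs (insert q W) = star W q \<union> rs W"
    using asym_D[of q q] by (auto simp: rs_def star_def)
  show "finite (star W q)" using finite_D by (auto simp: star_def)
  show "\<And>e. e \<in> star W q \<Longrightarrow> (fst e = q) \<noteq> (snd e = q)"
    using assms by (auto simp: star_def)
  show "\<And>e. e \<in> rs W \<Longrightarrow> fst e \<noteq> q \<and> snd e \<noteq> q"
    using assms by (auto simp: rs_def)
  show "bij_betw (other_end q) (star W q) (nb W q)"
    unfolding bij_betw_def
  proof
    show "inj_on (other_end q) (star W q)"
      using asym_D assms by (auto simp: inj_on_def other_end_def star_def)
    show "other_end q ` star W q = nb W q"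
    proof
      show "other_end q ` star W q \<subseteq> nb W q"
        using assms by (auto simp: other_end_def star_def nb_def adj_def)
      show "nb W q \<subseteq> other_end q ` star W q"
      proof
        fix u assume u: "u \<in> nb W q"
        then consider "(q, u) \<in> D" | "(u, q) \<in> D" by (auto simp: nb_def adj_def)
        then show "u \<in> other_end q ` star W q"
        proof cases
          case 1
          then show ?thesis using u by (intro image_eqI[of _ _ "(q, u)"]) (auto simp: other_end_def star_def nb_def)
        next
          case 2
          then show ?thesis using u assms
            by (intro image_eqI[of _ _ "(u, q)"]) (auto simp: other_end_def star_def nb_def)
        qed
      qed
    qed
  qed
qed

definition sg :: "'a set \<Rightarrow> 'a \<Rightarrow> int" where
  "sg W q = star_sign q (star W q)"

lemma sg_nonzero: "sg W q \<noteq> 0"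
  by (simp add: sg_def star_sign_nonzero)

lemma cf_above_deg:
  assumes "q \<notin> W" "card (nb W q) < d q"
  shows "cf (rs (insert q W)) d = 0"
  using cf_star[OF finite_rs star_facts(4)[OF assms(1)] star_facts(2,3)[OF assms(1)], where d = d]
    assms(2) bij_betw_same_card[OF star_facts(5)[OF assms(1)]]
  by (simp add: star_facts(1)[OF assms(1)])

lemma cf_deg:
  assumes "q \<notin> W" "d q = card (nb W q)"
  shows "cf (rs (insert q W)) d = sg W q * cf (rs W) (d(q := 0))"
  using cf_star[OF finite_rs star_facts(4)[OF assms(1)] star_facts(2,3)[OF assms(1)], where d = d]
    assms(2) bij_betw_same_card[OF star_facts(5)[OF assms(1)]]
  by (simp add: star_facts(1)[OF assms(1)] sg_def)

lemma cf_deg_minus_1: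
  assumes "q \<notin> W" "Suc (d q) = card (nb W q)"
  shows "cf (rs (insert q W)) d = - sg W q * (\<Sum>u\<in>nb W q.
    if 0 < d u then cf (rs W) (d(q := 0, u := d u - 1)) else 0)"
  using cf_star[OF finite_rs star_facts(4)[OF assms(1)] star_facts(2,3)[OF assms(1)], where d = d]
    assms(2) bij_betw_same_card[OF star_facts(5)[OF assms(1)]]
  by (simp add: star_facts(1)[OF assms(1)] sg_def flip: sum.reindex_bij_betw[OF star_facts(5)[OF assms(1)]])

lemma AT_mono_demand: "AT f W \<Longrightarrow> (\<And>v. v \<in> W \<Longrightarrow> g v \<le> f v) \<Longrightarrow> AT g W"
  unfolding AT_def by (meson le_trans)

text \<open>Give \<open>q\<close> its full degree into \<open>W\<close> as exponent: the coefficient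
  is then, up to sign, the old one.\<close>

lemma AT_insert:
  assumes "AT f W" "q \<notin> W" "f q \<le> card (nb W q)"
  shows "AT f (insert q W)"
proof -
  obtain d where d: "\<forall>v\<in>W. f v \<le> d v" "\<forall>v. v \<notin> W \<longrightarrow> d v = 0" "cf (rs W) d \<noteq> 0"
    using assms(1) by (auto simp: AT_def)
  let ?d = "d(q := card (nb W q))"
  have "cf (rs (insert q W)) ?d = sg W q * cf (rs W) (?d(q := 0))"
    by (rule cf_deg) (use assms in auto)
  moreover have "?d(q := 0) = d" using d assms by auto
  ultimately have "cf (rs (insert q W)) ?d \<noteq> 0" using d sg_nonzero by simp
  then show ?thesis unfolding AT_def using d assms
    by (intro exI[of _ ?d]) auto
qed

text \<open>No exponent exceeds the degree, so a demand of at least the degree forces equality, and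
  the leading coefficient in \<open>y_q\<close> hands the monomial down to \<open>W\<close>.\<close>

lemma AT_insert_deg:
  assumes "AT f (insert q W)" "q \<notin> W" "card (nb W q) \<le> f q"
  shows "AT f W" "f q = card (nb W q)"
proof -
  obtain d where d: "\<forall>v\<in>insert q W. f v \<le> d v" "\<forall>v. v \<notin> insert q W \<longrightarrow> d v = 0"
    "cf (rs (insert q W)) d \<noteq> 0"
    using assms(1) by (auto simp: AT_def)
  have "\<not> card (nb W q) < d q" using cf_above_deg d assms by blast
  then have q: "d q = card (nb W q)" "f q = card (nb W q)" using d assms by auto
  then show "f q = card (nb W q)" by simp
  have "cf (rs W) (d(q := 0)) \<noteq> 0" using cf_deg[of q W d] d q assms by auto
  then show "AT f W" unfolding AT_def using d assms
    by (intro exI[of _ "d(q := 0)"]) auto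
qed

text \<open>Connectivity through cuts rather than walks: every proper nonempty part has an edge
  leaving it. All later uses extract such an edge, and the vertex sets need no path objects.\<close>

definition conn :: "'a set \<Rightarrow> bool" where
  "conn W \<longleftrightarrow> W \<noteq> {} \<and>
     (\<forall>S. S \<subseteq> W \<longrightarrow> S \<noteq> {} \<longrightarrow> S \<noteq> W \<longrightarrow> (\<exists>u\<in>S. \<exists>v\<in>W - S. adj u v))"

lemma connE:
  assumes "conn W" "S \<subseteq> W" "S \<noteq> {}" "S \<noteq> W"
  obtains u v where "u \<in> S" "v \<in> W - S" "adj u v"
  using assms unfolding conn_def by blast

lemma conn_nonempty: "conn W \<Longrightarrow> W \<noteq> {}"
  by (simp add: conn_def)

lemma conn_singleton: "conn {v}"
  by (auto simp: conn_def)

text \<open>By symmetry of adjacency it suffices to consider cuts that avoid a given vertex.\<close>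

lemma connI:
  assumes "r \<in> W" "\<And>S. S \<subseteq> W \<Longrightarrow> S \<noteq> {} \<Longrightarrow> r \<notin> S \<Longrightarrow> \<exists>u\<in>S. \<exists>v\<in>W - S. adj u v"
  shows "conn W"
  unfolding conn_def
proof (intro conjI allI impI)
  show "W \<noteq> {}" using assms by auto
  fix S assume S: "S \<subseteq> W" "S \<noteq> {}" "S \<noteq> W"
  show "\<exists>u\<in>S. \<exists>v\<in>W - S. adj u v"
  proof (cases "r \<in> S")
    case False
    then show ?thesis using assms S by blast
  next
    case True
    then obtain u v where "u \<in> W - S" "v \<in> W - (W - S)" "adj u v"
      using assms(2)[of "W - S"] S by blast
    then show ?thesis using adj_sym by blast
  qed
qed

lemma conn_insert:
  assumes "conn W" "u \<in> W" "adj q u"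
  shows "conn (insert q W)"
proof (cases "q \<in> W")
  case True
  then show ?thesis using assms by (simp add: insert_absorb)
next
  case False
  show ?thesis
  proof (rule connI[of q])
    fix S assume S: "S \<subseteq> insert q W" "S \<noteq> {}" "q \<notin> S"
    show "\<exists>u\<in>S. \<exists>v\<in>insert q W - S. adj u v"
    proof (cases "S = W")
      case True
      then show ?thesis using assms False adj_sym by blast
    next
      case False
      then show ?thesis using connE[OF assms(1), of S] S by blast
    qed
  qed simp
qed

lemma conn_Un:
  assumes "conn A" "conn B" "A \<inter> B \<noteq> {}"
  shows "conn (A \<union> B)"
proof -
  obtain r where r: "r \<in> A" "r \<in> B" using assms by blast
  show ?thesis
  proof (rule connI[of r])
    fix S assume S: "S \<subseteq> A \<union> B" "S \<noteq> {}" "r \<notin> S"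
    have *: "\<exists>u\<in>S. \<exists>v\<in>C - S. adj u v" if "S \<inter> C \<noteq> {}" "conn C" "r \<in> C" for C
      using connE[OF that(2), of "S \<inter> C"] that S by blast
    show "\<exists>u\<in>S. \<exists>v\<in>A \<union> B - S. adj u v"
      using *[of A] *[of B] S r assms by blast
  qed (use r in auto)
qed

lemma conn_Un_edge:
  assumes "conn A" "conn B" "a \<in> A" "b \<in> B" "adj a b"
  shows "conn (A \<union> B)"
proof -
  have "conn (insert a B)" using conn_insert[OF assms(2,4,5)] .
  then have "conn (A \<union> insert a B)" using assms by (intro conn_Un) auto
  moreover have "A \<union> insert a B = A \<union> B" using assms by auto
  ultimately show ?thesis by simp
qed

lemma conn_extend:
  assumes "conn W" "W' \<subseteq> W" "W' \<noteq> {}" "W' \<noteq> W"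
  obtains q where "q \<in> W - W'" "nb W' q \<noteq> {}"
proof -
  obtain u v where "u \<in> W'" "v \<in> W - W'" "adj u v" using connE[OF assms] .
  then show thesis using that[of v] adj_sym by (auto simp: nb_def)
qed

text \<open>A maximal connected proper subset \<open>M\<close> above \<open>W'\<close> has a
  neighbour \<open>q\<close> in \<open>W\<close>, and maximality makes \<open>M\<close> plus
  \<open>q\<close> everything; so \<open>M\<close> is \<open>W\<close> without the single vertex
  \<open>q\<close>.\<close>

lemma conn_remove_outside:
  assumes "conn W" "finite W" "conn W'" "W' \<subseteq> W" "W' \<noteq> W"
  obtains q where "q \<in> W - W'" "conn (W - {q})"
proof -
  let ?M = "{M. conn M \<and> W' \<subseteq> M \<and> M \<subset> W}"
  have fin: "finite ?M" using assms(2) by (intro finite_subset[of ?M "Pow W"]) auto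
  have "W' \<in> ?M" using assms by auto
  from finite_has_maximal2[OF fin this]
  obtain M where M: "M \<in> ?M" and max: "\<And>M'. M' \<in> ?M \<Longrightarrow> M \<subseteq> M' \<Longrightarrow> M = M'" by auto
  then have "M \<subseteq> W" "M \<noteq> {}" "M \<noteq> W" using conn_nonempty by auto
  from conn_extend[OF assms(1) this] obtain q where q: "q \<in> W - M" "nb M q \<noteq> {}" .
  then have "conn (insert q M)" using M conn_insert by (auto simp: nb_def)
  then have "insert q M = W" using max[of "insert q M"] M q by blast
  then have "M = W - {q}" using q by auto
  then show thesis using that[of q] M q by auto
qed

text \<open>Vertices are added so that each has a neighbour already present; its exponent is then at
  least 1, which is all that is demanded outside \<open>W'\<close>.\<close>

lemma AT_superset:
  assumes "conn W" "finite W" "W' \<subseteq> W" "W' \<noteq> {}" "AT f W'" "\<And>v. v \<in> W - W' \<Longrightarrow> f v \<le> 1"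
  shows "AT f W"
  using assms(3-)
proof (induction "card (W - W')" arbitrary: W' rule: less_induct)
  case less
  show ?case
  proof (cases "W' = W")
    case True
    then show ?thesis using less by simp
  next
    case False
    then obtain q where q: "q \<in> W - W'" "nb W' q \<noteq> {}"
      using conn_extend[OF assms(1)] less by blast
    have "1 \<le> card (nb W' q)" using q finite_nb by (simp add: card_gt_0_iff Suc_leI)
    then have "AT f (insert q W')" using less.prems q
      by (intro AT_insert) (auto intro: order_trans)
    moreover have "card (W - insert q W') < card (W - W')"
      using q assms(2) by (intro psubset_card_mono) auto
    ultimately show ?thesis using less.hyps[of "insert q W'"] less.prems q by blast
  qed
qed

lemma AT1_superset: "conn W \<Longrightarrow> finite W \<Longrightarrow> W' \<subseteq> W \<Longrightarrow> W' \<noteq> {} \<Longrightarrow> AT1 W' \<Longrightarrow> AT1 W"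
  by (rule AT_superset) auto

section \<open>Factorisation at a cutvertex\<close>

lemma rs_Un:
  assumes "\<And>u v. u \<in> W1 - W2 \<Longrightarrow> v \<in> W2 - W1 \<Longrightarrow> \<not> adj u v"
  shows "rs (W1 \<union> W2) = rs W1 \<union> rs W2"
proof (rule set_eqI)
  fix e
  have "(u, v) \<notin> D \<and> (v, u) \<notin> D" if "u \<in> W1 - W2" "v \<in> W2 - W1" for u v
    using assms that by (auto simp: adj_def)
  then show "e \<in> rs (W1 \<union> W2) \<longleftrightarrow> e \<in> rs W1 \<union> rs W2"
    by (cases e) (simp add: rs_def, metis DiffI)
qed

lemma cf_split:
  assumes "W1 \<inter> W2 \<subseteq> {c}" "\<And>u v. u \<in> W1 - W2 \<Longrightarrow> v \<in> W2 - W1 \<Longrightarrow> \<not> adj u v"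
    and nz: "cf (rs (W1 \<union> W2)) d \<noteq> 0"
  obtains d1 d2 where "cf (rs W1) d1 \<noteq> 0" "cf (rs W2) d2 \<noteq> 0" "\<forall>v. d1 v + d2 v = d v"
    "\<forall>v. v \<notin> W1 \<longrightarrow> d1 v = 0" "\<forall>v. v \<notin> W2 \<longrightarrow> d2 v = 0"
proof -
  have d: "cf (rs W1 \<union> rs W2) d \<noteq> 0" using nz rs_Un[OF assms(2)] by simp
  have "rs W1 \<inter> rs W2 = {}" using assms(1) asym_D by (auto simp: rs_def) blast
  then have "(\<Sum>d1 \<in> expo (rs W1) ` Pow (rs W1).
      if d1 \<le> d then cf (rs W1) d1 * cf (rs W2) (\<lambda>v. d v - d1 v) else 0) \<noteq> 0"
    using d cf_Un[OF finite_rs finite_rs] by simp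
  then obtain d1 where "(if d1 \<le> d then cf (rs W1) d1 * cf (rs W2) (\<lambda>v. d v - d1 v) else 0) \<noteq> 0"
    by (rule sum.not_neutral_contains_not_neutral)
  then have d1: "d1 \<le> d" "cf (rs W1) d1 \<noteq> 0" "cf (rs W2) (\<lambda>v. d v - d1 v) \<noteq> 0"
    by (auto split: if_splits)
  show thesis
  proof (rule that[OF d1(2,3)]; intro allI impI)
    fix v
    show "d1 v + (d v - d1 v) = d v" using d1(1) by (simp add: le_fun_def)
    show "d1 v = 0" if "v \<notin> W1"
      using cf_support[OF d1(2), of v] that by (auto simp: rs_def)
    show "d v - d1 v = 0" if "v \<notin> W2"
      using cf_support[OF d1(3), of v] that by (auto simp: rs_def)
  qed
qed

text \<open>Only at \<open>c\<close> can both factors contribute to an exponent. If the second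
  factor has exponent 0 somewhere on \<open>W2\<close>, this must be at \<open>c\<close>, and then
  the first factor alone meets the whole demand on \<open>W1\<close>.\<close>

lemma AT_glue:
  assumes "W1 \<inter> W2 \<subseteq> {c}" "\<And>u v. u \<in> W1 - W2 \<Longrightarrow> v \<in> W2 - W1 \<Longrightarrow> \<not> adj u v"
    and "AT f (W1 \<union> W2)" "\<And>v. v \<in> W2 \<Longrightarrow> 1 \<le> f v"
  shows "AT f W1 \<or> AT1 W2"
proof -
  obtain d where d: "\<forall>v\<in>W1 \<union> W2. f v \<le> d v" "cf (rs (W1 \<union> W2)) d \<noteq> 0"
    using assms(3) by (auto simp: AT_def)
  obtain d1 d2 where nz: "cf (rs W1) d1 \<noteq> 0" "cf (rs W2) d2 \<noteq> 0" and sum: "\<forall>v. d1 v + d2 v = d v"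
    and off1: "\<forall>v. v \<notin> W1 \<longrightarrow> d1 v = 0" and off2: "\<forall>v. v \<notin> W2 \<longrightarrow> d2 v = 0"
    using cf_split[OF assms(1,2) d(2)] .
  show ?thesis
  proof (cases "\<forall>v\<in>W2. 1 \<le> d2 v")
    case True
    then show ?thesis using off2 nz(2) by (auto simp: AT_def)
  next
    case False
    then obtain z where z: "z \<in> W2" "d2 z = 0" by (auto simp: not_le)
    have "f z \<le> d z" using d(1) z(1) by blast
    then have "d1 z \<noteq> 0" using sum[rule_format, of z] z(2) assms(4)[OF z(1)] by linarith
    then have "z \<in> W1" using off1[rule_format, of z] by auto
    then have zc: "z = c" using z assms by auto
    have "f v \<le> d1 v" if "v \<in> W1" for v
    proof (cases "v \<in> W2")
      case True
      then have "v = z" using that zc assms by auto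
      then show ?thesis using sum[rule_format, of v] z d that by simp
    next
      case False
      then show ?thesis using sum[rule_format, of v] off2[rule_format, of v] d that by simp
    qed
    then show ?thesis using off1 nz(1) by (auto simp: AT_def)
  qed
qed

text \<open>Without a shared vertex each factor inherits its own exponents. This is why a single
  Gallai component of G - x suffices when x has degree 2.\<close>

lemma AT_disjoint:
  assumes "W1 \<inter> W2 = {}" "\<And>u v. u \<in> W1 \<Longrightarrow> v \<in> W2 \<Longrightarrow> \<not> adj u v" "AT f (W1 \<union> W2)"
  shows "AT f W2"
proof -
  obtain d where d: "\<forall>v\<in>W1 \<union> W2. f v \<le> d v" "cf (rs (W1 \<union> W2)) d \<noteq> 0"
    using assms(3) by (auto simp: AT_def)
  obtain d1 d2 where nz: "cf (rs W1) d1 \<noteq> 0" "cf (rs W2) d2 \<noteq> 0" and sum: "\<forall>v. d1 v + d2 v = d v"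
    and off1: "\<forall>v. v \<notin> W1 \<longrightarrow> d1 v = 0" and off2: "\<forall>v. v \<notin> W2 \<longrightarrow> d2 v = 0"
    using cf_split[of W1 W2 undefined d, OF _ _ d(2)] assms(1,2) by auto
  have "f v \<le> d2 v" if "v \<in> W2" for v
  proof -
    have "v \<notin> W1" using that assms(1) by auto
    then show ?thesis using sum[rule_format, of v] off1[rule_format, of v] d(1) that by simp
  qed
  then show ?thesis using off2 nz(2) by (auto simp: AT_def)
qed

text \<open>Demands add at the shared vertex. There is no cancellation: two ways of splitting the
  exponents agree off \<open>c\<close>, and homogeneity of the first factor makes them agree at
  \<open>c\<close>, so the convolution has a single nonzero term.\<close>

lemma AT_product:
  assumes "finite W1" "finite W2" "W1 \<inter> W2 \<subseteq> {c}"
    and "\<And>u v. u \<in> W1 - W2 \<Longrightarrow> v \<in> W2 - W1 \<Longrightarrow> \<not> adj u v"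
    and "AT f1 W1" "AT f2 W2"
    and "\<And>v. v \<in> W1 \<union> W2 \<Longrightarrow> g v \<le> (if v \<in> W1 then f1 v else 0) + (if v \<in> W2 then f2 v else 0)"
  shows "AT g (W1 \<union> W2)"
proof -
  obtain d1 where d1: "\<forall>v\<in>W1. f1 v \<le> d1 v" "\<forall>v. v \<notin> W1 \<longrightarrow> d1 v = 0" "cf (rs W1) d1 \<noteq> 0"
    using assms(5) by (auto simp: AT_def)
  obtain d2 where d2: "\<forall>v\<in>W2. f2 v \<le> d2 v" "\<forall>v. v \<notin> W2 \<longrightarrow> d2 v = 0" "cf (rs W2) d2 \<noteq> 0"
    using assms(6) by (auto simp: AT_def)
  let ?d = "\<lambda>v. d1 v + d2 v"
  have disj: "rs W1 \<inter> rs W2 = {}" using assms(3) asym_D by (auto simp: rs_def) blast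
  let ?t = "\<lambda>e. if e \<le> ?d then cf (rs W1) e * cf (rs W2) (\<lambda>v. ?d v - e v) else 0"
  have uniq: "?t e = 0" if "e \<noteq> d1" for e
  proof (rule ccontr)
    assume "?t e \<noteq> 0"
    then have e: "e \<le> ?d" "cf (rs W1) e \<noteq> 0" "cf (rs W2) (\<lambda>v. ?d v - e v) \<noteq> 0"
      by (auto split: if_splits)
    have off1: "e v = 0" if "v \<notin> W1" for v
      using cf_support[OF e(2), of v] that by (auto simp: rs_def)
    have off2: "?d v = e v" if "v \<notin> W2" for v
      using cf_support[OF e(3), of v] that le_funD[OF e(1), of v] by (auto simp: rs_def)
    have nc: "e v = d1 v" if "v \<noteq> c" for v
      using off1[of v] off2[of v] d1 d2 that assms(3) by (cases "v \<in> W1"; cases "v \<in> W2") auto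
    have "sum e W1 = sum d1 W1"
      using cf_sum[OF finite_rs assms(1) _ e(2)] cf_sum[OF finite_rs assms(1) _ d1(3)]
      by (auto simp: rs_def)
    moreover have "sum e (W1 - {c}) = sum d1 (W1 - {c})" using nc by (intro sum.cong) auto
    ultimately have "c \<in> W1 \<Longrightarrow> e c = d1 c" using assms(1) by (simp add: sum.remove)
    then have "e c = d1 c" using off1 d1 by metis
    then have "e = d1" using nc by (metis ext)
    then show False using that by simp
  qed
  have mem: "d1 \<in> expo (rs W1) ` Pow (rs W1)"
    using d1(3) by (auto elim: cf_nonzeroE)
  have "cf (rs W1 \<union> rs W2) ?d = (\<Sum>e\<in>expo (rs W1) ` Pow (rs W1). ?t e)"
    by (rule cf_Un[OF finite_rs finite_rs disj])
  also have "\<dots> = (\<Sum>e\<in>{d1}. ?t e)"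
    using uniq mem finite_rs by (intro sum.mono_neutral_right) auto
  also have "\<dots> = cf (rs W1) d1 * cf (rs W2) d2" by (simp add: le_fun_def)
  finally have "cf (rs (W1 \<union> W2)) ?d \<noteq> 0" using d1 d2 rs_Un[OF assms(4)] by simp
  moreover have "g v \<le> ?d v" if "v \<in> W1 \<union> W2" for v
  proof -
    have "(if v \<in> W1 then f1 v else 0) \<le> d1 v" "(if v \<in> W2 then f2 v else 0) \<le> d2 v"
      using d1 d2 by auto
    then show ?thesis using assms(7)[OF that] by linarith
  qed
  ultimately show ?thesis unfolding AT_def using d1 d2 by (intro exI[of _ ?d]) auto
qed

text \<open>
  \<open>Z T \<nu>\<close>: the product of the graph polynomial of \<open>T\<close> with the linear form \<open>\<Sum>\<nu>\<^sub>u y\<^sub>u\<close> has no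
  monomial divisible by all variables. It detects the orientations in which \<open>x\<close> has outdegree 1.
\<close>

definition Z :: "'a set \<Rightarrow> ('a \<Rightarrow> int) \<Rightarrow> bool" where
  "Z T \<nu> \<longleftrightarrow> (\<forall>d. (\<forall>v\<in>T. 1 \<le> d v) \<longrightarrow> (\<forall>v. v \<notin> T \<longrightarrow> d v = 0) \<longrightarrow>
     (\<Sum>u\<in>T. \<nu> u * cf (rs T) (d(u := d u - 1))) = 0)"

lemma Z_diff: "Z T \<nu> \<Longrightarrow> Z T \<mu> \<Longrightarrow> Z T (\<lambda>v. \<nu> v - \<mu> v)"
  unfolding Z_def by (simp add: left_diff_distrib sum_subtractf)

lemma Z_cong: "(\<And>v. v \<in> T \<Longrightarrow> \<nu> v = \<mu> v) \<Longrightarrow> Z T \<nu> \<longleftrightarrow> Z T \<mu>"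
  unfolding Z_def by (simp cong: sum.cong)

lemma Z_singleton: "Z {w} \<nu> \<Longrightarrow> \<nu> w = 0"
proof -
  assume Z: "Z {w} \<nu>"
  let ?d = "(\<lambda>_. 0)(w := 1)"
  have "(\<Sum>u\<in>{w}. \<nu> u * cf (rs {w}) (?d(u := ?d u - 1))) = 0"
    using Z unfolding Z_def by (elim allE[of _ ?d]) auto
  moreover have "rs {w} = {}" using asym_D by (auto simp: rs_def)
  ultimately show ?thesis by (simp add: cf_empty fun_eq_iff)
qed

text \<open>Take the exponent of \<open>q\<close> to be its degree. The term in which the form
  supplies \<open>y_q\<close> leaves exponent at least 1 at \<open>q\<close> and vanishes since the
  graph is not \<open>AT1\<close>; all other terms reduce to the leading coefficient in
  \<open>y_q\<close>.\<close>

lemma Z_delete: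
  fixes \<nu> :: "'a \<Rightarrow> int"
  assumes "finite T" "q \<notin> T" "2 \<le> card (nb T q)" "\<not> AT1 (insert q T)" "Z (insert q T) \<nu>"
  shows "Z T \<nu>"
  unfolding Z_def
proof (intro allI impI)
  fix d :: "'a \<Rightarrow> nat" assume d: "\<forall>v\<in>T. 1 \<le> d v" "\<forall>v. v \<notin> T \<longrightarrow> d v = 0"
  let ?d = "d(q := card (nb T q))"
  have "(\<Sum>u\<in>insert q T. \<nu> u * cf (rs (insert q T)) (?d(u := ?d u - 1))) = 0"
    using assms(3,5) d unfolding Z_def by (elim allE[of _ ?d]) auto
  moreover have "cf (rs (insert q T)) (?d(q := ?d q - 1)) = 0"
  proof -
    have "\<forall>v\<in>insert q T. 1 \<le> (?d(q := ?d q - 1)) v" "\<forall>v. v \<notin> insert q T \<longrightarrow> (?d(q := ?d q - 1)) v = 0"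
      using d assms(2,3) by auto
    then show ?thesis using assms(4) unfolding AT_def by blast
  qed
  moreover have "cf (rs (insert q T)) (?d(u := ?d u - 1)) = sg T q * cf (rs T) (d(u := d u - 1))"
    if "u \<in> T" for u
  proof -
    have "u \<noteq> q" using that assms by auto
    moreover have "(?d(u := ?d u - 1))(q := 0) = d(u := d u - 1)" using \<open>u \<noteq> q\<close> d assms by auto
    ultimately show ?thesis using assms by (subst cf_deg) auto
  qed
  ultimately have "sg T q * (\<Sum>u\<in>T. \<nu> u * cf (rs T) (d(u := d u - 1))) = 0"
    using assms(1,2) by (simp add: sum_distrib_left mult.left_commute)
  then show "(\<Sum>u\<in>T. \<nu> u * cf (rs T) (d(u := d u - 1))) = 0" using sg_nonzero by simp
qed

lemma Z_leaf_aux: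
  assumes "finite T" "q \<notin> T" "nb T q = {w}" "\<forall>v\<in>T. 1 \<le> d v" "\<forall>v. v \<notin> T \<longrightarrow> d v = 0"
  shows "(\<Sum>u\<in>insert q T. \<nu> u * cf (rs (insert q T)) ((d(q := 1))(u := (d(q := 1)) u - 1)))
     = sg T q * (\<Sum>u\<in>T. (\<nu>(w := \<nu> w - \<nu> q)) u * cf (rs T) (d(u := d u - 1)))"
proof -
  let ?d = "d(q := 1)"
  have w: "w \<in> T" using assms(3) by (auto simp: nb_def)
  have dq: "?d(q := ?d q - 1) = d" using assms by auto
  have q: "cf (rs (insert q T)) (?d(q := ?d q - 1)) = - sg T q * cf (rs T) (d(w := d w - 1))"
    unfolding dq using assms w by (subst cf_deg_minus_1) (auto simp: fun_upd_idem Suc_le_eq)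
  have T: "cf (rs (insert q T)) (?d(u := ?d u - 1)) = sg T q * cf (rs T) (d(u := d u - 1))"
    if "u \<in> T" for u
  proof -
    have "u \<noteq> q" using that assms by auto
    moreover have "(?d(u := ?d u - 1))(q := 0) = d(u := d u - 1)" using \<open>u \<noteq> q\<close> assms by auto
    ultimately show ?thesis using assms by (subst cf_deg) auto
  qed
  have "(\<Sum>u\<in>insert q T. \<nu> u * cf (rs (insert q T)) (?d(u := ?d u - 1)))
      = \<nu> q * (- sg T q * cf (rs T) (d(w := d w - 1)))
        + (\<Sum>u\<in>T. \<nu> u * (sg T q * cf (rs T) (d(u := d u - 1))))"
    using assms(1,2) q T by (simp cong: sum.cong)
  also have "\<dots> = sg T q * ((\<Sum>u\<in>T. \<nu> u * cf (rs T) (d(u := d u - 1)))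
      - (\<Sum>u\<in>T. (if u = w then \<nu> q else 0) * cf (rs T) (d(u := d u - 1))))"
    using assms(1) w by (simp add: sum_distrib_left algebra_simps if_distrib[of "\<lambda>x. x * _"] sum.delta
        cong: if_cong)
  also have "\<dots> = sg T q * (\<Sum>u\<in>T. (\<nu>(w := \<nu> w - \<nu> q)) u * cf (rs T) (d(u := d u - 1)))"
    by (simp add: sum_subtractf[symmetric] left_diff_distrib[symmetric] cong: sum.cong)
       (auto intro!: sum.cong)
  finally show ?thesis .
qed

text \<open>Up to sign the edge at \<open>q\<close> is the factor \<open>y_q - y_w\<close>. In
  exponent 1 of \<open>y_q\<close>, either this factor gives \<open>y_q\<close> and the form stays
  in \<open>T\<close>, or the form gives \<nu>_q \<open>y_q\<close> and the factor gives
  \<open>- y_w\<close>. Together this is the form on \<open>T\<close> with \<nu>_q subtracted at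
  \<open>w\<close>.\<close>

lemma Z_leaf:
  assumes "finite T" "q \<notin> T" "nb T q = {w}" "\<not> AT1 T"
  shows "Z (insert q T) \<nu> \<longleftrightarrow> Z T (\<nu>(w := \<nu> w - \<nu> q))"
proof
  assume Z: "Z (insert q T) \<nu>"
  show "Z T (\<nu>(w := \<nu> w - \<nu> q))"
    unfolding Z_def
  proof (intro allI impI)
    fix d :: "'a \<Rightarrow> nat" assume d: "\<forall>v\<in>T. 1 \<le> d v" "\<forall>v. v \<notin> T \<longrightarrow> d v = 0"
    let ?d = "d(q := 1)"
    have "(\<Sum>u\<in>insert q T. \<nu> u * cf (rs (insert q T)) (?d(u := ?d u - 1))) = 0"
      using Z d unfolding Z_def by (elim allE[of _ ?d]) auto
    then show "(\<Sum>u\<in>T. (\<nu>(w := \<nu> w - \<nu> q)) u * cf (rs T) (d(u := d u - 1))) = 0"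
      unfolding Z_leaf_aux[OF assms(1-3) d] using sg_nonzero by simp
  qed
next
  assume Z: "Z T (\<nu>(w := \<nu> w - \<nu> q))"
  show "Z (insert q T) \<nu>"
    unfolding Z_def
  proof (intro allI impI)
    fix d :: "'a \<Rightarrow> nat" assume d: "\<forall>v\<in>insert q T. 1 \<le> d v" "\<forall>v. v \<notin> insert q T \<longrightarrow> d v = 0"
    let ?d = "d(q := 0)"
    have d': "\<forall>v\<in>T. 1 \<le> ?d v" "\<forall>v. v \<notin> T \<longrightarrow> ?d v = 0" using d assms by auto
    have zero: "cf (rs T) ?d = 0" using assms(4) d' unfolding AT_def by blast
    show "(\<Sum>u\<in>insert q T. \<nu> u * cf (rs (insert q T)) (d(u := d u - 1))) = 0"
    proof (cases "d q = 1")
      case True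
      have "?d(q := 1) = d" using True by auto
      have "(\<Sum>u\<in>T. (\<nu>(w := \<nu> w - \<nu> q)) u * cf (rs T) (?d(u := ?d u - 1))) = 0"
        using Z d' unfolding Z_def by blast
      then show ?thesis
        using Z_leaf_aux[OF assms(1-3) d', of \<nu>] unfolding \<open>?d(q := 1) = d\<close> by (simp only: mult_zero_right)
    next
      \<comment> \<open>With exponent 2 at \<open>q\<close>, both the form and the edge supply
        \<open>y_q\<close>, leaving a coefficient of \<open>T\<close> itself, which vanishes because
        \<open>T\<close> is not \<open>AT1\<close>; larger exponents exceed what is
        available.\<close>
      case False
      then have dq: "2 \<le> d q" using d by (metis One_nat_def Suc_1 insertI1 le_antisym not_less_eq_eq)
      have "cf (rs (insert q T)) (d(q := d q - 1)) = 0"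
      proof (cases "d q = 2")
        case True
        then show ?thesis using assms zero by (subst cf_deg) auto
      next
        case False
        then show ?thesis using dq assms by (subst cf_above_deg) auto
      qed
      moreover have "cf (rs (insert q T)) (d(u := d u - 1)) = 0" if "u \<in> T" for u
      proof -
        have "u \<noteq> q" using that assms by auto
        then show ?thesis using dq assms by (subst cf_above_deg) auto
      qed
      ultimately show ?thesis using assms by (intro sum.neutral) auto
    qed
  qed
qed

lemma AT1_leaf:
  assumes "q \<notin> T" "card (nb T q) \<le> 1" "\<not> AT1 T"
  shows "\<not> AT1 (insert q T)"
  using assms AT_insert_deg[of "\<lambda>_. 1" q T] by auto

text \<open>Vertices outside \<open>T'\<close> are removed one by one while the rest stays
  connected. Both deletion rules leave the form unchanged because the removed weight is 0.\<close>

lemma Z_elim: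
  assumes "finite T" "conn T" "\<not> AT1 T" "conn T'" "T' \<subseteq> T" "\<And>v. v \<in> T - T' \<Longrightarrow> \<nu> v = 0" "Z T \<nu>"
  shows "Z T' \<nu>"
  using assms
proof (induction "card (T - T')" arbitrary: T rule: less_induct)
  case less
  show ?case
  proof (cases "T' = T")
    case True
    then show ?thesis using less by simp
  next
    case False
    then obtain q where q: "q \<in> T - T'" "conn (T - {q})"
      using conn_remove_outside less.prems by blast
    define S where "S = T - {q}"
    have T: "T = insert q S" "q \<notin> S" "finite S" using q less.prems by (auto simp: S_def)
    have cS: "conn S" "T' \<subseteq> S" "\<nu> q = 0" using q less.prems by (auto simp: S_def)
    have nS: "\<not> AT1 S"
      using AT1_superset[OF less.prems(2,1), of S] less.prems(3) T conn_nonempty[OF cS(1)] by auto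
    have "nb S q \<noteq> {}"
    proof -
      obtain u v where "u \<in> {q}" "v \<in> T - {q}" "adj u v"
        using connE[OF less.prems(2), of "{q}"] T conn_nonempty[OF cS(1)] by auto
      then show ?thesis by (auto simp: nb_def S_def)
    qed
    then have card: "1 \<le> card (nb S q)" using finite_nb by (simp add: card_gt_0_iff Suc_leI)
    have "Z S \<nu>"
    proof (cases "card (nb S q) = 1")
      case True
      then obtain w where w: "nb S q = {w}" by (auto simp: card_1_singleton_iff)
      have "Z S (\<nu>(w := \<nu> w - \<nu> q))" using Z_leaf[OF T(3,2) w nS] less.prems(7) T by simp
      then show ?thesis using cS by simp
    next
      case False
      then show ?thesis using Z_delete[of S q \<nu>] T less.prems card by simp
    qed
    moreover have "card (S - T') < card (T - T')"
      using q less.prems(1) by (intro psubset_card_mono) (auto simp: S_def)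
    moreover have "\<And>v. v \<in> S - T' \<Longrightarrow> \<nu> v = 0" using less.prems(6) by (auto simp: S_def)
    ultimately show ?thesis
      using less.hyps[of S, OF _ T(3) cS(1) nS less.prems(4) cS(2)] by blast
  qed
qed

definition ind :: "'a set \<Rightarrow> 'a \<Rightarrow> int" where
  "ind N v = (if v \<in> N then 1 else 0)"

text \<open>Exponent degree minus 1 at \<open>x\<close> still meets the demand \<open>s\<close>, and
  its coefficient is, up to sign, that of the product with the indicator form.\<close>

lemma AT_of_not_Z:
  assumes "finite T" "x \<notin> T" "s < card (nb T x)" "\<not> Z T (ind (nb T x))"
  shows "AT (demand x s) (insert x T)"
proof -
  obtain d where d: "\<forall>v\<in>T. 1 \<le> d v" "\<forall>v. v \<notin> T \<longrightarrow> d v = 0"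
    "(\<Sum>u\<in>T. ind (nb T x) u * cf (rs T) (d(u := d u - 1))) \<noteq> 0"
    using assms(4) by (auto simp: Z_def)
  let ?d = "d(x := card (nb T x) - 1)"
  have "cf (rs (insert x T)) ?d = - sg T x * (\<Sum>u\<in>nb T x.
    if 0 < ?d u then cf (rs T) (?d(x := 0, u := ?d u - 1)) else 0)"
    using assms by (intro cf_deg_minus_1) auto
  also have "(\<Sum>u\<in>nb T x. if 0 < ?d u then cf (rs T) (?d(x := 0, u := ?d u - 1)) else 0)
      = (\<Sum>u\<in>nb T x. cf (rs T) (d(u := d u - 1)))"
  proof (rule sum.cong[OF refl])
    fix u assume "u \<in> nb T x"
    then have "u \<in> T" "u \<noteq> x" using assms by (auto simp: nb_def)
    moreover have "?d(x := 0, u := ?d u - 1) = d(u := d u - 1)" using \<open>u \<noteq> x\<close> d assms by auto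
    ultimately show "(if 0 < ?d u then cf (rs T) (?d(x := 0, u := ?d u - 1)) else 0)
        = cf (rs T) (d(u := d u - 1))" using d by (simp add: Suc_le_eq)
  qed
  also have "\<dots> = (\<Sum>u\<in>T. ind (nb T x) u * cf (rs T) (d(u := d u - 1)))"
    using assms(1) by (intro sum.mono_neutral_cong_left) (auto simp: nb_def ind_def)
  finally have "cf (rs (insert x T)) ?d \<noteq> 0"
    using d(3) sg_nonzero by (metis mult_eq_0_iff neg_equal_0_iff_equal)
  then show ?thesis unfolding AT_def using d assms
    by (intro exI[of _ ?d]) (auto simp: demand_def)
qed

text \<open>The bound on the degree leaves only the two top exponents at \<open>x\<close>: the
  degree itself fails because \<open>T\<close> is not \<open>AT1\<close>, the one below it because
  the form vanishes.\<close>

lemma not_AT_of_Z: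
  assumes "finite T" "x \<notin> T" "card (nb T x) \<le> Suc s" "\<not> AT1 T" "Z T (ind (nb T x))"
  shows "\<not> AT (demand x s) (insert x T)"
proof
  assume "AT (demand x s) (insert x T)"
  then obtain d where d: "\<forall>v\<in>insert x T. demand x s v \<le> d v" "\<forall>v. v \<notin> insert x T \<longrightarrow> d v = 0"
    "cf (rs (insert x T)) d \<noteq> 0"
    by (auto simp: AT_def)
  let ?d = "d(x := 0)"
  have d': "\<forall>v\<in>T. 1 \<le> ?d v" "\<forall>v. v \<notin> T \<longrightarrow> ?d v = 0" using d assms by (auto simp: demand_def)
  have "s \<le> d x" using d by (auto simp: demand_def)
  moreover have "\<not> card (nb T x) < d x" using cf_above_deg d assms by blast
  moreover have "d x \<noteq> card (nb T x)"
  proof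
    assume "d x = card (nb T x)"
    then have "cf (rs T) ?d \<noteq> 0" using cf_deg[of x T d] d(3) assms(2) by auto
    then show False using d' assms(4) unfolding AT_def by blast
  qed
  ultimately have "Suc (d x) = card (nb T x)" using assms by linarith
  then have "cf (rs (insert x T)) d = - sg T x * (\<Sum>u\<in>nb T x.
    if 0 < d u then cf (rs T) (d(x := 0, u := d u - 1)) else 0)"
    using assms by (intro cf_deg_minus_1) auto
  also have "(\<Sum>u\<in>nb T x. if 0 < d u then cf (rs T) (d(x := 0, u := d u - 1)) else 0)
      = (\<Sum>u\<in>nb T x. cf (rs T) (?d(u := ?d u - 1)))"
    using d' assms by (intro sum.cong) (auto simp: nb_def Suc_le_eq split: if_splits)
  also have "\<dots> = (\<Sum>u\<in>T. ind (nb T x) u * cf (rs T) (?d(u := ?d u - 1)))"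
    using assms(1) by (intro sum.mono_neutral_cong_left) (auto simp: nb_def ind_def)
  also have "\<dots> = 0" using assms(5) d' unfolding Z_def by blast
  finally show False using d(3) by simp
qed

section \<open>Separations, leaf blocks and paths\<close>

definition clq :: "'a set \<Rightarrow> bool" where
  "clq L \<longleftrightarrow> (\<forall>u\<in>L. \<forall>v\<in>L. u \<noteq> v \<longrightarrow> adj u v)"

definition cyc :: "nat \<Rightarrow> (nat \<Rightarrow> 'a) \<Rightarrow> 'a set \<Rightarrow> bool" where
  "cyc n f L \<longleftrightarrow> 3 \<le> n \<and> bij_betw f {..<n} L \<and>
     (\<forall>i<n. \<forall>j<n. adj (f i) (f j) \<longleftrightarrow> j = Suc i mod n \<or> i = Suc j mod n)"

definition oddcyc :: "'a set \<Rightarrow> bool" where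
  "oddcyc L \<longleftrightarrow> (\<exists>n f. odd n \<and> cyc n f L)"

definition nonsep :: "'a set \<Rightarrow> bool" where
  "nonsep W \<longleftrightarrow> conn W \<and> (\<forall>v\<in>W. W = {v} \<or> conn (W - {v}))"

definition sep :: "'a set \<Rightarrow> 'a \<Rightarrow> 'a set \<Rightarrow> 'a set \<Rightarrow> bool" where
  "sep W v A B \<longleftrightarrow> A \<union> B = W \<and> A \<inter> B = {v} \<and> conn A \<and> conn B \<and> A \<noteq> {v} \<and> B \<noteq> {v} \<and>
     (\<forall>a\<in>A - {v}. \<forall>b\<in>B - {v}. \<not> adj a b)"

lemma sep_sym: "sep W v A B \<Longrightarrow> sep W v B A"
  unfolding sep_def using adj_sym by blast

lemma sep_exists:
  assumes "conn W" "v \<in> W" "W \<noteq> {v}" "\<not> conn (W - {v})"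
  shows "\<exists>A B. sep W v A B"
proof -
  obtain S where S: "S \<subseteq> W - {v}" "S \<noteq> {}" "S \<noteq> W - {v}"
    and no: "\<And>a b. a \<in> S \<Longrightarrow> b \<in> W - {v} - S \<Longrightarrow> \<not> adj a b"
    using assms unfolding conn_def[of "W - {v}"] by blast
  have side: "conn (insert v R)" if R: "R \<subseteq> W - {v}" "\<And>a b. a \<in> R \<Longrightarrow> b \<in> W - {v} - R \<Longrightarrow> \<not> adj a b" for R
  proof (rule connI[of v])
    fix Q assume Q: "Q \<subseteq> insert v R" "Q \<noteq> {}" "v \<notin> Q"
    then obtain a b where "a \<in> Q" "b \<in> W - Q" "adj a b"
      using connE[OF assms(1), of Q] R(1) assms(2) by blast
    then show "\<exists>u\<in>Q. \<exists>w\<in>insert v R - Q. adj u w" using R Q by blast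
  qed simp
  have "conn (insert v S)" using side[of S] S no by blast
  moreover have "conn (insert v (W - {v} - S))"
    using side[of "W - {v} - S"] no adj_sym by blast
  ultimately have "sep W v (insert v S) (insert v (W - {v} - S))"
    unfolding sep_def using S no assms(2) by blast
  then show ?thesis by blast
qed

text \<open>As long as the side \<open>A\<close> has a cutvertex \<open>z\<close>, split it there
  and keep the part that contains \<open>v\<close> at most as \<open>z\<close> itself; the other
  part joins \<open>B\<close>. The kept side shrinks until it has no cutvertex.\<close>

lemma leaf_exists:
  assumes "finite W" "sep W v A B"
  shows "\<exists>w L T0. sep W w L T0 \<and> nonsep L \<and> L - {w} \<subseteq> A - {v}"
  using assms(2)
proof (induction "card A" arbitrary: v A B rule: less_induct)
  case less
  note s = less.prems[unfolded sep_def]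
  show ?case
  proof (cases "nonsep A")
    case True
    then show ?thesis using less.prems by blast
  next
    case False
    then obtain z where z: "z \<in> A" "A \<noteq> {z}" "\<not> conn (A - {z})" using s by (auto simp: nonsep_def)
    then obtain P Q where PQ: "sep A z P Q" using sep_exists[of A z] s by blast
    obtain A1 A2 where A12: "sep A z A1 A2" and v1: "v \<in> A1"
    proof (cases "v \<in> P")
      case True
      then show ?thesis using that PQ by blast
    next
      case False
      then have "v \<in> Q" using PQ s by (auto simp: sep_def)
      then show ?thesis using that sep_sym[OF PQ] by blast
    qed
    note t = A12[unfolded sep_def]
    have vz: "v \<in> A2 \<Longrightarrow> v = z" using v1 t by blast
    have "sep W z A2 (A1 \<union> B)"
      unfolding sep_def
    proof (intro conjI ballI)
      show "A2 \<union> (A1 \<union> B) = W" using s t by blast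
      show "A2 \<inter> (A1 \<union> B) = {z}" using s t vz by blast
      show "conn A2" using t by blast
      show "conn (A1 \<union> B)" using t s v1 by (intro conn_Un) auto
      show "A2 \<noteq> {z}" using t by blast
      show "A1 \<union> B \<noteq> {z}" using t s by blast
      fix a b assume a: "a \<in> A2 - {z}" and b: "b \<in> A1 \<union> B - {z}"
      show "\<not> adj a b"
      proof (cases "b \<in> A1")
        case True
        then show ?thesis using t a b adj_sym by blast
      next
        case False
        then have "b \<in> B - {v}" using b v1 by blast
        moreover have "a \<in> A - {v}" using a t vz by blast
        ultimately show ?thesis using s by blast
      qed
    qed
    moreover have "card A2 < card A"
    proof (rule psubset_card_mono)
      show "finite A" using assms(1) s by (metis finite_Un)
      show "A2 \<subset> A" using t by blast
    qed
    ultimately obtain w L T0 where L: "sep W w L T0" "nonsep L" "L - {w} \<subseteq> A2 - {z}"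
      using less.hyps by blast
    moreover have "A2 - {z} \<subseteq> A - {v}" using t vz by blast
    ultimately show ?thesis by blast
  qed
qed

text \<open>Descending into both sides of one separation yields two leaf blocks that are disjoint
  away from their cutvertices.\<close>

lemma two_leaves:
  assumes "finite W" "conn W" "\<not> nonsep W"
  obtains v A B w L T0 w' L' T0' where "sep W v A B"
    "sep W w L T0" "nonsep L" "L - {w} \<subseteq> A - {v}"
    "sep W w' L' T0'" "nonsep L'" "L' - {w'} \<subseteq> B - {v}"
proof -
  obtain v where "v \<in> W" "W \<noteq> {v}" "\<not> conn (W - {v})" using assms by (auto simp: nonsep_def)
  then obtain A B where s: "sep W v A B" using sep_exists assms by blast
  show thesis
    using leaf_exists[OF assms(1) s] leaf_exists[OF assms(1) sep_sym[OF s]] that s by blast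
qed

section \<open>Induced paths and alternating sums\<close>

fun ipath :: "'a list \<Rightarrow> bool" where
  "ipath [] = True"
| "ipath (a # p) = (ipath p \<and> a \<notin> set p \<and> (p \<noteq> [] \<longrightarrow> nb (set p) a = {hd p}))"

fun alt :: "('a \<Rightarrow> int) \<Rightarrow> 'a list \<Rightarrow> int" where
  "alt \<nu> [] = 0"
| "alt \<nu> (a # p) = \<nu> a - alt \<nu> p"

lemma alt_cong: "(\<And>v. v \<in> set p \<Longrightarrow> \<nu> v = \<mu> v) \<Longrightarrow> alt \<nu> p = alt \<mu> p"
  by (induction p) auto

lemma alt_last:
  "p \<noteq> [] \<Longrightarrow> (\<And>v. v \<in> set (butlast p) \<Longrightarrow> \<nu> v = 0) \<Longrightarrow> alt \<nu> p = (-1) ^ (length p - 1) * \<nu> (last p)"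
proof (induction p)
  case (Cons a p)
  then show ?case by (cases p) auto
qed simp

lemma ipath_distinct: "ipath p \<Longrightarrow> distinct p"
  by (induction p) auto

lemma ipath_adj:
  "ipath p \<Longrightarrow> i < length p \<Longrightarrow> j < length p \<Longrightarrow> adj (p ! i) (p ! j) \<longleftrightarrow> j = Suc i \<or> i = Suc j"
proof (induction p arbitrary: i j)
  case (Cons a p)
  have key: "adj a (p ! k) \<longleftrightarrow> k = 0" if k: "k < length p" for k
  proof -
    have ne: "p \<noteq> []" using k by auto
    then have "p ! k \<in> nb (set p) a \<longleftrightarrow> p ! k = hd p" using Cons.prems(1) by simp
    then have "adj a (p ! k) \<longleftrightarrow> p ! k = hd p" using k by (simp add: nb_def)
    also have "\<dots> \<longleftrightarrow> k = 0" using k ipath_distinct[of p] Cons.prems(1) ne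
      by (simp add: hd_conv_nth nth_eq_iff_index_eq)
    finally show ?thesis .
  qed
  have IH: "adj (p ! i') (p ! j') \<longleftrightarrow> j' = Suc i' \<or> i' = Suc j'" if "i' < length p" "j' < length p" for i' j'
    using Cons.IH Cons.prems(1) that by simp
  have sym: "adj u v = adj v u" for u v using adj_sym by blast
  show ?case
  proof (cases i)
    case 0
    then show ?thesis using key[of "j - 1"] Cons.prems(3) adj_irrefl[of a] by (cases j) auto
  next
    case (Suc i')
    then show ?thesis using key[of i'] IH[of i' "j - 1"] Cons.prems(2,3) sym[of "p ! i'" a]
      by (cases j) auto
  qed
qed simp

lemma conn_ipath: "ipath p \<Longrightarrow> p \<noteq> [] \<Longrightarrow> conn (set p)"
proof (induction p)
  case (Cons a p)
  show ?case
  proof (cases "p = []")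
    case True
    then show ?thesis by (simp add: conn_singleton)
  next
    case False
    then have "hd p \<in> nb (set p) a" using Cons by simp
    then show ?thesis using Cons False conn_insert[of "set p" "hd p" a] by (auto simp: nb_def)
  qed
qed simp

lemma not_AT1_singleton: "\<not> AT1 {v}"
proof
  assume "AT1 {v}"
  then obtain d where "1 \<le> d v" "cf (rs {v}) d \<noteq> 0" by (auto simp: AT_def)
  moreover have "rs {v} = {}" using asym_D by (auto simp: rs_def)
  ultimately show False by (auto simp: cf_empty split: if_splits)
qed

lemma not_AT1_ipath: "ipath p \<Longrightarrow> p \<noteq> [] \<Longrightarrow> \<not> AT1 (set p)"
proof (induction p)
  case (Cons a p)
  show ?case
  proof (cases "p = []")
    case True
    then show ?thesis using not_AT1_singleton by simp
  next
    case False
    then show ?thesis using Cons AT1_leaf[of a "set p"] by simp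
  qed
qed simp

lemma Z_singleton_iff: "Z {w} \<nu> \<longleftrightarrow> \<nu> w = 0"
  using Z_singleton by (auto simp: Z_def)

text \<open>Peeling off the first vertex by \<open>Z_leaf\<close> subtracts its weight from that of
  the next one, which merely negates the alternating sum. At a single vertex the condition is that
  the weight is 0.\<close>

lemma Z_ipath: "ipath p \<Longrightarrow> p \<noteq> [] \<Longrightarrow> Z (set p) \<nu> \<longleftrightarrow> alt \<nu> p = 0"
proof (induction p arbitrary: \<nu>)
  case (Cons a p)
  show ?case
  proof (cases "p = []")
    case True
    then show ?thesis by (simp add: Z_singleton_iff)
  next
    case False
    then obtain b q where p: "p = b # q" by (cases p) auto
    have "Z (insert a (set p)) \<nu> \<longleftrightarrow> Z (set p) (\<nu>(b := \<nu> b - \<nu> a))"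
      using Cons.prems p not_AT1_ipath[of p] by (intro Z_leaf) auto
    also have "\<dots> \<longleftrightarrow> alt (\<nu>(b := \<nu> b - \<nu> a)) p = 0" using Cons.IH Cons.prems p by simp
    also have "alt (\<nu>(b := \<nu> b - \<nu> a)) p = \<nu> b - \<nu> a - alt \<nu> q"
    proof -
      have "b \<notin> set q" using Cons.prems(1) p by simp
      then have "alt (\<nu>(b := \<nu> b - \<nu> a)) q = alt \<nu> q" by (intro alt_cong) auto
      then show ?thesis by (simp add: p)
    qed
    also have "\<nu> b - \<nu> a - alt \<nu> q = - alt \<nu> (a # p)" by (simp add: p)
    finally show ?thesis by auto
  qed
qed simp

lemma cyc_rotate:
  assumes "cyc n f L"
  shows "cyc n (\<lambda>i. f ((i + k) mod n)) L"
proof -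
  have n: "3 \<le> n" and f: "bij_betw f {..<n} L"
    and a: "\<And>i j. i < n \<Longrightarrow> j < n \<Longrightarrow> adj (f i) (f j) \<longleftrightarrow> j = Suc i mod n \<or> i = Suc j mod n"
    using assms by (auto simp: cyc_def)
  have inj: "inj_on (\<lambda>i. (i + k) mod n) {..<n}"
  proof (rule inj_onI)
    have *: "i = j" if "i \<le> j" "j < n" "(j + k) mod n = (i + k) mod n" for i j
    proof -
      have "n dvd (j + k) - (i + k)" using that by (subst (asm) mod_eq_dvd_iff_nat) auto
      then have "n dvd j - i" by simp
      moreover have "j - i < n" using that by simp
      ultimately have "j - i = 0" using nat_dvd_not_less[of "j - i" n] by blast
      then show ?thesis using that by simp
    qed
    fix i j assume "i \<in> {..<n}" "j \<in> {..<n}" "(i + k) mod n = (j + k) mod n"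
    then show "i = j" using *[of i j] *[of j i] by (cases "i \<le> j") auto
  qed
  then have bij: "bij_betw (\<lambda>i. (i + k) mod n) {..<n} {..<n}"
  proof -
    have "(\<lambda>i. (i + k) mod n) ` {..<n} \<subseteq> {..<n}" using n by auto
    then show ?thesis using endo_inj_surj[of "{..<n}" "\<lambda>i. (i + k) mod n"] inj by (simp add: bij_betw_def)
  qed
  have "adj (f ((i + k) mod n)) (f ((j + k) mod n)) \<longleftrightarrow> j = Suc i mod n \<or> i = Suc j mod n"
    if "i < n" "j < n" for i j
  proof -
    have "(y + k) mod n = Suc ((x + k) mod n) mod n \<longleftrightarrow> y = Suc x mod n" if "x < n" "y < n" for x y
    proof -
      have "Suc ((x + k) mod n) mod n = (Suc x mod n + k) mod n"
        by (metis add_Suc mod_Suc_eq mod_add_left_eq)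
      moreover have "Suc x mod n < n" using n by simp
      ultimately show ?thesis using inj_on_eq_iff[OF inj, of y "Suc x mod n"] that by simp
    qed
    then show ?thesis using a[of "(i + k) mod n" "(j + k) mod n"] n that by simp
  qed
  then show ?thesis using n bij_betw_trans[OF bij f] by (simp add: cyc_def o_def)
qed

text \<open>Starting at index 1 or later leaves out vertex 0, so the closing edge of the cycle is
  absent.\<close>

lemma ipath_cyc:
  assumes "cyc n f L" "1 \<le> a"
  shows "ipath (map f [a..<n])"
  using assms(2)
proof (induction "n - a" arbitrary: a)
  case (Suc m)
  have inj: "inj_on f {..<n}" and adj: "\<And>i j. i < n \<Longrightarrow> j < n \<Longrightarrow> adj (f i) (f j) \<longleftrightarrow> j = Suc i mod n \<or> i = Suc j mod n"
    using assms(1) by (auto simp: cyc_def bij_betw_def)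
  have a: "a < n" using Suc by simp
  have IH: "ipath (map f [Suc a..<n])" using Suc by simp
  have "f a \<notin> f ` {Suc a..<n}"
  proof
    assume "f a \<in> f ` {Suc a..<n}"
    then obtain x where "x \<in> {Suc a..<n}" "f a = f x" by auto
    then show False using a inj_onD[OF inj, of a x] by auto
  qed
  moreover have "nb (f ` {Suc a..<n}) (f a) = {f (Suc a)}" if "Suc a < n"
  proof -
    have "adj (f a) (f j) \<longleftrightarrow> j = Suc a" if "j \<in> {Suc a..<n}" for j
    proof -
      have "a \<noteq> Suc j mod n"
        using that Suc.prems by (cases "Suc j = n") auto
      then show ?thesis using adj[of a j] that \<open>Suc a < n\<close> by auto
    qed
    then show ?thesis using that by (auto simp: nb_def)
  qed
  ultimately have "ipath (f a # map f [Suc a..<n])"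
    using IH by (subst ipath.simps) (simp add: hd_map)
  then show ?case using a by (simp add: upt_conv_Cons del: ipath.simps)
qed simp

end

section \<open>Complete graphs, odd cycles and leaf blocks\<close>

lemma cf_perm:
  assumes "finite D" "bij \<pi>"
  shows "cf (map_prod \<pi> \<pi> ` D) d = cf D (d \<circ> \<pi>)"
  using assms(1)
proof (induction D arbitrary: d rule: finite_induct)
  case empty
  have "d = (\<lambda>_. 0)" if "d \<circ> \<pi> = (\<lambda>_. 0)"
    using that bij_is_surj[OF assms(2)] by (metis comp_apply ext surjD)
  then have "d \<circ> \<pi> = (\<lambda>_. 0) \<longleftrightarrow> d = (\<lambda>_. 0)" by auto
  then show ?case by (simp only: image_empty cf_empty)
next
  case (insert e D)
  obtain u v where e: "e = (u, v)" by (cases e)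
  have inj: "inj \<pi>" using assms(2) by (rule bij_is_inj)
  then have "inj (map_prod \<pi> \<pi>)" by (auto simp: inj_def)
  then have n: "map_prod \<pi> \<pi> e \<notin> map_prod \<pi> \<pi> ` D" using insert by (simp add: inj_image_mem_iff)
  have upd: "d(\<pi> a := c) \<circ> \<pi> = (d \<circ> \<pi>)(a := c)" for a c
    using inj by (auto simp: fun_eq_iff inj_def)
  have n': "(\<pi> u, \<pi> v) \<notin> map_prod \<pi> \<pi> ` D" "(u, v) \<notin> D" using n insert e by auto
  show ?case
    unfolding e image_insert map_prod_simp cf_insert[OF finite_imageI[OF insert.hyps(1)] n'(1)]
      cf_insert[OF insert.hyps(1) n'(2)] insert.IH upd fst_conv snd_conv
    by (simp only: o_apply)
qed

context ograph begin

text \<open>Swapping two adjacent twins fixes the rest of the graph and negates the factor of the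
  edge between them. The polynomial is thus antisymmetric in the two variables, and monomials with
  equal exponents there cancel.\<close>

lemma cf_twins:
  assumes "u \<in> W" "v \<in> W" "adj u v" "\<And>w. w \<in> W - {u, v} \<Longrightarrow> adj u w \<longleftrightarrow> adj v w" "d u = d v"
  shows "cf (rs W) d = 0"
proof -
  have uv: "u \<noteq> v" using assms(3) adj_irrefl by auto
  define X where "X = {w \<in> W - {u, v}. adj u w}"
  \<comment> \<open>An orientation invariant under the swap: all edges from common neighbours point
    towards \<open>u\<close> and \<open>v\<close>. The arc between the twins is added separately in
    \<open>D'\<close>, and the two terms of \<open>cf_insert\<close> for it coincide.\<close>
  define D0 where "D0 = (\<lambda>w. (w, u)) ` X \<union> (\<lambda>w. (w, v)) ` X \<union> rs (W - {u, v})"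
  define D' where "D' = insert (u, v) D0"
  have "X \<subseteq> nb W u" by (auto simp: X_def nb_def)
  then have fX: "finite X" using finite_nb finite_subset by blast
  then have f0: "finite D0" using finite_rs by (simp add: D0_def)
  have n0: "(u, v) \<notin> D0" using uv by (auto simp: D0_def X_def rs_def)
  have vX: "w \<in> X \<longleftrightarrow> w \<in> W \<and> w \<noteq> u \<and> w \<noteq> v \<and> adj v w" for w
    using assms(4) by (auto simp: X_def)
  have rsc: "(a, b) \<in> rs S \<union> (rs S)\<inverse> \<longleftrightarrow> a \<in> S \<and> b \<in> S \<and> adj a b" for a b S
    by (auto simp: rs_def adj_def)
  have rsa: "rs S \<inter> (rs S)\<inverse> = {}" for S using asym_D by (auto simp: rs_def)
  have D0c: "(a, b) \<in> D0 \<union> D0\<inverse> \<longleftrightarrow>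
      a \<in> X \<and> b \<in> {u, v} \<or> b \<in> X \<and> a \<in> {u, v} \<or> a \<in> W - {u, v} \<and> b \<in> W - {u, v} \<and> adj a b" for a b
    using rsc[of a b "W - {u, v}"] unfolding D0_def by auto
  have "(a, b) \<in> rs W \<union> (rs W)\<inverse> \<longleftrightarrow> (a, b) \<in> D' \<union> D'\<inverse>" for a b
  proof -
    have "(a, b) \<in> D' \<union> D'\<inverse> \<longleftrightarrow> (a, b) = (u, v) \<or> (a, b) = (v, u) \<or> (a, b) \<in> D0 \<union> D0\<inverse>"
      by (auto simp: D'_def)
    also have "\<dots> \<longleftrightarrow> a \<in> W \<and> b \<in> W \<and> adj a b"
      unfolding D0c using assms(1-3) vX adj_sym adj_irrefl unfolding X_def by auto
    finally show ?thesis using rsc by simp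
  qed
  then have c: "rs W \<union> (rs W)\<inverse> = D' \<union> D'\<inverse>" by auto
  have "D' \<inter> D'\<inverse> = {}"
    using rsa[of "W - {u, v}"] uv by (auto simp: D'_def D0_def X_def rs_def)
  then have eq: "\<bar>cf (rs W) d\<bar> = \<bar>cf D' d\<bar>"
    using cf_orientation_indep[OF finite_rs _ rsa _ c] f0 by (simp add: D'_def)
  define \<pi> where "\<pi> = (\<lambda>z. if z = u then v else if z = v then u else z)"
  have pp: "\<pi> (\<pi> z) = z" for z by (auto simp: \<pi>_def)
  then have bij: "bij \<pi>" by (intro o_bij[of \<pi>]) (auto simp: fun_eq_iff)
  have fixes_D0: "map_prod \<pi> \<pi> e \<in> D0" if "e \<in> D0" for e
    using that uv by (cases e) (auto simp: D0_def \<pi>_def X_def rs_def)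
  have "map_prod \<pi> \<pi> ` D0 = D0"
  proof
    show "map_prod \<pi> \<pi> ` D0 \<subseteq> D0" by (intro image_subsetI fixes_D0)
    show "D0 \<subseteq> map_prod \<pi> \<pi> ` D0"
    proof
      fix e assume "e \<in> D0"
      moreover have "e = map_prod \<pi> \<pi> (map_prod \<pi> \<pi> e)" by (cases e) (simp add: pp)
      ultimately show "e \<in> map_prod \<pi> \<pi> ` D0" using fixes_D0[of e] by (metis imageI)
    qed
  qed
  then have "cf D0 (d(v := d v - 1)) = cf D0 (d(v := d v - 1) \<circ> \<pi>)" using cf_perm[OF f0 bij] by metis
  moreover have "d(v := d v - 1) \<circ> \<pi> = d(u := d u - 1)" using assms(5) uv by (auto simp: \<pi>_def fun_eq_iff)
  ultimately have "cf D' d = 0" using assms(5) unfolding D'_def cf_insert[OF f0 n0] by simp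
  then show ?thesis using eq by simp
qed

lemma cf_le_deg:
  assumes "cf (rs W) d \<noteq> 0" "v \<in> W"
  shows "d v \<le> card (nb (W - {v}) v)"
proof (rule ccontr)
  assume "\<not> ?thesis"
  then have "cf (rs (insert v (W - {v}))) d = 0" by (intro cf_above_deg) auto
  then show False using assms by (simp add: insert_absorb)
qed

text \<open>The polynomial is a Vandermonde determinant. Exponents between 1 and
  \<open>card W - 1\<close> must repeat by the pigeonhole principle, and any two vertices of a
  clique are adjacent twins.\<close>

lemma not_AT1_clq:
  assumes "finite W" "W \<noteq> {}" "clq W"
  shows "\<not> AT1 W"
proof
  assume "AT1 W"
  then obtain d where d: "\<forall>v\<in>W. 1 \<le> d v" "cf (rs W) d \<noteq> 0" by (auto simp: AT_def)
  have "d v \<le> card W - 1" if "v \<in> W" for v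
  proof -
    have "nb (W - {v}) v \<subseteq> W - {v}" by (auto simp: nb_def)
    then have "card (nb (W - {v}) v) \<le> card W - 1"
      using card_mono[of "W - {v}"] assms(1) that by fastforce
    then show ?thesis using cf_le_deg[OF d(2) that] by linarith
  qed
  then have "d ` W \<subseteq> {1..card W - 1}" using d by auto
  then have "card (d ` W) \<le> card W - 1" using card_mono[of "{1..card W - 1}"] by simp
  then have "card (d ` W) < card W" using assms by (simp add: card_gt_0_iff Suc_le_eq le_less_trans)
  then have "\<not> inj_on d W" by (auto dest: card_image)
  then obtain u v where "u \<in> W" "v \<in> W" "u \<noteq> v" "d u = d v" by (auto simp: inj_on_def)
  then have "cf (rs W) d = 0" using assms(3) by (intro cf_twins[of u W v]) (auto simp: clq_def)
  then show False using d by simp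
qed

text \<open>Removing one vertex leaves an induced path with an even number of vertices whose two
  ends are its neighbours; the ends have opposite signs in the alternating sum, so the indicator
  form vanishes. Degree 2 is exactly the bound in \<open>not_AT_of_Z\<close> for
  \<open>s = 1\<close>.\<close>

lemma not_AT1_oddcyc:
  assumes "oddcyc W"
  shows "\<not> AT1 W"
proof -
  obtain n f where n: "odd n" and c: "cyc n f W" using assms by (auto simp: oddcyc_def)
  then have n3: "3 \<le> n" and bij: "bij_betw f {..<n} W"
    and adj: "\<And>i j. i < n \<Longrightarrow> j < n \<Longrightarrow> adj (f i) (f j) \<longleftrightarrow> j = Suc i mod n \<or> i = Suc j mod n"
    by (auto simp: cyc_def)
  have inj: "inj_on f {..<n}" using bij by (simp add: bij_betw_def)
  let ?p = "map f [1..<n]"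
  have p: "ipath ?p" "?p \<noteq> []" using ipath_cyc[OF c, of 1] n3 by auto
  have f0: "f 0 \<notin> set ?p"
  proof
    assume "f 0 \<in> set ?p"
    then obtain j where "1 \<le> j" "j < n" "f 0 = f j" by auto
    then show False using inj_onD[OF inj, of 0 j] by simp
  qed
  have nb: "nb (set ?p) (f 0) = {f 1, f (n - 1)}"
  proof -
    have "adj (f 0) (f j) \<longleftrightarrow> j = 1 \<or> j = n - 1" if "1 \<le> j" "j < n" for j
    proof -
      have "0 = Suc j mod n \<longleftrightarrow> j = n - 1" using that by (cases "Suc j = n") auto
      then show ?thesis using adj[of 0 j] that n3 by auto
    qed
    then show ?thesis using n3 by (auto simp: nb_def)
  qed
  have W: "W = insert (f 0) (set ?p)"
  proof -
    have "{..<n} = insert 0 {1..<n}" using n3 by auto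
    then show ?thesis using bij by (auto simp: bij_betw_def)
  qed
  have "alt (ind {f 1, f (n - 1)}) ?p = 0"
  proof -
    have "?p = f 1 # map f [2..<n]" using n3 by (simp add: upt_conv_Cons numeral_2_eq_2)
    moreover have "alt (ind {f 1, f (n - 1)}) (map f [2..<n]) = (-1) ^ (n - 3) * 1"
    proof -
      have m: "[2..<n] = [2..<n - 1] @ [n - 1]" using n3 upt_Suc_append[of 2 "n - 1"] by simp
      have "ind {f 1, f (n - 1)} v = 0" if "v \<in> f ` {2..<n - 1}" for v
      proof -
        obtain j where j: "2 \<le> j" "j < n - 1" "v = f j" using \<open>v \<in> f ` {2..<n - 1}\<close> by auto
        then have "j < n" by simp
        then have "f j \<noteq> f 1" "f j \<noteq> f (n - 1)" using j n3
            inj_onD[OF inj, of j 1] inj_onD[OF inj, of j "n - 1"] by auto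
        then show ?thesis using j by (simp add: ind_def)
      qed
      then have "alt (ind {f 1, f (n - 1)}) (map f [2..<n])
        = (-1) ^ (length (map f [2..<n]) - 1) * ind {f 1, f (n - 1)} (last (map f [2..<n]))"
        by (intro alt_last) (auto simp: m)
      then show ?thesis by (simp add: m ind_def) (simp add: numeral_3_eq_3 eval_nat_numeral)
    qed
    moreover have "even (n - 3)" using n n3 by simp
    ultimately show ?thesis by (simp add: ind_def)
  qed
  then have "Z (set ?p) (ind (nb (set ?p) (f 0)))" using Z_ipath[OF p] nb by simp
  moreover have "card (nb (set ?p) (f 0)) \<le> Suc 1" unfolding nb by (simp add: card_insert_if)
  ultimately have "\<not> AT (demand (f 0) 1) (insert (f 0) (set ?p))"
    using not_AT_of_Z[OF _ f0, of 1] not_AT1_ipath[OF p] by blast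
  then show ?thesis by (simp only: W demand_1 not_False_eq_True)
qed

text \<open>Weaker than \<open>sep\<close>: the rest \<open>T0\<close> may be just \<open>w\<close>.
  A graph consisting of one block then counts as a leaf block with any of its vertices as
  \<open>w\<close>, so the constancy of the weights is proved once for both situations.\<close>

definition leaf :: "'a set \<Rightarrow> 'a \<Rightarrow> 'a set \<Rightarrow> 'a set \<Rightarrow> bool" where
  "leaf T w L T0 \<longleftrightarrow> L \<union> T0 = T \<and> L \<inter> T0 = {w} \<and> conn T0 \<and> (\<forall>a\<in>L - {w}. \<forall>b\<in>T0 - {w}. \<not> adj a b)"

lemma leaf_sep: "sep T w L T0 \<Longrightarrow> leaf T w L T0"
  by (auto simp: sep_def leaf_def)

lemma leaf_whole: "w \<in> T \<Longrightarrow> leaf T w T {w}"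
  by (auto simp: leaf_def conn_singleton)

text \<open>Every vertex of the clique other than \<open>w\<close> and \<open>a\<close> keeps the
  neighbours \<open>a\<close> and \<open>w\<close> while it is deleted, so \<open>Z_delete\<close>
  applies; finally \<open>a\<close> hangs at \<open>w\<close> and is removed by
  \<open>Z_leaf\<close>.\<close>

lemma clq_reduce:
  assumes "finite T" "conn T" "\<not> AT1 T" "leaf T w L T0" "clq L" "Z T \<nu>" "a \<in> L - {w}"
  shows "Z T0 (\<nu>(w := \<nu> w - \<nu> a))"
proof -
  note l = assms(4)[unfolded leaf_def]
  have aw: "adj a w" using assms(5,7) l by (auto simp: clq_def)
  have fin: "finite T0" "finite L" using assms(1) l by (metis finite_Un)+
  have nA: "\<not> AT1 S" if "S \<subseteq> T" "S \<noteq> {}" for S using AT1_superset[OF assms(2,1) that] assms(3) by blast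
  have del: "Z (insert a T0) \<nu>" if "finite S" "S \<subseteq> L - {w, a}" "Z (S \<union> insert a T0) \<nu>" for S
    using that
  proof (induction S rule: finite_induct)
    case empty
    then show ?case by simp
  next
    case (insert q S)
    have qn: "q \<notin> S \<union> insert a T0" using insert l by auto
    have "{a, w} \<subseteq> nb (S \<union> insert a T0) q"
      using insert.prems assms(5,7) l by (auto simp: nb_def clq_def)
    then have "card {a, w} \<le> card (nb (S \<union> insert a T0) q)" using finite_nb by (intro card_mono) auto
    then have 2: "2 \<le> card (nb (S \<union> insert a T0) q)" using assms(7) by (auto simp: card_insert_if)
    have "Z (S \<union> insert a T0) \<nu>"
    proof (rule Z_delete[OF _ qn 2])
      show "finite (S \<union> insert a T0)" using insert fin by simp
      show "\<not> AT1 (insert q (S \<union> insert a T0))" using insert.prems l assms(7) by (intro nA) auto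
      show "Z (insert q (S \<union> insert a T0)) \<nu>" using insert.prems by (simp add: insert_commute)
    qed
    then show ?case using insert by auto
  qed
  have "(L - {w, a}) \<union> insert a T0 = T" using l assms(7) by auto
  then have Za: "Z (insert a T0) \<nu>" using del[of "L - {w, a}"] fin assms(6) by auto
  have "nb T0 a = {w}" using l aw assms(7) by (auto simp: nb_def)
  then show ?thesis using Za Z_leaf[of T0 a w \<nu>] fin l assms(7) nA[of T0] conn_nonempty by auto
qed

lemma Z_point: "finite T \<Longrightarrow> conn T \<Longrightarrow> \<not> AT1 T \<Longrightarrow> w \<in> T \<Longrightarrow> Z T (\<lambda>v. if v = w then c else 0) \<Longrightarrow> c = 0"
  using Z_elim[of T "{w}" "\<lambda>v. if v = w then c else 0"] conn_singleton
    Z_singleton[of w "\<lambda>v. if v = w then c else 0"] by simp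

text \<open>Either of \<open>a\<close>, \<open>b\<close> may be the last clique vertex to be
  deleted. The two resulting forms on \<open>T0\<close> differ only at \<open>w\<close>, by the
  difference of the weights, and a form supported at one vertex must be 0.\<close>

lemma leaf_const_clq:
  assumes "finite T" "conn T" "\<not> AT1 T" "leaf T w L T0" "clq L" "Z T \<nu>" "a \<in> L - {w}" "b \<in> L - {w}"
  shows "\<nu> a = \<nu> b"
proof -
  note l = assms(4)[unfolded leaf_def]
  have "Z T0 (\<lambda>v. (\<nu>(w := \<nu> w - \<nu> a)) v - (\<nu>(w := \<nu> w - \<nu> b)) v)"
    by (rule Z_diff[OF clq_reduce[OF assms(1-7)] clq_reduce[OF assms(1-6,8)]])
  moreover have "(\<lambda>v. (\<nu>(w := \<nu> w - \<nu> a)) v - (\<nu>(w := \<nu> w - \<nu> b)) v)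
    = (\<lambda>v. if v = w then \<nu> b - \<nu> a else 0)" by auto
  ultimately have "Z T0 (\<lambda>v. if v = w then \<nu> b - \<nu> a else 0)" by simp
  moreover have "finite T0" using assms(1) l by (metis finite_Un)
  moreover have "\<not> AT1 T0" using AT1_superset[OF assms(2,1), of T0] assms(3) l conn_nonempty by auto
  ultimately have "\<nu> b - \<nu> a = 0" using l Z_point[of T0 w "\<nu> b - \<nu> a"] by blast
  then show ?thesis by simp
qed

text \<open>Deleting \<open>f 0\<close> makes \<open>f 1\<close> a leaf at \<open>f 2\<close>;
  deleting \<open>f 1\<close> makes \<open>f 0\<close> a leaf at \<open>f (n - 1)\<close>. The two
  resulting forms differ only at \<open>f 2\<close>, by minus the weight of \<open>f 1\<close>, and
  at \<open>f (n - 1)\<close>, by the weight of \<open>f 0\<close>. These are the ends of an induced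
  path with \<open>n - 2\<close> vertices, an odd number, so they carry the same sign in the
  alternating sum and the weights agree. The bound 5 keeps the ends distinct.\<close>

lemma leaf_const_cyc_step:
  assumes "finite T" "conn T" "\<not> AT1 T" "leaf T w L T0" "cyc n f L" "odd n" "5 \<le> n" "Z T \<nu>"
    "f 0 \<noteq> w" "f 1 \<noteq> w"
  shows "\<nu> (f 0) = \<nu> (f 1)"
proof -
  note l = assms(4)[unfolded leaf_def]
  have bij: "bij_betw f {..<n} L"
    and adj: "\<And>i j. i < n \<Longrightarrow> j < n \<Longrightarrow> adj (f i) (f j) \<longleftrightarrow> j = Suc i mod n \<or> i = Suc j mod n"
    using assms(5) by (auto simp: cyc_def)
  have inj: "\<And>i j. i < n \<Longrightarrow> j < n \<Longrightarrow> f i = f j \<longleftrightarrow> i = j"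
    using bij by (auto simp: bij_betw_def inj_on_def)
  have L: "L = f ` {..<n}" using bij by (simp add: bij_betw_def)
  let ?Q = "f ` {2..<n}"
  define S where "S = ?Q \<union> T0"
  have "{..<n} = insert 0 (insert 1 {2..<n})" using assms(7) by auto
  then have LQ: "L = insert (f 0) (insert (f 1) ?Q)" using L by simp
  have T: "T = insert (f 0) (insert (f 1) S)" using LQ l by (auto simp: S_def)
  have wQ: "w \<in> ?Q" using LQ l assms(9,10) by auto
  have n01: "f 0 \<notin> T0" "f 1 \<notin> T0" using LQ l assms(9,10) by auto
  have nQ: "f 0 \<notin> ?Q" "f 1 \<notin> ?Q" "f 0 \<noteq> f 1" using inj assms(7) by auto
  have nS: "f 0 \<notin> S" "f 1 \<notin> S" using n01 nQ by (auto simp: S_def)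
  have m0: "adj (f 0) (f j) \<longleftrightarrow> j = 1 \<or> j = n - 1" if "j < n" for j
  proof -
    have "0 = Suc j mod n \<longleftrightarrow> j = n - 1" using that by (cases "Suc j = n") auto
    then show ?thesis using adj[of 0 j] that assms(7) by auto
  qed
  have m1: "adj (f 1) (f j) \<longleftrightarrow> j = 0 \<or> j = 2" if "j < n" for j
  proof -
    have "1 = Suc j mod n \<longleftrightarrow> j = 0" using that assms(7) by (cases "Suc j = n") auto
    then show ?thesis using adj[of 1 j] that assms(7) by auto
  qed
  have noT0: "\<not> adj (f i) b" if "i < 2" "b \<in> T0 - {w}" for i b
    using l that assms(9,10) LQ by (cases i) (auto simp: less_Suc_eq numeral_2_eq_2)
  have nbS: "nb S q = nb ?Q q" if "q = f 0 \<or> q = f 1" for q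
    using noT0[of 0] noT0[of 1] that wQ by (auto simp: nb_def S_def)
  have nb0: "nb S (f 0) = {f (n - 1)}"
    unfolding nbS[of "f 0", simplified] using m0 assms(7) by (auto simp: nb_def)
  have nb1: "nb S (f 1) = {f 2}"
    using nbS[of "f 1"] m1 assms(7) by (auto simp: nb_def)
  have adj01: "adj (f 0) (f 1)" "adj (f 1) (f 0)" using m0[of 1] m1[of 0] assms(7) by auto
  have fin: "finite S" "finite (insert (f 0) S)" "finite (insert (f 1) S)" using assms(1) T by auto
  have cQ: "conn ?Q" using conn_ipath[OF ipath_cyc[OF assms(5), of 2]] assms(7) by auto
  have cS: "conn S" unfolding S_def using cQ l wQ by (intro conn_Un) auto
  have nA: "\<not> AT1 S" using AT1_superset[OF assms(2,1), of S] assms(3) T conn_nonempty[OF cS] by auto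
  have "Z (insert (f 1) S) \<nu>"
  proof (rule Z_delete[of _ "f 0"])
    show "2 \<le> card (nb (insert (f 1) S) (f 0))"
      using nb0 adj01 inj[of 1 "n - 1"] assms(7) by (simp add: nb_insert)
  qed (use fin nS nQ assms(3,8) T in auto)
  then have Z1: "Z S (\<nu>(f 2 := \<nu> (f 2) - \<nu> (f 1)))" using Z_leaf[OF fin(1) nS(2) nb1 nA] by simp
  have "Z (insert (f 0) S) \<nu>"
  proof (rule Z_delete[of _ "f 1"])
    show "2 \<le> card (nb (insert (f 0) S) (f 1))"
      using nb1 adj01 inj[of 0 2] assms(7) by (simp add: nb_insert)
  qed (use fin nS nQ assms(3,8) T in \<open>auto simp: insert_commute\<close>)
  then have Z0: "Z S (\<nu>(f (n - 1) := \<nu> (f (n - 1)) - \<nu> (f 0)))" using Z_leaf[OF fin(1) nS(1) nb0 nA] by simp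
  have ne: "f (n - 1) \<noteq> f 2"
  proof
    assume "f (n - 1) = f 2"
    then show False using inj[of "n - 1" 2] assms(7) by linarith
  qed
  let ?\<mu> = "\<lambda>v. (\<nu>(f 2 := \<nu> (f 2) - \<nu> (f 1))) v - (\<nu>(f (n - 1) := \<nu> (f (n - 1)) - \<nu> (f 0))) v"
  have "Z S ?\<mu>" using Z_diff[OF Z1 Z0] .
  moreover have "?\<mu> v = 0" if "v \<in> S - ?Q" for v
  proof -
    have "v \<noteq> f 2" "v \<noteq> f (n - 1)" using that assms(7) by auto
    then show ?thesis by simp
  qed
  moreover have "?Q \<subseteq> S" by (simp add: S_def)
  ultimately have "Z ?Q ?\<mu>" using Z_elim[OF fin(1) cS nA cQ, of ?\<mu>] by blast
  then have "Z (set (map f [2..<n])) ?\<mu>" by simp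
  then have "alt ?\<mu> (map f [2..<n]) = 0"
    using Z_ipath[OF ipath_cyc[OF assms(5), of 2]] assms(7) by simp
  moreover have "map f [2..<n] = f 2 # map f [3..<n]"
    using assms(7) upt_conv_Cons[of 2 n] by (simp add: eval_nat_numeral)
  moreover have "alt ?\<mu> (map f [3..<n]) = (-1) ^ (n - 4) * \<nu> (f 0)"
  proof -
    have m: "[3..<n] = [3..<n - 1] @ [n - 1]" using assms(7) upt_Suc_append[of 3 "n - 1"] by simp
    have "?\<mu> v = 0" if "v \<in> f ` {3..<n - 1}" for v
    proof -
      have "v \<noteq> f 2" "v \<noteq> f (n - 1)" using that assms(7) inj by auto
      then show ?thesis by simp
    qed
    then have "alt ?\<mu> (map f [3..<n]) = (-1) ^ (length (map f [3..<n]) - 1) * ?\<mu> (last (map f [3..<n]))"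
      by (intro alt_last) (auto simp: m)
    moreover have "length (map f [3..<n]) - 1 = n - 4" "last (map f [3..<n]) = f (n - 1)" by (auto simp: m)
    moreover have "?\<mu> (f (n - 1)) = \<nu> (f 0)" using ne by simp
    ultimately show ?thesis by (simp only:)
  qed
  moreover have "odd (n - 4)" using assms(6,7) by simp
  moreover have "?\<mu> (f 2) = - \<nu> (f 1)" using ne by simp
  ultimately have "- \<nu> (f 1) - (-1) ^ (n - 4) * \<nu> (f 0) = 0" by (simp only: alt.simps)
  then show ?thesis using \<open>odd (n - 4)\<close> by simp
qed

lemma leaf_const_cyc:
  assumes "finite T" "conn T" "\<not> AT1 T" "leaf T w L T0" "cyc n f L" "odd n" "5 \<le> n" "Z T \<nu>"
    "f 0 = w" "1 \<le> i" "i < n"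
  shows "\<nu> (f i) = \<nu> (f 1)"
  using assms(10,11)
proof (induction i rule: dec_induct)
  case (step m)
  have inj: "inj_on f {..<n}" using assms(5) by (auto simp: cyc_def bij_betw_def)
  have ne: "f j \<noteq> w" if "1 \<le> j" "j < n" for j
    using inj_onD[OF inj, of j 0] assms(9) that by auto
  have "\<nu> (f ((0 + m) mod n)) = \<nu> (f ((1 + m) mod n))"
    using leaf_const_cyc_step[OF assms(1-4) cyc_rotate[OF assms(5), of m] assms(6,7,8)]
      ne[of m] ne[of "Suc m"] step by simp
  then show ?case using step by simp
qed simp

text \<open>What non-AT-ness of \<open>x + T\<close> says about the neighbourhood \<open>N\<close> of \<open>x\<close>, simultaneously for all \<open>T' \<subseteq> T\<close>.\<close>

definition hered :: "nat \<Rightarrow> 'a set \<Rightarrow> 'a set \<Rightarrow> bool" where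
  "hered s N T \<longleftrightarrow> (\<forall>T'\<subseteq>T. conn T' \<longrightarrow> s < card (N \<inter> T') \<longrightarrow> Z T' (ind N))"

lemma hered_of_not_AT:
  assumes "finite T" "x \<notin> T" "conn (insert x T)" "\<not> AT (demand x s) (insert x T)"
  shows "hered s (nb T x) T"
  unfolding hered_def
proof (intro allI impI)
  fix T' assume T': "T' \<subseteq> T" "conn T'" "s < card (nb T x \<inter> T')"
  have nb: "nb T x \<inter> T' = nb T' x" using T' by (auto simp: nb_def)
  have "Z T' (ind (nb T' x))"
  proof (rule ccontr)
    assume n: "\<not> Z T' (ind (nb T' x))"
    have "AT (demand x s) (insert x T')"
      using T' assms(1,2) nb n by (intro AT_of_not_Z) (auto intro: finite_subset)
    moreover have "insert x T' \<subseteq> insert x T" using T' by auto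
    ultimately have "AT (demand x s) (insert x T)"
      using AT_superset[OF assms(3), of "insert x T'"] assms(1) by (auto simp: demand_def)
    then show False using assms by blast
  qed
  moreover have "ind (nb T' x) v = ind (nb T x) v" if "v \<in> T'" for v
    using that T' by (auto simp: ind_def nb_def)
  ultimately show "Z T' (ind (nb T x))" using Z_cong[of T' "ind (nb T' x)" "ind (nb T x)"] by blast
qed

lemma cyc3_clq: "cyc 3 f L \<Longrightarrow> clq L"
proof -
  assume c: "cyc 3 f L"
  have L: "L = f ` {..<3}" using c by (simp add: cyc_def bij_betw_def)
  have "adj (f i) (f j)" if "i < 3" "j < 3" "i \<noteq> j" for i j
  proof -
    have "i = 0 \<or> i = 1 \<or> i = 2" "j = 0 \<or> j = 1 \<or> j = 2" using that by linarith+
    then have "j = Suc i mod 3 \<or> i = Suc j mod 3" using that(3) by auto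
    then show ?thesis using c that by (auto simp: cyc_def)
  qed
  then show ?thesis unfolding clq_def L by auto
qed

lemma leaf_const:
  assumes "finite T" "conn T" "\<not> AT1 T" "leaf T w L T0" "clq L \<or> oddcyc L" "Z T \<nu>"
    "a \<in> L - {w}" "b \<in> L - {w}"
  shows "\<nu> a = \<nu> b"
proof (cases "clq L")
  case True
  then show ?thesis using leaf_const_clq assms by blast
next
  case False
  then obtain n f where n: "odd n" and c: "cyc n f L" using assms by (auto simp: oddcyc_def)
  have "n \<noteq> 3" using cyc3_clq c False by auto
  then have n5: "5 \<le> n" using n c by (auto simp: cyc_def) presburger
  have "w \<in> L" using assms(4) by (auto simp: leaf_def)
  then obtain k where k: "k < n" "f k = w" using c by (auto simp: cyc_def bij_betw_def)
  let ?g = "\<lambda>i. f ((i + k) mod n)"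
  have g: "cyc n ?g L" using cyc_rotate[OF c] .
  have g0: "?g 0 = w" using k by simp
  have "\<nu> v = \<nu> (?g 1)" if "v \<in> L - {w}" for v
  proof -
    have "v \<in> ?g ` {..<n}" using that g by (simp add: cyc_def bij_betw_def)
    then obtain i where i: "i < n" "v = ?g i" by auto
    then have "i \<noteq> 0" using that g0 by (metis DiffE singletonI)
    then show ?thesis using leaf_const_cyc[OF assms(1-4) g n n5 assms(6) g0, of i] i by simp
  qed
  then show ?thesis using assms(7,8) by metis
qed

lemma cyc_three_path:
  assumes "cyc n f L" "5 \<le> n"
  shows "ipath [f 1, f 2, f 3]"
proof -
  have adj: "\<And>i j. i < n \<Longrightarrow> j < n \<Longrightarrow> adj (f i) (f j) \<longleftrightarrow> j = Suc i mod n \<or> i = Suc j mod n"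
    and inj: "inj_on f {..<n}"
    using assms(1) by (auto simp: cyc_def bij_betw_def)
  have "adj (f 1) (f 2)" "adj (f 2) (f 3)" "\<not> adj (f 1) (f 3)"
    using adj[of 1 2] adj[of 2 3] adj[of 1 3] assms(2) by auto
  moreover have "f 1 \<noteq> f 2" "f 1 \<noteq> f 3" "f 2 \<noteq> f 3"
    using inj_onD[OF inj, of 1 2] inj_onD[OF inj, of 1 3] inj_onD[OF inj, of 2 3] assms(2) by auto
  ultimately show ?thesis by (auto simp: nb_def)
qed

text \<open>The weights are constant off \<open>w\<close> and one of them is 1, so all of them are
  1. If \<open>T0\<close> still contained more than \<open>s\<close> neighbours, the indicator would
  vanish on \<open>T0\<close> directly as well as after removing the leaf block, where 1 has been
  subtracted at \<open>w\<close>; the difference is a nonzero form at one vertex.\<close>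

lemma leaf_bound:
  assumes "finite T" "conn T" "\<not> AT1 T" "leaf T w L T0" "clq L \<or> oddcyc L"
    and "hered s N T" "s \<le> 2" "N \<subseteq> T" "s < card N" "N \<inter> (L - {w}) \<noteq> {}"
  shows "clq L" "L - {w} \<subseteq> N" "card (N \<inter> T0) \<le> s"
proof -
  note l = assms(4)[unfolded leaf_def]
  have NT: "N \<inter> T = N" using assms(8) by blast
  have ZT: "Z T (ind N)" using assms(6,2,9) NT unfolding hered_def by simp
  obtain a where a: "a \<in> N" "a \<in> L - {w}" using assms(10) by blast
  show LN: "L - {w} \<subseteq> N"
  proof
    fix b assume "b \<in> L - {w}"
    then have "ind N a = ind N b" using leaf_const[OF assms(1-5) ZT] a by blast
    then show "b \<in> N" using a by (auto simp: ind_def split: if_splits)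
  qed
  show c: "clq L"
  proof (rule ccontr)
    assume n: "\<not> clq L"
    then obtain n f where n: "odd n" and c: "cyc n f L" using assms by (auto simp: oddcyc_def)
    have "n \<noteq> 3" using cyc3_clq c \<open>\<not> clq L\<close> by auto
    then have n5: "5 \<le> n" using n c by (auto simp: cyc_def) presburger
    have "w \<in> L" using assms(4) by (auto simp: leaf_def)
    then obtain k where k: "k < n" "f k = w" using c by (auto simp: cyc_def bij_betw_def)
    let ?g = "\<lambda>i. f ((i + k) mod n)"
    have g: "cyc n ?g L" using cyc_rotate[OF c] .
    have gi: "inj_on ?g {..<n}" "?g ` {..<n} = L" using g by (auto simp: cyc_def bij_betw_def)
    have g0: "?g 0 = w" using k by simp
    have in_N: "?g i \<in> N" if "1 \<le> i" "i < n" for i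
    proof -
      have "?g i \<noteq> ?g 0" using inj_onD[OF gi(1), of i 0] that by auto
      moreover have "?g i \<in> L" using gi(2) that by blast
      ultimately show ?thesis using LN g0 by auto
    qed
    \<comment> \<open>Three consecutive vertices of a long cycle, away from \<open>w\<close>: more
      than \<open>s\<close> neighbours, with alternating sum 1 - 1 + 1, contradicting
      \<open>hered\<close>.\<close>
    let ?p = "[?g 1, ?g 2, ?g 3]"
    have p: "ipath ?p" using cyc_three_path[OF g n5] .
    have sub: "set ?p \<subseteq> N" using in_N[of 1] in_N[of 2] in_N[of 3] n5 by simp
    then have "card (N \<inter> set ?p) = 3"
      using ipath_distinct[OF p] distinct_card[of ?p] by (simp add: Int_absorb1)
    then have "Z (set ?p) (ind N)"
      using assms(6)[unfolded hered_def, rule_format, of "set ?p"] assms(7,8) sub conn_ipath[OF p] by auto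
    then have "alt (ind N) ?p = 0" using Z_ipath[OF p] by blast
    then show False using sub by (auto simp: ind_def)
  qed
  show "card (N \<inter> T0) \<le> s"
  proof (rule ccontr)
    assume "\<not> card (N \<inter> T0) \<le> s"
    then have Z0: "Z T0 (ind N)" using assms(6) l unfolding hered_def by auto
    have "Z T0 ((ind N)(w := ind N w - ind N a))" using clq_reduce[OF assms(1-4) c ZT a(2)] .
    then have "Z T0 (\<lambda>v. ind N v - ((ind N)(w := ind N w - ind N a)) v)" using Z0 by (intro Z_diff)
    moreover have "(\<lambda>v. ind N v - ((ind N)(w := ind N w - ind N a)) v) = (\<lambda>v. if v = w then 1 else 0)"
      using a by (auto simp: ind_def)
    ultimately have "Z T0 (\<lambda>v. if v = w then 1 else 0)" by simp
    moreover have "finite T0" using assms(1) l by (metis finite_Un)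
    moreover have "\<not> AT1 T0" using AT1_superset[OF assms(2,1), of T0] assms(3) l conn_nonempty by auto
    ultimately show False using l Z_point[of T0 w 1] by auto
  qed
qed

text \<open>With one block every vertex may play the cutvertex. To compare a neighbour
  \<open>a\<close> with a non-neighbour \<open>b\<close>, take as cutvertex a second neighbour,
  which exists since there are more than \<open>s\<close> of them.\<close>

lemma single_block:
  assumes "finite T" "conn T" "\<not> AT1 T" "clq T \<or> oddcyc T"
    and "hered s N T" "1 \<le> s" "s \<le> 2" "N \<subseteq> T" "s < card N"
  shows "clq T" "N = T"
proof -
  have "N \<noteq> {}" using assms(9) by auto
  then obtain a where a: "a \<in> N" by blast
  have NT: "N \<inter> T = N" using assms(8) by blast
  have ZT: "Z T (ind N)" using assms(5,2,9) NT unfolding hered_def by simp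
  have fN: "finite N" using assms(1,8) finite_subset by blast
  show "N = T"
  proof (rule ccontr)
    assume "N \<noteq> T"
    then obtain b where b: "b \<in> T" "b \<notin> N" using assms(8) by blast
    have "\<not> N \<subseteq> {a}" using assms(6,9) card_mono[of "{a}" N] by auto
    then obtain w where w: "w \<in> N" "w \<noteq> a" by blast
    then have "ind N a = ind N b"
      using leaf_const[OF assms(1-3) leaf_whole[of w T] assms(4) ZT, of a b] a b assms(8) by blast
    then show False using a b by (auto simp: ind_def)
  qed
  then have "\<not> T \<subseteq> {a}" using assms(6,9) card_mono[of "{a}" N] by auto
  then obtain w where w: "w \<in> T" "w \<noteq> a" by blast
  show "clq T"
    using leaf_bound(1)[OF assms(1-3) leaf_whole[OF w(1)] assms(4,5,7,8,9)] a w assms(8) by blast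
qed

section \<open>Gallai trees\<close>

lemma conn_remove_leaf:
  assumes "conn T" "a \<in> T" "T \<noteq> {a}" "nb T a = {b}"
  shows "conn (T - {a})"
proof (rule connI[of b])
  have ab: "adj a b" "b \<in> T" using assms(4) by (auto simp: nb_def)
  then show "b \<in> T - {a}" using adj_irrefl by auto
  fix S assume S: "S \<subseteq> T - {a}" "S \<noteq> {}" "b \<notin> S"
  obtain u v where uv: "u \<in> S" "v \<in> T - S" "adj u v" using connE[OF assms(1), of S] S assms(2) by blast
  have "v \<noteq> a"
  proof
    assume "v = a"
    then have "u \<in> nb T a" using uv S adj_sym by (auto simp: nb_def)
    then show False using assms(4) uv S by auto
  qed
  then show "\<exists>u\<in>S. \<exists>v\<in>T - {a} - S. adj u v" using uv by blast
qed

lemma conn_nb_nonempty: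
  assumes "conn T" "a \<in> T" "T \<noteq> {a}"
  shows "nb T a \<noteq> {}"
  using connE[OF assms(1), of "{a}"] assms by (auto simp: nb_def)

lemma deg2_path:
  assumes "finite T" "conn T" "a \<in> T" "card (nb T a) \<le> 1" "\<And>v. v \<in> T \<Longrightarrow> card (nb T v) \<le> 2"
  shows "\<exists>p. set p = T \<and> ipath p \<and> p \<noteq> [] \<and> hd p = a"
  using assms
proof (induction "card T" arbitrary: T a rule: less_induct)
  case less
  show ?case
  proof (cases "T = {a}")
    case True
    then show ?thesis by (intro exI[of _ "[a]"]) auto
  next
    case False
    have "nb T a \<noteq> {}" using conn_nb_nonempty less.prems False by blast
    then have "card (nb T a) = 1" using less.prems(4) finite_nb[of T a] by (simp add: le_Suc_eq)
    then obtain b where b: "nb T a = {b}" by (auto simp: card_1_singleton_iff)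
    define S where "S = T - {a}"
    have S: "conn S" "finite S" using conn_remove_leaf[OF less.prems(2,3) False b] less.prems by (auto simp: S_def)
    have ba: "b \<in> S" "adj b a" using b adj_sym adj_irrefl by (auto simp: nb_def S_def)
    have nbS: "nb S v = nb T v - {a}" for v by (auto simp: nb_def S_def)
    have "a \<in> nb T b" using ba less.prems(3) by (auto simp: nb_def)
    then have "card (nb S b) \<le> 1"
      using less.prems(5)[of b] ba finite_nb[of T b] unfolding nbS by (simp add: S_def)
    moreover have "card (nb S v) \<le> 2" if "v \<in> S" for v
      using less.prems(5)[of v] that card_mono[OF finite_nb, of "nb S v" T v] unfolding nbS
      by (auto simp: S_def)
    moreover have "card S < card T" unfolding S_def using less.prems(1,3) by (rule card_Diff1_less)
    ultimately obtain p where p: "set p = S" "ipath p" "p \<noteq> []" "hd p = b"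
      using less.hyps[of S b] S ba by blast
    have "nb S a = {b}" unfolding nbS b using adj_irrefl b by (auto simp: nb_def)
    then have "ipath (a # p)" using p by (simp add: S_def)
    moreover have "set (a # p) = T" using p less.prems by (auto simp: S_def)
    ultimately show ?thesis by (intro exI[of _ "a # p"]) simp
  qed
qed

lemma nonsep_conn: "nonsep W \<Longrightarrow> conn W"
  by (simp add: nonsep_def)

lemma nonsep_remove: "nonsep W \<Longrightarrow> v \<in> W \<Longrightarrow> W \<noteq> {v} \<Longrightarrow> conn (W - {v})"
  by (auto simp: nonsep_def)

text \<open>Deleting \<open>w\<close> does not disconnect x + T, and x is the only possible way out
  of the leaf block.\<close>

lemma leaf_meets:
  assumes "nonsep (insert x T)" "x \<notin> T" "sep T w L T0"
  shows "nb T x \<inter> (L - {w}) \<noteq> {}"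
proof -
  note s = assms(3)[unfolded sep_def]
  have w: "w \<in> L" "w \<in> T0" using s by auto
  have "conn (insert x T - {w})" using assms w s by (intro nonsep_remove) auto
  moreover have "L - {w} \<subseteq> insert x T - {w}" "L - {w} \<noteq> {}" "L - {w} \<noteq> insert x T - {w}"
    using s assms(2) w by auto
  ultimately obtain u v where uv: "u \<in> L - {w}" "v \<in> insert x T - {w} - (L - {w})" "adj u v" by (rule connE)
  have "v = x"
  proof (rule ccontr)
    assume "v \<noteq> x"
    then have "v \<in> T0 - {w}" using uv s by auto
    then show False using uv s by blast
  qed
  then have "u \<in> nb T x" using uv s adj_sym by (auto simp: nb_def)
  then show ?thesis using uv by blast
qed

text \<open>The classification of blocks enters as the hypothesis \<open>rub\<close>, so that the
  lemma can be used inside the inductive proof of that classification, where it is known for smaller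
  sets only.\<close>

lemma leaves_info:
  assumes "finite T" "x \<notin> T" "nonsep (insert x T)" "conn T" "\<not> AT1 T" "\<not> nonsep T"
    and "hered s (nb T x) T" "s \<le> 2" "s < card (nb T x)"
    and rub: "\<And>L. nonsep L \<Longrightarrow> L \<subseteq> T \<Longrightarrow> \<not> AT1 L \<Longrightarrow> clq L \<or> oddcyc L"
  obtains v A B w L T0 w' L' T0' where "sep T v A B"
    "sep T w L T0" "L - {w} \<subseteq> A - {v}" "sep T w' L' T0'" "L' - {w'} \<subseteq> B - {v}"
    "clq L" "clq L'" "L - {w} \<subseteq> nb T x" "L' - {w'} \<subseteq> nb T x"
    "card (nb T x \<inter> T0) \<le> s" "card (nb T x \<inter> T0') \<le> s"
    "L' - {w'} \<subseteq> T0" "L - {w} \<subseteq> T0'"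
proof -
  obtain v A B w L T0 w' L' T0' where s: "sep T v A B" and
    l: "sep T w L T0" "nonsep L" "L - {w} \<subseteq> A - {v}" and
    l': "sep T w' L' T0'" "nonsep L'" "L' - {w'} \<subseteq> B - {v}"
    using two_leaves[OF assms(1,4,6)] .
  have nT: "nb T x \<subseteq> T" by (auto simp: nb_def)
  have good: "clq L \<and> L - {w} \<subseteq> nb T x \<and> card (nb T x \<inter> T0) \<le> s" if l: "sep T w L T0" "nonsep L" for w L T0
  proof -
    have LT: "L \<subseteq> T" using l by (auto simp: sep_def)
    have "\<not> AT1 L" using AT1_superset[OF assms(4,1) LT] assms(5) conn_nonempty nonsep_conn l by blast
    then have "clq L \<or> oddcyc L" using rub l LT by blast
    then show ?thesis
      using leaf_bound[OF assms(1,4,5) leaf_sep[OF l(1)] _ assms(7,8) nT assms(9) leaf_meets[OF assms(3,2) l(1)]]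
      by blast
  qed
  have "A \<inter> B = {v}" using s by (auto simp: sep_def)
  then have disj: "(L - {w}) \<inter> (L' - {w'}) = {}" using l(3) l'(3) by blast
  have "L' - {w'} \<subseteq> T0" using disj l(1) l'(1) unfolding sep_def by blast
  moreover have "L - {w} \<subseteq> T0'" using disj l(1) l'(1) unfolding sep_def by blast
  ultimately show thesis using that[OF s l(1,3) l'(1,3)] good[OF l(1,2)] good[OF l'(1,2)] by blast
qed

lemma insert_clq:
  assumes "clq T" "nb T x = T"
  shows "clq (insert x T)"
proof -
  have "adj x u \<and> adj u x" if "u \<in> T" for u
    using that assms(2) adj_sym[of x u] unfolding nb_def by blast
  then show ?thesis using assms(1) by (auto simp: clq_def)
qed

lemma nonsep_deg:
  assumes "finite W" "nonsep W" "x \<in> W" "3 \<le> card W"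
  shows "2 \<le> card (nb (W - {x}) x)"
proof (rule ccontr)
  assume "\<not> ?thesis"
  then have le: "card (nb (W - {x}) x) \<le> 1" by simp
  have ne: "W \<noteq> {a}" "W \<noteq> {a, b}" for a b
    using assms(4) by (auto simp: card_insert_if split: if_splits)
  obtain u v where uv: "u \<in> {x}" "v \<in> W - {x}" "adj u v"
    using connE[OF nonsep_conn[OF assms(2)], of "{x}"] assms(3) ne by blast
  then have v: "v \<in> nb (W - {x}) x" by (auto simp: nb_def)
  then have one: "nb (W - {x}) x = {v}"
    using le finite_nb[of "W - {x}" x] by (metis One_nat_def card_le_Suc0_iff_eq is_singletonI' is_singleton_def equals0D singletonD)
  have "conn (W - {v})" using nonsep_remove[OF assms(2)] uv ne by blast
  moreover have "{x} \<subseteq> W - {v}" "{x} \<noteq> W - {v}" using uv assms(3) ne(2)[of x v] by auto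
  ultimately obtain y where "y \<in> W - {v} - {x}" "adj x y" using connE[of "W - {v}" "{x}"] by blast
  then have "y \<in> nb (W - {x}) x" by (auto simp: nb_def)
  then show False using one \<open>y \<in> W - {v} - {x}\<close> by auto
qed

text \<open>Delete a vertex x and apply the leaf-block bounds with \<open>s = 1\<close>. If some
  deletion leaves no cutvertex, the rest is a clique completely joined to x. Otherwise each deletion
  leaves two leaf blocks, which forces degree 2 everywhere, hence a cycle, and the alternating sum
  makes it odd.\<close>

lemma not_AT1_nonsep_imp:
  assumes "finite W" "nonsep W" "\<not> AT1 W"
  shows "clq W \<or> oddcyc W"
  using assms
proof (induction "card W" arbitrary: W rule: less_induct)
  case less
  have cW: "conn W" using less.prems nonsep_conn by blast
  show ?case
  proof (cases "card W < 3")
    case True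
    have "clq W"
      unfolding clq_def
    proof (intro ballI impI)
      fix u v assume uv: "u \<in> W" "v \<in> W" "u \<noteq> v"
      have "{u, v} = W" using uv True less.prems(1) by (intro card_seteq) auto
      then obtain a b where "a \<in> {u}" "b \<in> {u, v} - {u}" "adj a b" using connE[OF cW, of "{u}"] uv by blast
      then show "adj u v" by auto
    qed
    then show ?thesis ..
  next
    case False
    then have c3: "3 \<le> card W" by simp
    have ne: "W \<noteq> {x}" for x using c3 by auto
    have T: "conn (W - {x})" "finite (W - {x})" "x \<notin> W - {x}" "insert x (W - {x}) = W"
      "\<not> AT1 (W - {x})" "hered 1 (nb (W - {x}) x) (W - {x})" "2 \<le> card (nb (W - {x}) x)"
      "\<And>L. nonsep L \<Longrightarrow> L \<subseteq> W - {x} \<Longrightarrow> \<not> AT1 L \<Longrightarrow> clq L \<or> oddcyc L" if x: "x \<in> W" for x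
    proof -
      show c: "conn (W - {x})" using nonsep_remove[OF less.prems(2) x ne] .
      show f: "finite (W - {x})" and n: "x \<notin> W - {x}" and i: "insert x (W - {x}) = W"
        using less.prems x by auto
      show "\<not> AT1 (W - {x})" using AT1_superset[OF cW less.prems(1), of "W - {x}"] less.prems(3) conn_nonempty[OF c] by blast
      show "hered 1 (nb (W - {x}) x) (W - {x})"
        using hered_of_not_AT[OF f n, of 1] cW less.prems(3) unfolding i demand_1 by blast
      show "2 \<le> card (nb (W - {x}) x)" using nonsep_deg less.prems(1,2) x c3 by blast
      fix L assume L: "nonsep L" "L \<subseteq> W - {x}" "\<not> AT1 L"
      have "card L < card W" using L x less.prems(1) by (intro psubset_card_mono) auto
      then show "clq L \<or> oddcyc L" using less.hyps[of L] L less.prems(1) finite_subset by blast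
    qed
    have nbT: "nb (W - {x}) x \<subseteq> W - {x}" for x by (auto simp: nb_def)
    show ?thesis
    proof (cases "\<exists>x\<in>W. nonsep (W - {x})")
      case True
      then obtain x where x: "x \<in> W" "nonsep (W - {x})" by blast
      have "clq (W - {x}) \<or> oddcyc (W - {x})" using T(8)[OF x(1) x(2) subset_refl T(5)[OF x(1)]] .
      then have "clq (W - {x})" "nb (W - {x}) x = W - {x}"
        using single_block[OF T(2,1,5)[OF x(1)] _ T(6)[OF x(1)] _ _ nbT] T(7)[OF x(1)] by auto
      then have "clq (insert x (W - {x}))" by (rule insert_clq)
      then show ?thesis using T(4)[OF x(1)] by simp
    next
      case False
      have deg: "card (nb (W - {x}) x) = 2" if x: "x \<in> W" for x
      proof -
        let ?T = "W - {x}" and ?N = "nb (W - {x}) x"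
        have ns: "\<not> nonsep ?T" using False x by blast
        have nsi: "nonsep (insert x ?T)" using less.prems(2) T(4)[OF x] by simp
        have c: "1 < card ?N" using T(7)[OF x] by simp
        obtain v A B w L T0 w' L' T0' where "sep ?T v A B"
          and l: "sep ?T w L T0" and "L - {w} \<subseteq> A - {v}" "sep ?T w' L' T0'" "L' - {w'} \<subseteq> B - {v}"
            "clq L" "clq L'" "L - {w} \<subseteq> ?N" "L' - {w'} \<subseteq> ?N"
            and cards: "card (?N \<inter> T0) \<le> 1" "card (?N \<inter> T0') \<le> 1"
            and "L' - {w'} \<subseteq> T0" and LT0: "L - {w} \<subseteq> T0'"
          using leaves_info[OF T(2,3)[OF x] nsi T(1,5)[OF x] ns T(6)[OF x] one_le_numeral c T(8)[OF x]] .
        have "?N \<subseteq> (?N \<inter> T0') \<union> (?N \<inter> T0)" using l LT0 nbT[of x] unfolding sep_def by blast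
        then have "card ?N \<le> card (?N \<inter> T0') + card (?N \<inter> T0)"
          by (metis (no_types, lifting) card_Un_le card_mono dual_order.trans finite_Int finite_UnI finite_nb)
        then show ?thesis using cards T(7)[OF x] by linarith
      qed
      obtain x where x: "x \<in> W" using conn_nonempty[OF cW] by blast
      let ?T = "W - {x}"
      obtain a a' where a: "nb ?T x = {a, a'}" "a \<noteq> a'" using deg[OF x] by (auto simp: card_2_iff)
      have degW: "card (nb W v) = 2" if "v \<in> W" for v
      proof -
        have "nb W v = nb (W - {v}) v" using adj_irrefl by (auto simp: nb_def)
        then show ?thesis using deg[OF that] by simp
      qed
      have nbT': "nb ?T v = nb W v - {x}" for v by (auto simp: nb_def)
      have end_deg: "card (nb ?T b) = 1" if "b \<in> {a, a'}" for b
      proof -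
        have "b \<in> nb ?T x" using that a by simp
        then have "b \<in> W" "x \<in> nb W b" using x adj_sym by (auto simp: nb_def)
        then show ?thesis using degW[of b] finite_nb[of W b] unfolding nbT' by simp
      qed
      have aT: "a \<in> ?T" "a' \<in> ?T" using a nbT[of x] by auto
      have "card (nb ?T v) \<le> 2" if "v \<in> ?T" for v
        using degW[of v] that card_mono[OF finite_nb, of "nb ?T v" W v] unfolding nbT' by auto
      then obtain p where p: "set p = ?T" "ipath p" "p \<noteq> []" "hd p = a"
        using deg2_path[OF T(2,1)[OF x] aT(1)] end_deg[of a] by auto
      obtain i where i: "i < length p" "p ! i = a'" using p(1) aT(2) by (metis in_set_conv_nth)
      have p0: "p ! 0 = a" using p by (simp add: hd_conv_nth)
      have i0: "i \<noteq> 0" using p0 i(2) a(2) by metis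
      \<comment> \<open>The second neighbour \<open>a'\<close> of x has degree 1 after the deletion,
        so it cannot be an inner vertex of the path.\<close>
      have ilast: "i = length p - 1"
      proof (rule ccontr)
        assume "i \<noteq> length p - 1"
        then have "Suc i < length p" using i by linarith
        have "adj a' (p ! (i - 1))" "adj a' (p ! Suc i)"
          using ipath_adj[OF p(2) i(1), of "i - 1"] ipath_adj[OF p(2) i(1), of "Suc i"]
            i i0 \<open>Suc i < length p\<close> by simp_all
        moreover have "p ! (i - 1) \<in> ?T" "p ! Suc i \<in> ?T"
          using \<open>Suc i < length p\<close> unfolding p(1)[symmetric] by simp_all
        ultimately have "p ! (i - 1) \<in> nb ?T a'" "p ! Suc i \<in> nb ?T a'"
          unfolding nb_def by blast+
        moreover have "p ! (i - 1) \<noteq> p ! Suc i"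
          using ipath_distinct[OF p(2)] \<open>Suc i < length p\<close> by (simp add: nth_eq_iff_index_eq)
        ultimately have "2 \<le> card (nb ?T a')"
          using card_mono[OF finite_nb, of "{p ! (i - 1), p ! Suc i}" ?T a'] by simp
        then show False using end_deg[of a'] by simp
      qed
      have "nb ?T x \<inter> ?T = nb ?T x" using nbT[of x] by blast
      then have "Z ?T (ind (nb ?T x))"
        using T(6)[OF x, unfolded hered_def, rule_format, of ?T] T(1,7)[OF x] by simp
      then have "Z (set p) (ind {a, a'})" unfolding p(1) a(1) .
      then have alt0: "alt (ind {a, a'}) p = 0" using Z_ipath p by blast
      obtain q where q: "p = a # q" using p by (cases p) auto
      have dq: "distinct (a # q)" using ipath_distinct p(2) q by auto
      have qne: "q \<noteq> []" using i i0 q by auto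
      have lq: "last q = a'" using i ilast p(3) q qne by (metis last_ConsR last_conv_nth)
      have "alt (ind {a, a'}) q = (-1) ^ (length q - 1) * ind {a, a'} (last q)"
      proof (rule alt_last[OF qne])
        fix v assume v: "v \<in> set (butlast q)"
        have "q = butlast q @ [last q]" using qne by simp
        then have "distinct (butlast q @ [last q])" using dq by (metis distinct.simps(2))
        then have "v \<noteq> a'" "v \<noteq> a" using v lq dq in_set_butlastD[of v q] by auto
        then show "ind {a, a'} v = 0" by (simp add: ind_def)
      qed
      then have "1 - (-1) ^ (length q - 1) = (0::int)" using alt0 q lq by (simp add: ind_def)
      then have even: "even (length q - 1)" by (cases "even (length q - 1)") auto
      have len: "length p = Suc (length q)" "1 \<le> length q" using q qne by (auto simp: Suc_le_eq)
      let ?n = "Suc (length p)"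
      have "odd ?n" using even len qne by simp
      moreover have "cyc ?n (nth (x # p)) W"
        unfolding cyc_def
      proof (intro conjI allI impI)
        show "3 \<le> ?n" using len by simp
        have "distinct (x # p)" using ipath_distinct p x by auto
        moreover have "set (x # p) = W" using p x by auto
        ultimately show "bij_betw ((!) (x # p)) {..<?n} W" using bij_betw_nth[of "x # p"] by simp
        have xp: "adj x (p ! k) \<longleftrightarrow> k = 0 \<or> k = length p - 1" if k: "k < length p" for k
        proof -
          have "p ! k \<in> ?T" using nth_mem[OF k] unfolding p(1) .
          then have "adj x (p ! k) \<longleftrightarrow> p ! k \<in> nb ?T x" unfolding nb_def by blast
          also have "\<dots> \<longleftrightarrow> p ! k = p ! 0 \<or> p ! k = p ! i" using a i p0 by simp
          also have "\<dots> \<longleftrightarrow> k = 0 \<or> k = i"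
            using ipath_distinct[OF p(2)] k i(1) p(3) by (simp add: nth_eq_iff_index_eq)
          finally show ?thesis using ilast by simp
        qed
        have xp': "adj (p ! k) x \<longleftrightarrow> k = 0 \<or> k = length p - 1" if k: "k < length p" for k
          using xp[OF k] adj_sym by blast
        have modS: "Suc m mod ?n = (if m = length p then 0 else Suc m)" if "m < ?n" for m
          using that by auto
        fix i j assume ij: "i < ?n" "j < ?n"
        show "adj ((x # p) ! i) ((x # p) ! j) \<longleftrightarrow> j = Suc i mod ?n \<or> i = Suc j mod ?n"
        proof (cases i)
          case 0
          show ?thesis
          proof (cases j)
            case 0
            then show ?thesis using \<open>i = 0\<close> adj_irrefl[of x] modS[of 0] len by simp
          next
            case (Suc j')
            then have j': "j' < length p" using ij by simp
            show ?thesis using xp[OF j'] modS[OF ij(1)] modS[OF ij(2)] len \<open>i = 0\<close> Suc by auto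
          qed
        next
          case (Suc i')
          note i' = this
          show ?thesis
          proof (cases j)
            case 0
            have "i' < length p" using i' ij by simp
            then show ?thesis using xp'[of i'] modS[OF ij(1)] modS[OF ij(2)] len i' 0 by auto
          next
            case (Suc j')
            have "i' < length p" "j' < length p" using i' Suc ij by auto
            then have "adj (p ! i') (p ! j') \<longleftrightarrow> j' = Suc i' \<or> i' = Suc j'" by (rule ipath_adj[OF p(2)])
            moreover have "j = Suc i mod ?n \<longleftrightarrow> j' = Suc i'"
            proof (cases "i = length p")
              case True
              then show ?thesis unfolding modS[OF ij(1)] using i' Suc \<open>j' < length p\<close> by simp
            next
              case False
              then show ?thesis unfolding modS[OF ij(1)] using i' Suc by simp
            qed
            moreover have "i = Suc j mod ?n \<longleftrightarrow> i' = Suc j'"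
            proof (cases "j = length p")
              case True
              then show ?thesis unfolding modS[OF ij(2)] using i' Suc \<open>i' < length p\<close> by simp
            next
              case False
              then show ?thesis unfolding modS[OF ij(2)] using i' Suc by simp
            qed
            ultimately show ?thesis unfolding i' Suc nth_Cons_Suc by (simp only:)
          qed
        qed
      qed
      ultimately show ?thesis unfolding oddcyc_def by blast
    qed
  qed
qed

definition blk :: "'a set \<Rightarrow> 'a set \<Rightarrow> bool" where
  "blk W B \<longleftrightarrow> B \<subseteq> W \<and> nonsep B \<and> (\<forall>B'. B \<subseteq> B' \<longrightarrow> B' \<subseteq> W \<longrightarrow> nonsep B' \<longrightarrow> B' = B)"

definition gal :: "'a set \<Rightarrow> bool" where
  "gal W \<longleftrightarrow> conn W \<and> (\<forall>B. blk W B \<longrightarrow> clq B \<or> oddcyc B)"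

lemma nonsep_pair: "adj u v \<Longrightarrow> nonsep {u, v}"
proof -
  assume a: "adj u v"
  then have "conn {u, v}" using conn_insert[OF conn_singleton[of v], of v u] by simp
  moreover have "{u, v} - {u} = {v}" "{u, v} - {v} = {u}" using a adj_irrefl by auto
  ultimately show ?thesis using conn_singleton by (auto simp: nonsep_def)
qed

lemma nonsep_in_side:
  assumes "sep W v A B" "nonsep C" "C \<subseteq> W"
  shows "C \<subseteq> A \<or> C \<subseteq> B"
proof (rule ccontr)
  note s = assms(1)[unfolded sep_def]
  assume "\<not> ?thesis"
  then obtain c1 c2 where c: "c1 \<in> C" "c1 \<notin> A" "c2 \<in> C" "c2 \<notin> B" by blast
  then have c': "c1 \<in> B - {v}" "c2 \<in> A - {v}" using s assms(3) by blast+
  have cC: "conn (C - {v})"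
  proof (cases "v \<in> C")
    case True
    then show ?thesis using nonsep_remove[OF assms(2)] c c' by blast
  next
    case False
    then show ?thesis using nonsep_conn[OF assms(2)] by simp
  qed
  obtain a b where "a \<in> C \<inter> (A - {v})" "b \<in> C - {v} - (C \<inter> (A - {v}))" "adj a b"
    using connE[OF cC, of "C \<inter> (A - {v})"] c c' s by blast
  moreover then have "b \<in> B - {v}" using assms(3) s by blast
  ultimately show False using s by blast
qed

lemma blk_exists:
  assumes "finite W" "C \<subseteq> W" "nonsep C"
  obtains B where "blk W B" "C \<subseteq> B"
proof -
  let ?M = "{B. nonsep B \<and> C \<subseteq> B \<and> B \<subseteq> W}"
  have fin: "finite ?M" using assms(1) by (intro finite_subset[of ?M "Pow W"]) auto
  have "C \<in> ?M" using assms by auto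
  from finite_has_maximal2[OF fin this]
  obtain B where B: "B \<in> ?M" and max: "\<And>B'. B' \<in> ?M \<Longrightarrow> B \<subseteq> B' \<Longrightarrow> B = B'" by auto
  have "blk W B" unfolding blk_def
  proof (intro conjI allI impI)
    fix B' assume "B \<subseteq> B'" "B' \<subseteq> W" "nonsep B'"
    then show "B' = B" using B max[of B'] by blast
  qed (use B in auto)
  then show thesis using that B by blast
qed

text \<open>A larger block of the whole graph would lie in the other side, leaving only the vertex
  \<open>v\<close> for \<open>C\<close>. But \<open>v\<close> has a neighbour in \<open>A\<close>,
  so \<open>C\<close> would not be maximal in \<open>A\<close>.\<close>

lemma blk_side:
  assumes "sep W v A B" "blk A C"
  shows "blk W C"
  unfolding blk_def
proof (intro conjI allI impI)
  note s = assms(1)[unfolded sep_def] and b = assms(2)[unfolded blk_def]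
  show "C \<subseteq> W" "nonsep C" using s b by auto
  fix C' assume C': "C \<subseteq> C'" "C' \<subseteq> W" "nonsep C'"
  show "C' = C"
  proof (cases "C' \<subseteq> A")
    case True
    then show ?thesis using b C' by blast
  next
    case False
    then have "C' \<subseteq> B" using nonsep_in_side[OF assms(1) C'(3,2)] by blast
    moreover have "C \<subseteq> A" "A \<inter> B = {v}" using b s by auto
    ultimately have "C \<subseteq> {v}" using C'(1) by blast
    moreover have "C \<noteq> {}" using b nonsep_conn[of C] conn_nonempty[of C] by blast
    ultimately have C: "C = {v}" by auto
    have "v \<in> A" "A \<noteq> {v}" "conn A" using s by auto
    then have "nb A v \<noteq> {}" using conn_nb_nonempty[of A v] by simp
    then obtain u where u: "u \<in> A" "adj v u" by (auto simp: nb_def)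
    have "C \<subseteq> {v, u}" "{v, u} \<subseteq> A" using C u \<open>v \<in> A\<close> by auto
    then have "{v, u} = C" using b nonsep_pair[OF u(2)] by simp
    then show ?thesis using C u adj_irrefl by auto
  qed
qed

text \<open>One direction splits at a cutvertex, where \<open>AT_glue\<close> sends a good monomial
  to one of the sides. For the other, blocks inherit the lack of a good monomial and are classified
  by \<open>not_AT1_nonsep_imp\<close>.\<close>

lemma gal_iff:
  assumes "finite W"
  shows "gal W \<longleftrightarrow> conn W \<and> \<not> AT1 W"
proof
  assume "gal W"
  then show "conn W \<and> \<not> AT1 W" using assms
  proof (induction "card W" arbitrary: W rule: less_induct)
    case less
    have cW: "conn W" using less.prems by (simp add: gal_def)
    have "\<not> AT1 W"
    proof (cases "nonsep W")
      case True
      then have "blk W W" by (auto simp: blk_def)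
      then have "clq W \<or> oddcyc W" using less.prems by (auto simp: gal_def)
      then show ?thesis using not_AT1_clq not_AT1_oddcyc less.prems conn_nonempty[OF cW] by blast
    next
      case False
      then obtain v where "v \<in> W" "W \<noteq> {v}" "\<not> conn (W - {v})" using cW by (auto simp: nonsep_def)
      then obtain A B where s: "sep W v A B" using sep_exists[OF cW] by blast
      have side: "\<not> AT1 A" if s: "sep W v A B" for A B
      proof -
        note t = s[unfolded sep_def]
        have "gal A" using blk_side[OF s] less.prems(1) t by (auto simp: gal_def)
        moreover have "card A < card W" using t less.prems(2) by (intro psubset_card_mono) auto
        moreover have "finite A" using t less.prems(2) by (metis finite_Un)
        ultimately show ?thesis using less.hyps by blast
      qed
      note t = s[unfolded sep_def]
      have no: "\<not> adj a b" if "a \<in> A - B" "b \<in> B - A" for a b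
      proof -
        have "v \<in> A" "v \<in> B" using t by auto
        then show ?thesis using that t by blast
      qed
      show ?thesis
        using AT_glue[of A B v "\<lambda>_. 1", OF _ no] side[OF s] side[OF sep_sym[OF s]] t by auto
    qed
    then show ?case using cW by blast
  qed
next
  assume W: "conn W \<and> \<not> AT1 W"
  have "clq B \<or> oddcyc B" if "blk W B" for B
  proof -
    have B: "B \<subseteq> W" "nonsep B" using that by (auto simp: blk_def)
    then have "\<not> AT1 B" using AT1_superset[of W B] W assms conn_nonempty nonsep_conn by blast
    then show ?thesis using not_AT1_nonsep_imp B assms finite_subset by blast
  qed
  then show "gal W" using W by (simp add: gal_def)
qed

end

section \<open>Two-connected graphs\<close>

lemma path_edges_Cons: "p \<noteq> [] \<Longrightarrow> path_edges (a # p) = insert (a, hd p) (path_edges p)"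
  by (cases p) (auto simp: path_edges_def)

lemma path_edges_single: "path_edges [a] = {}"
  by (simp add: path_edges_def)

context ograph begin

lemma Z_congD: "Z T \<nu> \<Longrightarrow> (\<And>v. v \<in> T \<Longrightarrow> \<nu> v = \<mu> v) \<Longrightarrow> Z T \<mu>"
  using Z_cong by blast

definition gr :: "'a set \<Rightarrow> 'a pair_pre_digraph" where
  "gr W = \<lparr> pverts = W, parcs = {(a, b). a \<in> W \<and> b \<in> W \<and> adj a b} \<rparr>"

lemma ipath_append: "ipath (xs @ ys) \<Longrightarrow> ipath ys"
  by (induction xs) auto

lemma conn_path:
  assumes "finite S" "conn S" "a \<in> S" "b \<in> S"
  shows "\<exists>p. ipath p \<and> p \<noteq> [] \<and> set p \<subseteq> S \<and> hd p = a \<and> last p = b"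
  using assms
proof (induction "card S" arbitrary: S a rule: less_induct)
  case less
  show ?case
  proof (cases "a = b")
    case True
    then show ?thesis using less.prems by (intro exI[of _ "[a]"]) auto
  next
    case False
    let ?M = "{C. conn C \<and> b \<in> C \<and> C \<subseteq> S - {a}}"
    have fin: "finite ?M" using less.prems(1) by (intro finite_subset[of ?M "Pow S"]) auto
    have "{b} \<in> ?M" using False less.prems conn_singleton by auto
    from finite_has_maximal2[OF fin this]
    obtain C where C: "C \<in> ?M" and max: "\<And>C'. C' \<in> ?M \<Longrightarrow> C \<subseteq> C' \<Longrightarrow> C = C'" by auto
    obtain u v where uv: "u \<in> C" "v \<in> S - C" "adj u v"
      using connE[OF less.prems(2), of C] C less.prems(3) by blast
    have "v = a"
    proof (rule ccontr)
      assume "v \<noteq> a"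
      then have "insert v C \<in> ?M" using C uv conn_insert[of C u v] adj_sym by auto
      then show False using max[of "insert v C"] uv by blast
    qed
    have "card C < card S" using C less.prems by (intro psubset_card_mono) auto
    moreover have "finite C" using C less.prems(1) finite_subset[of C S] by auto
    ultimately obtain p where p: "ipath p" "p \<noteq> []" "set p \<subseteq> C" "hd p = u" "last p = b"
      using less.hyps[of C u] C uv(1) by blast
    have "\<exists>c\<in>set p. adj a c" using p uv \<open>v = a\<close> adj_sym by (metis hd_in_set)
    \<comment> \<open>Entering the path at the last vertex adjacent to \<open>a\<close> keeps the
      extended path induced.\<close>
    then obtain xs c ys where d: "p = xs @ c # ys" "adj a c" "\<forall>y\<in>set ys. \<not> adj a y"
      using split_list_last_prop[of p "adj a"] by blast
    have "ipath (c # ys)" using p d ipath_append by blast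
    moreover have "a \<notin> set (c # ys)" using p C d by auto
    moreover have "nb (set (c # ys)) a = {c}" using d by (auto simp: nb_def)
    ultimately have "ipath (a # c # ys)" by simp
    moreover have "set (a # c # ys) \<subseteq> S" using p C d less.prems by auto
    moreover have "last (a # c # ys) = b" using p d by simp
    ultimately show ?thesis by (intro exI[of _ "a # c # ys"]) simp
  qed
qed

text \<open>Reduce to an induced path joining the two vertices, where the alternating sum has only
  the two end weights.\<close>

lemma Z_two_points:
  assumes "finite S" "conn S" "\<not> AT1 S" "a \<in> S" "b \<in> S" "a \<noteq> b"
    "Z S (\<lambda>v. if v = a then \<alpha> else if v = b then \<beta> else 0)"
  shows "\<alpha> = \<beta> \<or> \<alpha> = - \<beta>"
proof -
  obtain p where p: "ipath p" "p \<noteq> []" "set p \<subseteq> S" "hd p = a" "last p = b"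
    using conn_path[OF assms(1,2,4,5)] by blast
  let ?\<mu> = "\<lambda>v. if v = a then \<alpha> else if v = b then \<beta> else 0"
  have ab: "a \<in> set p" "b \<in> set p" using p hd_in_set last_in_set by blast+
  have "?\<mu> v = 0" if "v \<in> S - set p" for v using that ab by auto
  then have "Z (set p) ?\<mu>"
    using Z_elim[OF assms(1-3) conn_ipath[OF p(1,2)] p(3), of ?\<mu>] assms(7) by blast
  then have alt0: "alt ?\<mu> p = 0" using Z_ipath p by blast
  obtain q where q: "p = a # q" using p by (cases p) auto
  have qne: "q \<noteq> []" using q p assms(6) by auto
  have dp: "a \<notin> set q" "distinct q" using ipath_distinct[OF p(1)] q by auto
  have lq: "last q = b" using p q qne by simp
  have bq: "distinct (butlast q @ [b])" using dp lq qne by (metis append_butlast_last_id)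
  have "alt ?\<mu> q = (-1) ^ (length q - 1) * ?\<mu> (last q)"
  proof (rule alt_last[OF qne])
    fix v assume "v \<in> set (butlast q)"
    then show "?\<mu> v = 0" using bq dp in_set_butlastD[of v q] by auto
  qed
  then have "\<alpha> = (-1) ^ (length q - 1) * \<beta>" using alt0 q lq assms(6) by simp
  then show ?thesis by (cases "even (length q - 1)") auto
qed

section \<open>Triangles with three pendant paths\<close>

definition wt :: "'a \<Rightarrow> int \<Rightarrow> 'a \<Rightarrow> int \<Rightarrow> 'a \<Rightarrow> int \<Rightarrow> 'a \<Rightarrow> int" where
  "wt u1 e1 u2 e2 u3 e3 v = (if v = u1 then e1 else if v = u2 then e2 else if v = u3 then e3 else 0)"

definition tri_edges :: "'a \<Rightarrow> 'a \<Rightarrow> 'a \<Rightarrow> 'a list \<Rightarrow> 'a list \<Rightarrow> 'a list \<Rightarrow> ('a \<times> 'a) set" where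
  "tri_edges z1 z2 z3 p1 p2 p3 = {(z1, z2), (z1, z3), (z2, z3)} \<union> path_edges (p1 @ [z1]) \<union>
     path_edges (p2 @ [z2]) \<union> path_edges (p3 @ [z3])"

text \<open>A triangle with a path hanging at each corner, listed from its tip \<open>u_i\<close>
  inwards; an empty path makes the corner itself the tip. Peeling a path multiplies the weight of
  its tip by a sign per vertex, so the last two equations say that equal weights arrive at the three
  corners.\<close>

definition tri :: "'a set \<Rightarrow> 'a \<Rightarrow> int \<Rightarrow> 'a \<Rightarrow> int \<Rightarrow> 'a \<Rightarrow> int \<Rightarrow> bool" where
  "tri T u1 e1 u2 e2 u3 e3 \<longleftrightarrow> (\<exists>z1 z2 z3 p1 p2 p3.
     distinct ([z1, z2, z3] @ p1 @ p2 @ p3) \<and>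
     T = {z1, z2, z3} \<union> set p1 \<union> set p2 \<union> set p3 \<and>
     (\<forall>a b. a \<in> T \<and> b \<in> T \<and> adj a b \<longleftrightarrow>
        (a, b) \<in> tri_edges z1 z2 z3 p1 p2 p3 \<or> (b, a) \<in> tri_edges z1 z2 z3 p1 p2 p3) \<and>
     u1 = hd (p1 @ [z1]) \<and> u2 = hd (p2 @ [z2]) \<and> u3 = hd (p3 @ [z3]) \<and>
     e1 * (-1) ^ length p1 = e2 * (-1) ^ length p2 \<and> e1 * (-1) ^ length p1 = e3 * (-1) ^ length p3)"

lemma tri_swap12:
  assumes "tri T u1 e1 u2 e2 u3 e3"
  shows "tri T u2 e2 u1 e1 u3 e3"
proof -
  obtain z1 z2 z3 p1 p2 p3 where t: "distinct ([z1, z2, z3] @ p1 @ p2 @ p3)"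
     "T = {z1, z2, z3} \<union> set p1 \<union> set p2 \<union> set p3"
     "\<forall>a b. a \<in> T \<and> b \<in> T \<and> adj a b \<longleftrightarrow>
        (a, b) \<in> tri_edges z1 z2 z3 p1 p2 p3 \<or> (b, a) \<in> tri_edges z1 z2 z3 p1 p2 p3"
     "u1 = hd (p1 @ [z1])" "u2 = hd (p2 @ [z2])" "u3 = hd (p3 @ [z3])"
     "e1 * (-1) ^ length p1 = e2 * (-1) ^ length p2" "e1 * (-1) ^ length p1 = e3 * (-1) ^ length p3"
    using assms unfolding tri_def by blast
  have "((a, b) \<in> tri_edges z1 z2 z3 p1 p2 p3 \<or> (b, a) \<in> tri_edges z1 z2 z3 p1 p2 p3) \<longleftrightarrow>
     ((a, b) \<in> tri_edges z2 z1 z3 p2 p1 p3 \<or> (b, a) \<in> tri_edges z2 z1 z3 p2 p1 p3)" for a b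
    unfolding tri_edges_def by blast
  then have E: "\<forall>a b. a \<in> T \<and> b \<in> T \<and> adj a b \<longleftrightarrow>
        (a, b) \<in> tri_edges z2 z1 z3 p2 p1 p3 \<or> (b, a) \<in> tri_edges z2 z1 z3 p2 p1 p3"
    using t(3) by (simp only: simp_thms)
  show ?thesis unfolding tri_def
  proof (intro exI conjI)
    show "distinct ([z2, z1, z3] @ p2 @ p1 @ p3)" using t(1) by auto
    show "T = {z2, z1, z3} \<union> set p2 \<union> set p1 \<union> set p3" using t(2) by blast
    show "e2 * (-1) ^ length p2 = e3 * (-1) ^ length p3" using t(7,8) by simp
  qed (rule E t(4-6) t(7)[symmetric])+
qed

lemma tri_swap13:
  assumes "tri T u1 e1 u2 e2 u3 e3"
  shows "tri T u3 e3 u2 e2 u1 e1"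
proof -
  obtain z1 z2 z3 p1 p2 p3 where t: "distinct ([z1, z2, z3] @ p1 @ p2 @ p3)"
     "T = {z1, z2, z3} \<union> set p1 \<union> set p2 \<union> set p3"
     "\<forall>a b. a \<in> T \<and> b \<in> T \<and> adj a b \<longleftrightarrow>
        (a, b) \<in> tri_edges z1 z2 z3 p1 p2 p3 \<or> (b, a) \<in> tri_edges z1 z2 z3 p1 p2 p3"
     "u1 = hd (p1 @ [z1])" "u2 = hd (p2 @ [z2])" "u3 = hd (p3 @ [z3])"
     "e1 * (-1) ^ length p1 = e2 * (-1) ^ length p2" "e1 * (-1) ^ length p1 = e3 * (-1) ^ length p3"
    using assms unfolding tri_def by blast
  have "((a, b) \<in> tri_edges z1 z2 z3 p1 p2 p3 \<or> (b, a) \<in> tri_edges z1 z2 z3 p1 p2 p3) \<longleftrightarrow>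
     ((a, b) \<in> tri_edges z3 z2 z1 p3 p2 p1 \<or> (b, a) \<in> tri_edges z3 z2 z1 p3 p2 p1)" for a b
    unfolding tri_edges_def by blast
  then have E: "\<forall>a b. a \<in> T \<and> b \<in> T \<and> adj a b \<longleftrightarrow>
        (a, b) \<in> tri_edges z3 z2 z1 p3 p2 p1 \<or> (b, a) \<in> tri_edges z3 z2 z1 p3 p2 p1"
    using t(3) by (simp only: simp_thms)
  show ?thesis unfolding tri_def
  proof (intro exI conjI)
    show "distinct ([z3, z2, z1] @ p3 @ p2 @ p1)" using t(1) by auto
    show "T = {z3, z2, z1} \<union> set p3 \<union> set p2 \<union> set p1" using t(2) by blast
    show "e3 * (-1) ^ length p3 = e2 * (-1) ^ length p2" using t(7,8) by simp
  qed (rule E t(4-6) t(8)[symmetric])+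
qed

lemma tri_extend:
  assumes "tri S w (- e1) u2 e2 u3 e3" "q \<notin> S" "nb S q = {w}"
  shows "tri (insert q S) q e1 u2 e2 u3 e3"
proof -
  obtain z1 z2 z3 p1 p2 p3 where t: "distinct ([z1, z2, z3] @ p1 @ p2 @ p3)"
     "S = {z1, z2, z3} \<union> set p1 \<union> set p2 \<union> set p3" and
     E: "\<And>a b. a \<in> S \<and> b \<in> S \<and> adj a b \<longleftrightarrow>
        (a, b) \<in> tri_edges z1 z2 z3 p1 p2 p3 \<or> (b, a) \<in> tri_edges z1 z2 z3 p1 p2 p3" and
     h: "w = hd (p1 @ [z1])" "u2 = hd (p2 @ [z2])" "u3 = hd (p3 @ [z3])"
     "- e1 * (-1) ^ length p1 = e2 * (-1) ^ length p2" "- e1 * (-1) ^ length p1 = e3 * (-1) ^ length p3"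
    using assms(1) unfolding tri_def by blast
  have ed: "tri_edges z1 z2 z3 (q # p1) p2 p3 = insert (q, w) (tri_edges z1 z2 z3 p1 p2 p3)"
    unfolding tri_edges_def using path_edges_Cons[of "p1 @ [z1]" q] h(1) by auto
  have nbq: "adj q u \<longleftrightarrow> u = w" "adj u q \<longleftrightarrow> u = w" if "u \<in> S" for u
  proof -
    have "u \<in> nb S q \<longleftrightarrow> u = w" using assms(3) by simp
    then show "adj q u \<longleftrightarrow> u = w" using that by (simp add: nb_def)
    then show "adj u q \<longleftrightarrow> u = w" using adj_sym by blast
  qed
  have wS: "w \<in> S" using assms(3) by (auto simp: nb_def)
  have key: "a \<in> insert q S \<and> b \<in> insert q S \<and> adj a b \<longleftrightarrow>
     (a, b) \<in> insert (q, w) (tri_edges z1 z2 z3 p1 p2 p3) \<or> (b, a) \<in> insert (q, w) (tri_edges z1 z2 z3 p1 p2 p3)" for a b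
  proof (cases "a \<in> S \<and> b \<in> S")
    case True
    then have "a \<noteq> q" "b \<noteq> q" using assms(2) by auto
    then show ?thesis using E[of a b] True by auto
  next
    case False
    then have n: "(a, b) \<notin> tri_edges z1 z2 z3 p1 p2 p3" "(b, a) \<notin> tri_edges z1 z2 z3 p1 p2 p3"
      using E[of a b] E[of b a] by auto
    show ?thesis
    proof (cases "a = q")
      case True
      then show ?thesis using n nbq[of b] wS adj_irrefl[of q] assms(2) by auto
    next
      case False
      then show ?thesis using n nbq[of a] wS \<open>\<not> (a \<in> S \<and> b \<in> S)\<close> assms(2) by auto
    qed
  qed
  show ?thesis unfolding tri_def
    by (rule exI[of _ z1], rule exI[of _ z2], rule exI[of _ z3], rule exI[of _ "q # p1"],
        rule exI[of _ p2], rule exI[of _ p3])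
       (use t key h assms(2) in \<open>auto simp: ed\<close>)
qed

lemma wt_swap12: "u1 \<noteq> u2 \<Longrightarrow> wt u1 e1 u2 e2 u3 e3 = wt u2 e2 u1 e1 u3 e3"
  by (auto simp: wt_def)

lemma wt_swap13: "u1 \<noteq> u3 \<Longrightarrow> u1 \<noteq> u2 \<Longrightarrow> u2 \<noteq> u3 \<Longrightarrow> wt u1 e1 u2 e2 u3 e3 = wt u3 e3 u2 e2 u1 e1"
  by (auto simp: wt_def)

text \<open>
  The signs \<open>e\<^sub>i\<close> make the induction work: deleting a leaf tip \<open>u\<^sub>i\<close> moves the tip to its neighbour and
  negates \<open>e\<^sub>i\<close>.
\<close>

definition tri_hyp :: "'a set \<Rightarrow> 'a \<Rightarrow> int \<Rightarrow> 'a \<Rightarrow> int \<Rightarrow> 'a \<Rightarrow> int \<Rightarrow> bool" where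
  "tri_hyp T u1 e1 u2 e2 u3 e3 \<longleftrightarrow> finite T \<and> conn T \<and> \<not> AT1 T \<and>
     u1 \<noteq> u2 \<and> u1 \<noteq> u3 \<and> u2 \<noteq> u3 \<and> {u1, u2, u3} \<subseteq> T \<and>
     e1 \<in> {1, -1} \<and> e2 \<in> {1, -1} \<and> e3 \<in> {1, -1} \<and> Z T (wt u1 e1 u2 e2 u3 e3) \<and>
     (\<forall>w L T0. sep T w L T0 \<longrightarrow> (L - {w}) \<inter> {u1, u2, u3} \<noteq> {})"

lemma tri_hyp_swap12: "tri_hyp T u1 e1 u2 e2 u3 e3 \<Longrightarrow> tri_hyp T u2 e2 u1 e1 u3 e3"
  unfolding tri_hyp_def using wt_swap12[of u1 u2 e1 e2 u3 e3] by (auto simp: insert_commute)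

lemma tri_hyp_swap13: "tri_hyp T u1 e1 u2 e2 u3 e3 \<Longrightarrow> tri_hyp T u3 e3 u2 e2 u1 e1"
  unfolding tri_hyp_def using wt_swap13[of u1 u3 u2 e1 e2 e3] by (auto simp: insert_commute)

text \<open>Peeling the leaf tip by \<open>Z_leaf\<close> moves its negated weight to
  \<open>w\<close>. It remains to see that \<open>w\<close> is not one of the other tips and that
  every leaf side still contains a tip.\<close>

lemma tri_hyp_step:
  assumes h: "tri_hyp T u1 e1 u2 e2 u3 e3" and nb: "nb T u1 = {w}"
  shows "tri_hyp (T - {u1}) w (- e1) u2 e2 u3 e3"
proof -
  note H = h[unfolded tri_hyp_def]
  define S where "S = T - {u1}"
  have T: "T = insert u1 S" "u1 \<notin> S" "finite S" using H by (auto simp: S_def)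
  have wS: "w \<in> S" "adj u1 w" using nb adj_irrefl by (auto simp: nb_def S_def)
  have nbS: "nb S u1 = {w}" using nb wS adj_irrefl by (auto simp: nb_def S_def)
  have "T \<noteq> {u1}" using H by auto
  then have cS: "conn S" using conn_remove_leaf[of T u1 w] H nb by (simp add: S_def)
  have nS: "\<not> AT1 S" using AT1_superset[of T S] H T conn_nonempty[OF cS] by auto
  have ZS: "Z S ((wt u1 e1 u2 e2 u3 e3)(w := wt u1 e1 u2 e2 u3 e3 w - e1))"
    using Z_leaf[OF T(3,2) nbS nS] H T by (simp add: wt_def)
  have e: "e1 = 1 \<or> e1 = -1" "e2 = 1 \<or> e2 = -1" "e3 = 1 \<or> e3 = -1" using H by auto
  have w2: "w \<noteq> u2"
  proof
    assume w: "w = u2"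
    have "Z S (\<lambda>v. if v = u2 then e2 - e1 else if v = u3 then e3 else 0)"
    proof (rule Z_congD[OF ZS])
      fix v assume "v \<in> S"
      then have "v \<noteq> u1" using T(2) by auto
      then show "((wt u1 e1 u2 e2 u3 e3)(w := wt u1 e1 u2 e2 u3 e3 w - e1)) v
        = (if v = u2 then e2 - e1 else if v = u3 then e3 else 0)" using H w by (simp add: wt_def)
    qed
    \<comment> \<open>Colliding tips leave weights e2 - e1, which is even, and e3, which is odd; by
      \<open>Z_two_points\<close> they would agree up to sign.\<close>
    then have "e2 - e1 = e3 \<or> e2 - e1 = - e3" using Z_two_points[OF T(3) cS nS, of u2 u3] H T by auto
    then show False using e by auto
  qed
  have w3: "w \<noteq> u3"
  proof
    assume w: "w = u3"
    have "Z S (\<lambda>v. if v = u3 then e3 - e1 else if v = u2 then e2 else 0)"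
    proof (rule Z_congD[OF ZS])
      fix v assume "v \<in> S"
      then have "v \<noteq> u1" using T(2) by auto
      moreover have "u3 \<noteq> u1" "u3 \<noteq> u2" using H by auto
      ultimately show "((wt u1 e1 u2 e2 u3 e3)(w := wt u1 e1 u2 e2 u3 e3 w - e1)) v
        = (if v = u3 then e3 - e1 else if v = u2 then e2 else 0)" using w by (simp add: wt_def)
    qed
    then have "e3 - e1 = e2 \<or> e3 - e1 = - e2" using Z_two_points[OF T(3) cS nS, of u3 u2] H T by auto
    then show False using e by auto
  qed
  have "w \<noteq> u1" using wS T by auto
  have "Z S (wt w (- e1) u2 e2 u3 e3)"
  proof (rule Z_congD[OF ZS])
    fix v assume "v \<in> S"
    then have "v \<noteq> u1" using T(2) by auto
    then show "((wt u1 e1 u2 e2 u3 e3)(w := wt u1 e1 u2 e2 u3 e3 w - e1)) v = wt w (- e1) u2 e2 u3 e3 v"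
      using w2 w3 \<open>w \<noteq> u1\<close> by (simp add: wt_def)
  qed
  moreover have "(L - {c}) \<inter> {w, u2, u3} \<noteq> {}" if s: "sep S c L T0" for c L T0
  proof
    assume empty: "(L - {c}) \<inter> {w, u2, u3} = {}"
    note t = s[unfolded sep_def]
    have wT0: "w \<in> T0" using empty t wS by blast
    have uL: "u1 \<notin> L" "u1 \<notin> T0" using t T(2) by auto
    \<comment> \<open>A side without any new tip would also be a side of a separation of
      \<open>T\<close>: \<open>w\<close> lies on the opposite side, so the old tip can be put back
      there. This contradicts the hypothesis on \<open>T\<close>.\<close>
    have "sep T c L (insert u1 T0)"
      unfolding sep_def
    proof (intro conjI ballI)
      show "L \<union> insert u1 T0 = T" using t T by auto
      show "L \<inter> insert u1 T0 = {c}" using t uL by auto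
      show "conn (insert u1 T0)" using conn_insert[of T0 w u1] t wT0 wS by blast
      show "insert u1 T0 \<noteq> {c}" using t uL by auto
      fix a b assume ab: "a \<in> L - {c}" "b \<in> insert u1 T0 - {c}"
      show "\<not> adj a b"
      proof (cases "b = u1")
        case True
        have "a \<in> S" "a \<noteq> w" using ab t empty by auto
        then have "a \<notin> nb S u1" using nbS by simp
        then show ?thesis using True \<open>a \<in> S\<close> adj_sym by (auto simp: nb_def)
      next
        case False
        then show ?thesis using ab t by blast
      qed
    qed (use t in auto)
    then have "(L - {c}) \<inter> {u1, u2, u3} \<noteq> {}" using H by blast
    then show False using empty uL by blast
  qed
  moreover have "{w, u2, u3} \<subseteq> S" using wS H T by auto
  moreover have "- e1 \<in> {1, -1}" using e by auto
  ultimately show ?thesis using cS nS T(3) H w2 w3 unfolding tri_hyp_def S_def[symmetric] by blast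
qed

text \<open>A single block has constant weights off any vertex, so it consists of the three tips,
  and minimum degree 2 makes it a triangle. Otherwise, off its cutvertex, each of two leaf blocks
  consists of tips only, at least two by the degree bound; this would need four tips.\<close>

lemma tri_hyp_min_deg_2:
  assumes h: "tri_hyp T u1 e1 u2 e2 u3 e3" and deg: "\<And>q. q \<in> T \<Longrightarrow> 2 \<le> card (nb T q)"
  shows "tri T u1 e1 u2 e2 u3 e3"
proof -
  note H = h[unfolded tri_hyp_def]
  let ?\<nu> = "wt u1 e1 u2 e2 u3 e3"
  have nA: "\<not> AT1 L" if "L \<subseteq> T" "nonsep L" for L
    using AT1_superset[of T L] H that conn_nonempty[OF nonsep_conn] by blast
  have rub: "clq L \<or> oddcyc L" if "L \<subseteq> T" "nonsep L" for L
    using not_AT1_nonsep_imp[of L] nA[OF that] that H finite_subset by blast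
  have nz: "?\<nu> v \<noteq> 0 \<longleftrightarrow> v \<in> {u1, u2, u3}" for v using H by (auto simp: wt_def)
  show ?thesis
  proof (cases "nonsep T")
    case True
    have const: "?\<nu> a = ?\<nu> b" if "w \<in> T" "a \<in> T - {w}" "b \<in> T - {w}" for w a b
      using leaf_const[OF _ _ _ leaf_whole[OF that(1)] rub[OF subset_refl True] _ that(2,3)] H by blast
    have T: "T = {u1, u2, u3}"
    proof (rule ccontr)
      assume "T \<noteq> {u1, u2, u3}"
      then obtain t where t: "t \<in> T" "t \<notin> {u1, u2, u3}" using H by blast
      have "?\<nu> u1 = ?\<nu> t" using const[of u2 u1 t] t H by auto
      then show False using nz[of u1] nz[of t] t by auto
    qed
    have "?\<nu> u1 = ?\<nu> u2" using const[of u3 u1 u2] H by auto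
    then have e12: "e1 = e2" using H by (auto simp: wt_def)
    have "?\<nu> u1 = ?\<nu> u3" using const[of u2 u1 u3] H by auto
    then have e13: "e1 = e3" using H by (auto simp: wt_def)
    have adj: "adj a b" if ab: "a \<in> T" "b \<in> T" "a \<noteq> b" for a b
    proof (rule ccontr)
      assume n: "\<not> adj a b"
      have "nb T a \<subseteq> T - {a, b}" using n adj_irrefl by (auto simp: nb_def)
      then have "card (nb T a) \<le> card (T - {a, b})" using H by (intro card_mono) auto
      also have "card T = 3" unfolding T using H by auto
      then have "card (T - {a, b}) = 1" using ab H by (simp add: card_Diff_subset)
      finally show False using deg[OF ab(1)] by simp
    qed
    have key: "a \<in> T \<and> b \<in> T \<and> adj a b \<longleftrightarrow>
        (a, b) \<in> tri_edges u1 u2 u3 [] [] [] \<or> (b, a) \<in> tri_edges u1 u2 u3 [] [] []" for a b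
    proof -
      have "(a, b) \<in> tri_edges u1 u2 u3 [] [] [] \<or> (b, a) \<in> tri_edges u1 u2 u3 [] [] []
         \<longleftrightarrow> a \<in> {u1, u2, u3} \<and> b \<in> {u1, u2, u3} \<and> a \<noteq> b"
        using H by (auto simp: tri_edges_def path_edges_single)
      then show ?thesis using adj adj_irrefl unfolding T by blast
    qed
    show ?thesis unfolding tri_def
      by (rule exI[of _ u1], rule exI[of _ u2], rule exI[of _ u3], rule exI[of _ "[]"],
          rule exI[of _ "[]"], rule exI[of _ "[]"])
         (use key T e12 e13 H in auto)
  next
    case False
    obtain v A B w L T0 w' L' T0' where s: "sep T v A B" and
      l: "sep T w L T0" "nonsep L" "L - {w} \<subseteq> A - {v}" and
      l': "sep T w' L' T0'" "nonsep L'" "L' - {w'} \<subseteq> B - {v}"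
      using two_leaves[OF conjunct1[OF H] conjunct1[OF conjunct2[OF H]] False] .
    have big: "L - {w} \<subseteq> {u1, u2, u3} \<and> 2 \<le> card (L - {w})" if l: "sep T w L T0" "nonsep L" for w L T0
    proof
      note t = l(1)[unfolded sep_def]
      have LT: "L \<subseteq> T" using t by auto
      have fL: "finite L" using LT H finite_subset by blast
      obtain a where a: "a \<in> L - {w}" "a \<in> {u1, u2, u3}" using H l(1) by blast
      show "L - {w} \<subseteq> {u1, u2, u3}"
      proof
        fix b assume "b \<in> L - {w}"
        then have "?\<nu> a = ?\<nu> b" using leaf_const[OF _ _ _ leaf_sep[OF l(1)] rub[OF LT l(2)], of ?\<nu> a b] a H by blast
        then show "b \<in> {u1, u2, u3}" using nz[of a] nz[of b] a by auto
      qed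
      have "nb T a \<subseteq> insert w (L - {w} - {a})"
      proof
        fix y assume y: "y \<in> nb T a"
        then have "y \<in> T" "adj a y" by (auto simp: nb_def)
        then have "y \<notin> T0 - {w}" "y \<noteq> a" using t a adj_irrefl by blast+
        then show "y \<in> insert w (L - {w} - {a})" using \<open>y \<in> T\<close> t by blast
      qed
      then have "card (nb T a) \<le> card (insert w (L - {w} - {a}))" using fL by (intro card_mono) auto
      also have "\<dots> \<le> Suc (card (L - {w} - {a}))" by (rule card_insert_le_m1) auto
      also have "\<dots> = card (L - {w})" using a fL by (intro card_Suc_Diff1) auto
      finally show "2 \<le> card (L - {w})" using deg[of a] a LT by auto
    qed
    have "A \<inter> B = {v}" using s by (auto simp: sep_def)
    then have "(L - {w}) \<inter> (L' - {w'}) = {}" using l(3) l'(3) by blast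
    moreover have "L - {w} \<union> (L' - {w'}) \<subseteq> {u1, u2, u3}" using big[OF l(1,2)] big[OF l'(1,2)] by blast
    moreover have "finite (L - {w})" "finite (L' - {w'})"
      using big[OF l(1,2)] big[OF l'(1,2)] finite_subset[of _ "{u1, u2, u3}"] by blast+
    ultimately have "card (L - {w}) + card (L' - {w'}) \<le> card {u1, u2, u3}"
      by (metis card_Un_disjoint card_mono finite.emptyI finite.insertI)
    moreover have "card {u1, u2, u3} \<le> 3" by (simp add: card_insert_if)
    ultimately show ?thesis using big[OF l(1,2)] big[OF l'(1,2)] by linarith
  qed
qed

lemma tri_exists: "tri_hyp T u1 e1 u2 e2 u3 e3 \<Longrightarrow> tri T u1 e1 u2 e2 u3 e3"
proof (induction "card T" arbitrary: T u1 e1 u2 e2 u3 e3 rule: less_induct)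
  case less
  note H = less.prems[unfolded tri_hyp_def]
  have step: "tri T a1 c1 a2 c2 a3 c3"
    if h: "tri_hyp T a1 c1 a2 c2 a3 c3" and nb: "nb T a1 = {w}" for a1 c1 a2 c2 a3 c3 w
  proof -
    have aT: "a1 \<in> T" "finite T" using h by (auto simp: tri_hyp_def)
    have "card (T - {a1}) < card T" using aT by (intro card_Diff1_less)
    then have "tri (T - {a1}) w (- c1) a2 c2 a3 c3" using less.hyps tri_hyp_step[OF h nb] by blast
    moreover have "nb (T - {a1}) a1 = {w}" using nb adj_irrefl by (auto simp: nb_def)
    ultimately have "tri (insert a1 (T - {a1})) a1 c1 a2 c2 a3 c3" by (intro tri_extend) auto
    then show ?thesis using aT by (simp add: insert_absorb)
  qed
  show ?case
  proof (cases "\<exists>q\<in>T. card (nb T q) < 2")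
    case False
    then show ?thesis using tri_hyp_min_deg_2[OF less.prems] by (meson not_less)
  next
    case True
    then obtain q where q: "q \<in> T" "card (nb T q) < 2" by blast
    have Tq: "T \<noteq> {q}" using H by auto
    have "nb T q \<noteq> {}" using conn_nb_nonempty H q Tq by blast
    then have "card (nb T q) = 1" using q finite_nb[of T q] by (simp add: less_Suc_eq numeral_2_eq_2)
    then obtain w where w: "nb T q = {w}" by (auto simp: card_1_singleton_iff)
    have wT: "w \<in> T" "w \<noteq> q" "adj q w" using w adj_irrefl by (auto simp: nb_def)
    \<comment> \<open>A vertex of degree 1 is a leaf side by itself, so it must be a tip, and the
      tip can be peeled.\<close>
    have "sep T w {q, w} (T - {q})"
      unfolding sep_def
    proof (intro conjI ballI)
      show "conn {q, w}" using nonsep_conn[OF nonsep_pair[OF wT(3)]] .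
      show "conn (T - {q})" using conn_remove_leaf H q Tq w by blast
      show "T - {q} \<noteq> {w}"
      proof
        assume "T - {q} = {w}"
        then have "{u1, u2, u3} \<subseteq> {q, w}" using H by blast
        then show False using H by auto
      qed
      fix a b assume ab: "a \<in> {q, w} - {w}" "b \<in> T - {q} - {w}"
      then have "b \<notin> nb T q" using w by simp
      then show "\<not> adj a b" using ab by (auto simp: nb_def)
    qed (use wT q in auto)
    then have "q \<in> {u1, u2, u3}" using H by blast
    then consider "q = u1" | "q = u2" | "q = u3" by blast
    then show ?thesis
    proof cases
      case 1
      then show ?thesis using step less.prems w by blast
    next
      case 2
      then have "tri T u2 e2 u1 e1 u3 e3" using step[OF tri_hyp_swap12[OF less.prems]] w by blast
      then show ?thesis by (rule tri_swap12)
    next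
      case 3
      then have "tri T u3 e3 u2 e2 u1 e1" using step[OF tri_hyp_swap13[OF less.prems]] w by blast
      then show ?thesis by (rule tri_swap13)
    qed
  qed
qed

text \<open>With all weights 1 the three lists have lengths of equal parity. The edge from x to the
  tip makes the path one longer than its list, so even lists give paths of odd length.\<close>

lemma K4_of_tri:
  assumes "tri T u1 1 u2 1 u3 1" "x \<notin> T" "nb T x = {u1, u2, u3}"
  shows "(gr (insert x T), h_vert x) \<in> \<D>"
proof -
  obtain z1 z2 z3 p1 p2 p3 where t: "distinct ([z1, z2, z3] @ p1 @ p2 @ p3)"
     "T = {z1, z2, z3} \<union> set p1 \<union> set p2 \<union> set p3" and
     E: "\<And>a b. a \<in> T \<and> b \<in> T \<and> adj a b \<longleftrightarrow>
        (a, b) \<in> tri_edges z1 z2 z3 p1 p2 p3 \<or> (b, a) \<in> tri_edges z1 z2 z3 p1 p2 p3" and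
     h: "u1 = hd (p1 @ [z1])" "u2 = hd (p2 @ [z2])" "u3 = hd (p3 @ [z3])" and
     par: "(1::int) * (-1) ^ length p1 = 1 * (-1) ^ length p2" "(1::int) * (-1) ^ length p1 = 1 * (-1) ^ length p3"
    using assms(1) unfolding tri_def by blast
  let ?F = "{(x, u1), (x, u2), (x, u3)} \<union> tri_edges z1 z2 z3 p1 p2 p3"
  have F: "{(z1, z2), (z1, z3), (z2, z3)} \<union> path_edges (x # p1 @ [z1]) \<union>
        path_edges (x # p2 @ [z2]) \<union> path_edges (x # p3 @ [z3]) = ?F"
    unfolding tri_edges_def h using path_edges_Cons[of "p1 @ [z1]" x] path_edges_Cons[of "p2 @ [z2]" x]
      path_edges_Cons[of "p3 @ [z3]" x] by auto
  have nbx: "adj x u \<longleftrightarrow> u \<in> {u1, u2, u3}" "adj u x \<longleftrightarrow> u \<in> {u1, u2, u3}" if "u \<in> T" for u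
  proof -
    have "u \<in> nb T x \<longleftrightarrow> u \<in> {u1, u2, u3}" using assms(3) by simp
    then show "adj x u \<longleftrightarrow> u \<in> {u1, u2, u3}" using that by (simp add: nb_def)
    then show "adj u x \<longleftrightarrow> u \<in> {u1, u2, u3}" using adj_sym by blast
  qed
  have uT: "{u1, u2, u3} \<subseteq> T" using assms(3) by (auto simp: nb_def)
  have key: "a \<in> insert x T \<and> b \<in> insert x T \<and> adj a b \<longleftrightarrow> (a, b) \<in> ?F \<or> (b, a) \<in> ?F" for a b
  proof (cases "a \<in> T \<and> b \<in> T")
    case True
    then have "a \<noteq> x" "b \<noteq> x" using assms(2) by auto
    then show ?thesis using E[of a b] True by auto
  next
    case False
    then have n: "(a, b) \<notin> tri_edges z1 z2 z3 p1 p2 p3" "(b, a) \<notin> tri_edges z1 z2 z3 p1 p2 p3"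
      using E[of a b] E[of b a] by auto
    show ?thesis
    proof (cases "a = x")
      case True
      then show ?thesis using n nbx[of b] uT adj_irrefl[of x] assms(2) by auto
    next
      case False
      then show ?thesis using n nbx[of a] uT \<open>\<not> (a \<in> T \<and> b \<in> T)\<close> assms(2) by auto
    qed
  qed
  have "parcs (gr (insert x T)) = ?F \<union> ?F\<inverse>"
    using key by (auto simp: gr_def)
  then have G: "gr (insert x T) = K4_paths x z1 z2 z3 p1 p2 p3"
    unfolding K4_paths_def graph_of_def F using t(2) by (simp add: gr_def insert_commute)
  have d: "distinct ([x, z1, z2, z3] @ p1 @ p2 @ p3)" using t assms(2) by auto
  have e: "even (length p1) \<longleftrightarrow> even (length p2)" "even (length p1) \<longleftrightarrow> even (length p3)"
    using par by (auto simp: minus_one_power_iff split: if_splits)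
  show ?thesis
  proof (cases "even (length p1)")
    case True
    then show ?thesis unfolding G using e d by (intro \<D>.odd_paths) auto
  next
    case False
    then have "p1 \<noteq> []" "p2 \<noteq> []" "p3 \<noteq> []" using e by auto
    then show ?thesis unfolding G using e d False
      by (intro \<D>.even_paths) (auto simp: Suc_le_eq)
  qed
qed

section \<open>The Moser spindle\<close>

lemma conn_cut_side:
  assumes "sep T c L R" "conn S" "S \<subseteq> T" "c \<in> S"
  shows "conn (S \<inter> R)"
proof (rule connI[of c])
  note s = assms(1)[unfolded sep_def]
  show "c \<in> S \<inter> R" using assms s by auto
  fix Q assume Q: "Q \<subseteq> S \<inter> R" "Q \<noteq> {}" "c \<notin> Q"
  obtain u v where uv: "u \<in> Q" "v \<in> S - Q" "adj u v" using connE[OF assms(2), of Q] Q assms(4) by blast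
  have "v \<in> R"
  proof (rule ccontr)
    assume "v \<notin> R"
    then have "v \<in> L - {c}" using uv assms(3) s by blast
    moreover have "u \<in> R - {c}" using uv Q by blast
    ultimately show False using s uv adj_sym by blast
  qed
  then show "\<exists>u\<in>Q. \<exists>v\<in>S \<inter> R - Q. adj u v" using uv by blast
qed

lemma moser_gr:
  assumes d: "distinct [x, a, b, c, a', b', c']"
    and pos: "adj a b" "adj b c" "adj a c" "adj a' b'" "adj b' c'" "adj a' c'" "adj a a'"
      "adj x b" "adj x c" "adj x b'" "adj x c'"
    and neg: "\<not> adj x a" "\<not> adj x a'" "\<not> adj a b'" "\<not> adj a c'" "\<not> adj b a'" "\<not> adj b b'" "\<not> adj b c'"
      "\<not> adj c a'" "\<not> adj c b'" "\<not> adj c c'"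
  shows "(gr {x, a, b, c, a', b', c'}, h_vert x) \<in> \<D>"
proof -
  define W where "W = {x, a, b, c, a', b', c'}"
  define E where "E = {(a, b), (b, c), (a, c), (a', b'), (b', c'), (a', c'), (a, a'),
        (x, b), (x, c), (x, b'), (x, c')}"
  have E_sub: "u \<in> W \<and> v \<in> W \<and> adj u v" if "(u, v) \<in> E" for u v
    using that pos unfolding E_def W_def by auto
  have sup: "(u, v) \<in> E \<or> (v, u) \<in> E" if "u \<in> W" "v \<in> W" "adj u v" for u v
  proof -
    have half: "(p, q) \<in> E \<or> (q, p) \<in> E"
      if pq: "adj p q" and p: "p \<in> {x, a, b, c}" and q: "q \<in> W" for p q
    proof -
      have nx: "q = b \<or> q = c \<or> q = b' \<or> q = c'" if "p = x"
        using pq q neg(1,2) adj_irrefl[of x] that unfolding W_def by blast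
      have na: "q = x \<and> adj a x \<or> q = b \<or> q = c \<or> q = a'" if "p = a"
        using pq q neg(3,4) adj_irrefl[of a] that unfolding W_def by blast
      have nb: "q = x \<or> q = a \<or> q = c" if "p = b"
        using pq q neg(5,6,7) adj_irrefl[of b] that unfolding W_def by blast
      have nc: "q = x \<or> q = a \<or> q = b" if "p = c"
        using pq q neg(8,9,10) adj_irrefl[of c] that unfolding W_def by blast
      have "\<not> adj a x" using neg(1) adj_sym by blast
      then have na': "q = b \<or> q = c \<or> q = a'" if "p = a" using na that by blast
      consider "p = x" | "p = a" | "p = b" | "p = c" using p by blast
      then show ?thesis
      proof cases
        case 1
        then show ?thesis using nx unfolding E_def by auto
      next
        case 2
        then show ?thesis using na' unfolding E_def by auto
      next
        case 3
        then show ?thesis using nb unfolding E_def by auto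
      next
        case 4
        then show ?thesis using nc unfolding E_def by auto
      qed
    qed
    have half': "(p, q) \<in> E \<or> (q, p) \<in> E"
      if pq: "adj p q" and p: "p \<in> {a', b', c'}" and q: "q \<in> {a', b', c'}" for p q
    proof -
      have "p \<noteq> q" using pq adj_irrefl by auto
      then have "(p, q) \<in> {(a', b'), (b', c'), (a', c')} \<or> (q, p) \<in> {(a', b'), (b', c'), (a', c')}"
        using p q by auto
      moreover have "{(a', b'), (b', c'), (a', c')} \<subseteq> E" unfolding E_def by simp
      ultimately show ?thesis by blast
    qed
    show ?thesis
    proof (cases "u \<in> {x, a, b, c}")
      case True
      then show ?thesis using half[OF that(3) True that(2)] by blast
    next
      case False
      then have u: "u \<in> {a', b', c'}" using that(1) unfolding W_def by blast
      show ?thesis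
      proof (cases "v \<in> {x, a, b, c}")
        case True
        then show ?thesis using half[OF adj_sym[OF that(3)] True that(1)] by blast
      next
        case False
        then have "v \<in> {a', b', c'}" using that(2) unfolding W_def by blast
        then show ?thesis using half'[OF that(3) u] by blast
      qed
    qed
  qed
  have "{(u, v). u \<in> W \<and> v \<in> W \<and> adj u v} = E \<union> E\<inverse>"
  proof (rule subset_antisym; rule subrelI)
    fix u v assume "(u, v) \<in> {(u, v). u \<in> W \<and> v \<in> W \<and> adj u v}"
    then show "(u, v) \<in> E \<union> E\<inverse>" using sup by blast
  next
    fix u v assume "(u, v) \<in> E \<union> E\<inverse>"
    then have "(u, v) \<in> E \<or> (v, u) \<in> E" by auto
    then show "(u, v) \<in> {(u, v). u \<in> W \<and> v \<in> W \<and> adj u v}"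
      using E_sub[of u v] E_sub[of v u] adj_sym[of v u] by auto
  qed
  then have "gr W = moser_spindle x a b c a' b' c'"
    unfolding gr_def moser_spindle_def graph_of_def E_def W_def by simp
  then show ?thesis using \<D>.moser[OF d] unfolding W_def by simp
qed

text \<open>With two neighbours of \<open>x\<close> in the clique, one of them can serve as
  cutvertex; the weights at the other and at the non-neighbour \<open>w\<close> differ, so the form
  does not vanish. For a triangle this is K4 minus an edge.\<close>

lemma AT_diamond:
  assumes "finite L" "conn L" "clq L" "\<not> AT1 L" "x \<notin> L" "w \<in> L" "w \<notin> nb L x" "2 \<le> card (nb L x)"
  shows "AT1 (insert x L)"
proof -
  have "\<not> Z L (ind (nb L x))"
  proof
    assume Z: "Z L (ind (nb L x))"
    obtain b c where bc: "b \<in> nb L x" "c \<in> nb L x" "b \<noteq> c"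
      using assms(8) by (metis card_le_Suc0_iff_eq finite_nb not_less_eq_eq numeral_2_eq_2)
    then have "ind (nb L x) c = ind (nb L x) w"
      using leaf_const[OF assms(1,2,4) leaf_whole[of b L] disjI1[OF assms(3)] Z, of c w] assms
      by (auto simp: nb_def)
    then show False using bc assms(7) by (auto simp: ind_def)
  qed
  then have "AT (demand x 1) (insert x L)" using assms by (intro AT_of_not_Z) auto
  then show ?thesis unfolding demand_1 .
qed

text \<open>Two leaf blocks bound the neighbours of x by four, so there are exactly two in each and
  both leaf blocks are triangles. What remains is to show that the part \<open>M\<close> between
  them is the single edge from \<open>w\<close> to \<open>w'\<close>.\<close>

lemma moser_case:
  assumes fT: "finite T" and xT: "x \<notin> T" and ns: "nonsep (insert x T)" and cT: "conn T"
    and nT: "\<not> AT1 T" and nsT: "\<not> nonsep T" and nAT: "\<not> AT (demand x 2) (insert x T)"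
    and k: "4 \<le> card (nb T x)"
  shows "(gr (insert x T), h_vert x) \<in> \<D>"
proof -
  let ?N = "nb T x"
  have her: "hered 2 ?N T" using hered_of_not_AT[OF fT xT nonsep_conn[OF ns] nAT] .
  have rub: "clq L \<or> oddcyc L" if "nonsep L" "L \<subseteq> T" "\<not> AT1 L" for L
    using not_AT1_nonsep_imp[of L] that fT finite_subset by blast
  have k2: "2 < card ?N" using k by simp
  obtain v A B w L T0 w' L' T0' where "sep T v A B" and
    l: "sep T w L T0" and "L - {w} \<subseteq> A - {v}" and l': "sep T w' L' T0'" and "L' - {w'} \<subseteq> B - {v}" and
    c: "clq L" and c': "clq L'" and LN: "L - {w} \<subseteq> ?N" and LN': "L' - {w'} \<subseteq> ?N" and
    N0: "card (?N \<inter> T0) \<le> 2" and N0': "card (?N \<inter> T0') \<le> 2" and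
    LT: "L' - {w'} \<subseteq> T0" and LT': "L - {w} \<subseteq> T0'"
    using leaves_info[OF fT xT ns cT nT nsT her order_refl k2 rub] .
  note s = l[unfolded sep_def] and s' = l'[unfolded sep_def]
  have fN: "finite ?N" using finite_nb .
  have NT: "?N \<subseteq> T" by (auto simp: nb_def)
  have fL: "finite (L - {w})" "finite (L' - {w'})" using LN LN' fN finite_subset by blast+
  have "?N \<subseteq> (L - {w}) \<union> (?N \<inter> T0)" using NT s by blast
  then have "card ?N \<le> card (L - {w}) + card (?N \<inter> T0)"
    by (metis (no_types, lifting) card_Un_le card_mono dual_order.trans fL(1) fN finite_Int finite_UnI)
  moreover have "card (L - {w}) \<le> card (?N \<inter> T0')" using LN LT' fN by (intro card_mono) auto
  \<comment> \<open>At least four neighbours, covered by two sets with at most two each: every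
    inequality is tight.\<close>
  ultimately have cL: "card (L - {w}) = 2" and cN0: "card (?N \<inter> T0) = 2" using k N0 N0' by linarith+
  have "?N \<subseteq> (L' - {w'}) \<union> (?N \<inter> T0')" using NT s' by blast
  then have "card ?N \<le> card (L' - {w'}) + card (?N \<inter> T0')"
    by (metis (no_types, lifting) card_Un_le card_mono dual_order.trans fL(2) fN finite_Int finite_UnI)
  moreover have "card (L' - {w'}) \<le> card (?N \<inter> T0)" using LN' LT fN by (intro card_mono) auto
  ultimately have cL': "card (L' - {w'}) = 2" using k N0 N0' by linarith
  have N0_eq: "L' - {w'} = ?N \<inter> T0"
    using LN' LT fN cL' cN0 by (intro card_subset_eq) auto
  have N_eq: "?N = (L - {w}) \<union> (L' - {w'})" using N0_eq NT s LN LN' by blast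
  obtain b e where be: "L - {w} = {b, e}" "b \<noteq> e" using cL by (auto simp: card_2_iff)
  obtain b' e' where be': "L' - {w'} = {b', e'}" "b' \<noteq> e'" using cL' by (auto simp: card_2_iff)
  have ww: "w \<in> L" "w \<in> T0" "w' \<in> L'" "w' \<in> T0'" using s s' by auto
  have L: "L = {w, b, e}" and L': "L' = {w', b', e'}" using be be' ww by auto
  have wL': "w \<notin> L' - {w'}"
  proof
    assume a: "w \<in> L' - {w'}"
    obtain y where y: "y \<in> L - {w}" "y \<noteq> w'" using be by blast
    then have "y \<in> T0' - {w'}" using LT' by blast
    moreover have "adj w y" using c y ww by (auto simp: clq_def)
    ultimately show False using s' a by blast
  qed
  have wL: "w' \<notin> L - {w}"
  proof
    assume a: "w' \<in> L - {w}"
    obtain y where y: "y \<in> L' - {w'}" "y \<noteq> w" using be' by blast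
    then have "y \<in> T0 - {w}" using LT by blast
    moreover have "adj w' y" using c' y ww by (auto simp: clq_def)
    ultimately show False using s a by blast
  qed
  have wT: "w \<in> T" "w' \<in> T" using s s' by auto
  have w'T0: "w' \<in> T0" and wT0': "w \<in> T0'" using wL wL' wT s s' by blast+
  have wN: "w \<notin> ?N" "w' \<notin> ?N" unfolding N_eq using wL wL' by blast+
  \<comment> \<open>The middle part. Removing both triangles turns the indicator form into one with
    weight -1 at \<open>w\<close> and at \<open>w'\<close> and 0 elsewhere on \<open>M\<close>; if
    \<open>w\<close> and \<open>w'\<close> coincided, it would be -2 at one vertex, which
    \<open>Z_point\<close> excludes.\<close>
  define M where "M = T0 \<inter> T0'"
  have cM: "conn M" unfolding M_def using conn_cut_side[OF l', of T0] s w'T0 by blast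
  have wM: "w \<in> M" "w' \<in> M" using ww w'T0 wT0' by (auto simp: M_def)
  have TM: "T = M \<union> L \<union> L'" using s s' by (auto simp: M_def)
  have disjLL': "(L - {w}) \<inter> (L' - {w'}) = {}" using LT s by blast
  have Mcap: "M \<inter> L = {w}" "M \<inter> L' = {w'}" using s s' wM by (auto simp: M_def)
  have fM: "finite M" "finite T0" using fT s by (auto simp: M_def)
  have nA: "\<not> AT1 S" if "S \<subseteq> T" "S \<noteq> {}" for S using AT1_superset[OF cT fT that] nT by blast
  have MT: "M \<subseteq> T" "T0 \<subseteq> T" using s by (auto simp: M_def)
  have ZT: "Z T (ind ?N)" using her[unfolded hered_def, rule_format, of T] cT k2 NT by (simp add: Int_absorb2)
  have bN: "b \<in> L - {w}" "b' \<in> L' - {w'}" using be be' by auto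
  have Z0: "Z T0 ((ind ?N)(w := ind ?N w - ind ?N b))"
    using clq_reduce[OF fT cT nT leaf_sep[OF l] c ZT bN(1)] .
  let ?\<nu> = "(ind ?N)(w := ind ?N w - ind ?N b)"
  have leaf0: "leaf T0 w' L' M" unfolding leaf_def
  proof (intro conjI ballI)
    have "L' \<subseteq> T0" "L' \<union> T0' = T" "T0 \<subseteq> T" using LT w'T0 s s' by auto
    then show "L' \<union> M = T0" unfolding M_def by blast
    show "L' \<inter> M = {w'}" using Mcap by blast
    show "conn M" by (rule cM)
    fix p q assume "p \<in> L' - {w'}" "q \<in> M - {w'}"
    then show "\<not> adj p q" using s' by (auto simp: M_def)
  qed
  have cT0: "conn T0" "T0 \<noteq> {}" using s conn_nonempty by auto
  have ZM: "Z M (?\<nu>(w' := ?\<nu> w' - ?\<nu> b'))"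
    using clq_reduce[OF fM(2) cT0(1) nA[OF MT(2) cT0(2)] leaf0 c' Z0 bN(2)] .
  have vals: "ind ?N w = 0" "ind ?N w' = 0" "ind ?N b = 1" "ind ?N b' = 1"
    using wN bN LN LN' by (auto simp: ind_def)
  have b'w: "b' \<noteq> w" using wL' bN by auto
  have nM: "\<not> AT1 M" using nA[OF MT(1)] wM by blast
  have NM: "v \<notin> ?N" if "v \<in> M" for v using that N_eq Mcap by blast
  have wne: "w \<noteq> w'"
  proof
    assume e: "w = w'"
    have "Z M (\<lambda>v. if v = w then -2 else 0)"
      by (rule Z_congD[OF ZM]) (use e vals b'w NM in \<open>auto simp: ind_def\<close>)
    then show False using Z_point[OF fM(1) cM nM wM(1), of "-2"] by simp
  qed
  have LL: "L \<inter> L' = {}" using disjLL' wL wL' wne by blast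
  have L_nb: "y \<in> L" if "z \<in> L - {w}" "y \<in> T" "adj z y" for y z using s that by blast
  have L_nb': "y \<in> L'" if "z \<in> L' - {w'}" "y \<in> T" "adj z y" for y z using s' that by blast
  \<comment> \<open>Otherwise x with either triangle forms a diamond, and the two diamonds share
    only x with no edge between them; by \<open>AT_product\<close> their good monomials multiply to
    exponent at least 2 at x.\<close>
  have adjww: "adj w w'"
  proof (rule ccontr)
    assume n: "\<not> adj w w'"
    have LsubT: "L \<subseteq> T" "L' \<subseteq> T" using s s' by auto
    have nbL: "nb L x = L - {w}" "nb L' x = L' - {w'}"
      using N_eq LL ww wN LsubT unfolding nb_def by blast+
    have fLL: "finite L" "finite L'" using LsubT fT finite_subset by blast+
    have cLL: "conn L" "conn L'" "L \<noteq> {}" "L' \<noteq> {}" using s s' by auto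
    have xL: "x \<notin> L" "x \<notin> L'" using LsubT xT by auto
    have A1: "AT1 (insert x L)" using nbL cL ww
      by (intro AT_diamond[OF fLL(1) cLL(1) c nA[OF LsubT(1) cLL(3)] xL(1) ww(1)]) auto
    have A2: "AT1 (insert x L')" using nbL cL' ww
      by (intro AT_diamond[OF fLL(2) cLL(2) c' nA[OF LsubT(2) cLL(4)] xL(2) ww(3)]) auto
    have noadj: "\<not> adj p q" if p: "p \<in> insert x L - insert x L'" and q: "q \<in> insert x L' - insert x L" for p q
    proof
      assume pq: "adj p q"
      have pL: "p \<in> L" "q \<in> L'" using p q by auto
      show False
      proof (cases "p = w")
        case True
        then have "q \<noteq> w'" using n pq by auto
        then have "p \<in> L'" using L_nb'[of q p] pL adj_sym[OF pq] LsubT by blast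
        then show False using LL pL by blast
      next
        case False
        then have "q \<in> L" using L_nb[of p q] pL pq LsubT by blast
        then show False using LL pL by blast
      qed
    qed
    have "AT (demand x 2) (insert x L \<union> insert x L')"
    proof (rule AT_product[OF _ _ _ noadj A1 A2])
      show "insert x L \<inter> insert x L' \<subseteq> {x}" using LL by blast
    qed (use fLL in \<open>auto simp: demand_def\<close>)
    then have "AT (demand x 2) (insert x T)"
      using AT_superset[OF nonsep_conn[OF ns], of "insert x L \<union> insert x L'" "demand x 2"] fT LsubT
      by (auto simp: demand_def)
    then show False using nAT by blast
  qed
  \<comment> \<open>If \<open>M\<close> is one block, its weights are constant off
    \<open>w'\<close>, so a third vertex would have the weight -1 of \<open>w\<close> instead of 0.
    If \<open>M\<close> has a cutvertex, each side must contain \<open>w\<close> or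
    \<open>w'\<close> off it, which their adjacency forbids.\<close>
  have M_eq: "M = {w, w'}"
  proof (rule ccontr)
    assume "M \<noteq> {w, w'}"
    then obtain m where m: "m \<in> M" "m \<noteq> w" "m \<noteq> w'" using wM by blast
    show False
    proof (cases "nonsep M")
      case True
      then have "clq M \<or> oddcyc M" using rub nM MT by blast
      then have "(?\<nu>(w' := ?\<nu> w' - ?\<nu> b')) w = (?\<nu>(w' := ?\<nu> w' - ?\<nu> b')) m"
        using leaf_const[OF fM(1) cM nM leaf_whole[OF wM(2)] _ ZM, of w m] m wM wne by blast
      then show False using m wne vals NM[OF m(1)] by (simp add: ind_def)
    next
      case False
      then obtain z where z: "z \<in> M" "M \<noteq> {z}" "\<not> conn (M - {z})" using cM by (auto simp: nonsep_def)
      then obtain P Q where PQ: "sep M z P Q" using sep_exists[OF cM] by blast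
      have meet: "w \<in> P - {z} \<or> w' \<in> P - {z}" if PQ: "sep M z P Q" for P Q
      proof (rule ccontr)
        assume no: "\<not> ?thesis"
        note t = PQ[unfolded sep_def]
        have wQ: "w \<in> Q" "w' \<in> Q" using no t wM by blast+
        have cLL: "conn L" "conn L'" using s s' by auto
        have cR: "conn (Q \<union> L \<union> L')" using cLL wQ ww t by (intro conn_Un) auto
        have PM: "P \<subseteq> M" using t by auto
        have PL: "P \<inter> L \<subseteq> {w}" "P \<inter> L' \<subseteq> {w'}" using PM Mcap by auto
        have "sep T z P (Q \<union> L \<union> L')"
          unfolding sep_def
        proof (intro conjI ballI)
          show "P \<union> (Q \<union> L \<union> L') = T" using t TM by blast
          have zQ: "z \<in> P" "z \<in> Q" using t by auto
          have "P \<inter> L \<subseteq> {z}" "P \<inter> L' \<subseteq> {z}" using PL no by blast+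
          then show "P \<inter> (Q \<union> L \<union> L') = {z}" using t by blast
          show "conn P" "P \<noteq> {z}" using t by auto
          show "conn (Q \<union> L \<union> L')" by (rule cR)
          show "Q \<union> L \<union> L' \<noteq> {z}" using t by blast
          fix p q assume p: "p \<in> P - {z}" and q: "q \<in> Q \<union> L \<union> L' - {z}"
          show "\<not> adj p q"
          proof (cases "q \<in> Q")
            case True
            then show ?thesis using t p q by blast
          next
            case False
            have pT: "p \<in> T" using p PM MT by blast
            have "p \<notin> L" "p \<notin> L'" using p no PL by blast+
            moreover have "q \<in> L - {w} \<or> q \<in> L' - {w'}" using q False wQ by blast
            ultimately show ?thesis using L_nb[of q p] L_nb'[of q p] pT adj_sym by blast
          qed
        qed
        then have "?N \<inter> (P - {z}) \<noteq> {}" by (rule leaf_meets[OF ns xT])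
        then show False using NM PM by blast
      qed
      note t = PQ[unfolded sep_def]
      have "w \<in> P - {z} \<or> w' \<in> P - {z}" "w \<in> Q - {z} \<or> w' \<in> Q - {z}"
        using meet[OF PQ] meet[OF sep_sym[OF PQ]] .
      then show False using t adjww adj_sym by blast
    qed
  qed
  have T_eq: "insert x T = {x, w, b, e, w', b', e'}" using TM M_eq L L' by auto
  have bT: "b \<in> T" "e \<in> T" "b' \<in> T" "e' \<in> T" using TM L L' by auto
  have d: "distinct [x, w, b, e, w', b', e']"
    using xT bT wT LL be be' wne unfolding L L' by auto
  have xadj: "adj x y \<longleftrightarrow> y \<in> {b, e, b', e'}" if "y \<in> T" for y
    using N_eq that be be' by (auto simp: nb_def)
  have inner: "\<not> adj y y'" if "y \<in> {b, e}" "y' \<in> L'" for y y'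
    using L_nb[of y y'] that be LL s' by blast
  have inner': "\<not> adj w y'" if "y' \<in> {b', e'}" for y'
    using L_nb'[of y' w] that be' LL ww wT adj_sym by blast
  show ?thesis unfolding T_eq
  proof (rule moser_gr[OF d])
    show "adj w b" "adj b e" "adj w e" using c be(2) d unfolding L by (auto simp: clq_def)
    show "adj w' b'" "adj b' e'" "adj w' e'" using c' be'(2) d unfolding L' by (auto simp: clq_def)
    show "adj w w'" by (rule adjww)
    show "adj x b" "adj x e" "adj x b'" "adj x e'" using xadj bT by auto
    show "\<not> adj x w" "\<not> adj x w'" using xadj wT d by auto
    show "\<not> adj w b'" "\<not> adj w e'" using inner' by auto
    show "\<not> adj b w'" "\<not> adj b b'" "\<not> adj b e'" "\<not> adj e w'" "\<not> adj e b'" "\<not> adj e e'"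
      using inner unfolding L' by auto
  qed
qed

lemma nonsep_not_AT_imp:
  assumes fT: "finite T" and xT: "x \<notin> T" and ns: "nonsep (insert x T)"
    and nT: "\<not> AT1 T" and nAT: "\<not> AT (demand x 2) (insert x T)" and k: "3 \<le> card (nb T x)"
  shows "clq (insert x T) \<or> (gr (insert x T), h_vert x) \<in> \<D>"
proof -
  let ?N = "nb T x"
  have "?N \<noteq> {}" using k by auto
  then have "T \<noteq> {}" by (auto simp: nb_def)
  then have "insert x T \<noteq> {x}" using xT by auto
  then have "conn (insert x T - {x})" using nonsep_remove[OF ns, of x] by blast
  then have cT: "conn T" using xT by simp
  have NT: "?N \<subseteq> T" by (auto simp: nb_def)
  have her: "hered 2 ?N T" using hered_of_not_AT[OF fT xT nonsep_conn[OF ns] nAT] .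
  show ?thesis
  proof (cases "nonsep T")
    case True
    then have "clq T \<or> oddcyc T" using not_AT1_nonsep_imp fT nT by blast
    then have "clq T" "?N = T" using single_block[OF fT cT nT _ her _ _ NT] k by auto
    then show ?thesis using insert_clq by blast
  next
    case False
    show ?thesis
    proof (cases "card ?N = 3")
      case True
      then obtain u1 u2 u3 where u: "?N = {u1, u2, u3}" "u1 \<noteq> u2" "u1 \<noteq> u3" "u2 \<noteq> u3"
        by (auto simp: card_3_iff)
      have "Z T (ind ?N)" using her[unfolded hered_def, rule_format, of T] cT k NT by (simp add: Int_absorb2)
      then have "Z T (wt u1 1 u2 1 u3 1)" by (rule Z_congD) (auto simp: u ind_def wt_def)
      moreover have "(L - {w}) \<inter> {u1, u2, u3} \<noteq> {}" if "sep T w L T0" for w L T0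
        using leaf_meets[OF ns xT that] u by blast
      ultimately have "tri_hyp T u1 1 u2 1 u3 1"
        unfolding tri_hyp_def using fT cT nT u NT by auto
      then have "tri T u1 1 u2 1 u3 1" by (rule tri_exists)
      then show ?thesis using K4_of_tri[OF _ xT u(1)] by blast
    next
      case F: False
      then show ?thesis using moser_case[OF fT xT ns cT nT False nAT] k by simp
    qed
  qed
qed

end

section \<open>Members of the exceptional class are not AT\<close>

lemma path_edges_mem: "(a, b) \<in> path_edges p \<Longrightarrow> a \<in> set p \<and> b \<in> set p"
  unfolding path_edges_def by (cases p) (auto dest: set_zip_leftD set_zip_rightD)

text \<open>The recursion of \<open>cf_insert\<close> on numbered vertices with an exponent list, so
  that concrete coefficients can be evaluated.\<close>

fun cfl :: "(nat \<times> nat) list \<Rightarrow> nat list \<Rightarrow> int" where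
  "cfl [] ds = (if list_all (\<lambda>k. k = 0) ds then 1 else 0)"
| "cfl ((i, j) # es) ds = (case ds ! i of 0 \<Rightarrow> 0 | Suc k \<Rightarrow> cfl es (ds[i := k]))
     - (case ds ! j of 0 \<Rightarrow> 0 | Suc k \<Rightarrow> cfl es (ds[j := k]))"

lemma cf_cfl:
  assumes "inj_on f {..<n}"
  shows "distinct es \<Longrightarrow> set es \<subseteq> {..<n} \<times> {..<n} \<Longrightarrow> length ds = n \<Longrightarrow> (\<And>i. i < n \<Longrightarrow> d (f i) = ds ! i) \<Longrightarrow>
    (\<And>v. v \<notin> f ` {..<n} \<Longrightarrow> d v = 0) \<Longrightarrow> cf (map_prod f f ` set es) d = cfl es ds"
proof (induction es arbitrary: d ds)
  case Nil
  have "d = (\<lambda>_. 0) \<longleftrightarrow> list_all (\<lambda>k. k = 0) ds"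
  proof
    assume "d = (\<lambda>_. 0)"
    then show "list_all (\<lambda>k. k = 0) ds" using Nil(3,4) by (simp add: list_all_length)
  next
    assume "list_all (\<lambda>k. k = 0) ds"
    then have z: "ds ! i = 0" if "i < n" for i using Nil(3) that by (simp add: list_all_length)
    show "d = (\<lambda>_. 0)"
    proof
      fix v show "d v = 0" using Nil(4,5) z by (cases "v \<in> f ` {..<n}") auto
    qed
  qed
  then show ?case by (simp add: cf_empty)
next
  case (Cons e es)
  obtain i j where e: "e = (i, j)" by (cases e)
  have ij: "i < n" "j < n" using Cons.prems(2) e by auto
  have inj2: "inj_on (map_prod f f) ({..<n} \<times> {..<n})"
    using assms by (auto simp: inj_on_def)
  have ne: "(f i, f j) \<notin> map_prod f f ` set es"
  proof
    assume "(f i, f j) \<in> map_prod f f ` set es"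
    then obtain e' where "e' \<in> set es" "map_prod f f e' = map_prod f f (i, j)" by auto
    then have "e' = (i, j)" using inj_onD[OF inj2, of e' "(i, j)"] Cons.prems(2) ij by auto
    then show False using Cons.prems(1) e \<open>e' \<in> set es\<close> by simp
  qed
  have step: "(if 0 < d (f k) then cf (map_prod f f ` set es) (d(f k := d (f k) - 1)) else 0)
      = (case ds ! k of 0 \<Rightarrow> 0 | Suc m \<Rightarrow> cfl es (ds[k := m]))" if k: "k < n" for k
  proof (cases "ds ! k")
    case 0
    then show ?thesis using Cons.prems(4)[OF k] by simp
  next
    case (Suc m)
    have "cf (map_prod f f ` set es) (d(f k := d (f k) - 1)) = cfl es (ds[k := m])"
    proof (rule Cons.IH)
      show "distinct es" "set es \<subseteq> {..<n} \<times> {..<n}" "length (ds[k := m]) = n" using Cons.prems by auto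
      fix l assume l: "l < n"
      show "(d(f k := d (f k) - 1)) (f l) = ds[k := m] ! l"
        using Cons.prems(3,4) l k Suc inj_onD[OF assms, of l k] by (cases "l = k") auto
    next
      fix v assume v: "v \<notin> f ` {..<n}"
      then have "v \<noteq> f k" using k by auto
      then show "(d(f k := d (f k) - 1)) v = 0" using Cons.prems(5)[OF v] by simp
    qed
    then show ?thesis using Suc Cons.prems(4)[OF k] by simp
  qed
  have img: "map_prod f f ` set (e # es) = insert (f i, f j) (map_prod f f ` set es)" by (simp add: e)
  show ?case unfolding img cf_insert[OF finite_imageI[OF finite_set] ne] fst_conv snd_conv
      step[OF ij(1)] step[OF ij(2)] by (simp only: e cfl.simps)
qed

text \<open>The vertices \<open>x, a, b, c, a', b', c'\<close> are numbered \<open>0, \<dots>, 6\<close>.\<close>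

definition moser_edges :: "(nat \<times> nat) list" where
  "moser_edges = [(0, 2), (0, 3), (0, 5), (0, 6), (1, 2), (1, 3), (2, 3), (1, 4), (4, 5), (4, 6), (5, 6)]"

text \<open>Exponents add up to 11, the number of edges. The demands and the twin pairs, which need
  distinct exponents, already use 2 + 1 + 1 + 3 + 3; the five rows are the places where the one
  remaining unit can go.\<close>

lemma moser_cfl:
  "list_all (\<lambda>(x, a, a', s, s'). list_all (\<lambda>(b, c). list_all (\<lambda>(b', c').
      cfl moser_edges [x, a, b, c, a', b', c'] = 0) s') s)
    [(3, 1, 1, [(1, 2), (2, 1)], [(1, 2), (2, 1)]),
     (2, 2, 1, [(1, 2), (2, 1)], [(1, 2), (2, 1)]),
     (2, 1, 2, [(1, 2), (2, 1)], [(1, 2), (2, 1)]),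
     (2, 1, 1, [(1, 3), (3, 1)], [(1, 2), (2, 1)]),
     (2, 1, 1, [(1, 2), (2, 1)], [(1, 3), (3, 1)])]"
  by code_simp

context ograph begin

text \<open>\<open>Z_leaf\<close> applied along the path: a weight at the tip reaches
  \<open>z\<close> with one sign change per path vertex. The equivalence also allows weights to be
  pushed outwards, which is how it is used for K4.\<close>

lemma pendant_path:
  assumes "finite T0" "z \<in> T0" "\<not> AT1 T0" "distinct p" "set p \<inter> T0 = {}"
    "\<And>a b. a \<in> set p \<Longrightarrow> b \<in> T0 \<union> set p \<Longrightarrow>
       adj a b \<longleftrightarrow> (a, b) \<in> path_edges (p @ [z]) \<or> (b, a) \<in> path_edges (p @ [z])"
  shows "\<not> AT1 (T0 \<union> set p) \<and>
    (Z (T0 \<union> set p) (\<lambda>v. (if v \<in> set p then 0 else \<nu> v) + (if v = hd (p @ [z]) then c else 0))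
      \<longleftrightarrow> Z T0 (\<lambda>v. \<nu> v + (if v = z then (-1) ^ length p * c else 0)))"
  using assms(4-)
proof (induction p arbitrary: c)
  case Nil
  then show ?case using assms by (simp cong: if_cong)
next
  case (Cons q p)
  let ?T = "T0 \<union> set p" and ?h = "hd (p @ [z])"
  have pe: "path_edges ((q # p) @ [z]) = insert (q, ?h) (path_edges (p @ [z]))"
    using path_edges_Cons[of "p @ [z]" q] by simp
  have q: "q \<notin> ?T" "q \<noteq> z" using Cons.prems assms(2) by auto
  have qp: "(q, b) \<notin> path_edges (p @ [z])" "(b, q) \<notin> path_edges (p @ [z])" for b
    using path_edges_mem[of q b "p @ [z]"] path_edges_mem[of b q "p @ [z]"] q by auto
  have adj: "adj a b \<longleftrightarrow> (a, b) \<in> path_edges (p @ [z]) \<or> (b, a) \<in> path_edges (p @ [z])"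
    if "a \<in> set p" "b \<in> T0 \<union> set p" for a b
  proof -
    have "a \<noteq> q" "b \<noteq> q" using that q by auto
    then show ?thesis using Cons.prems(3)[of a b] that unfolding pe by auto
  qed
  note IH = Cons.IH[OF _ _ adj]
  have nA: "\<not> AT1 ?T" using IH Cons.prems by auto
  have hT: "?h \<in> ?T" using assms(2) by (cases p) auto
  have adjq: "adj q b \<longleftrightarrow> b = ?h" if "b \<in> ?T" for b
  proof -
    have "adj q b \<longleftrightarrow> (q, b) \<in> path_edges ((q # p) @ [z]) \<or> (b, q) \<in> path_edges ((q # p) @ [z])"
      using Cons.prems(3)[of q b] that by auto
    also have "\<dots> \<longleftrightarrow> b = ?h" unfolding pe using qp that q by auto
    finally show ?thesis .
  qed
  have nb: "nb ?T q = {?h}" using adjq hT unfolding nb_def by blast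
  let ?\<mu> = "\<lambda>v. (if v \<in> set (q # p) then 0 else \<nu> v) + (if v = q then c else 0)"
  have T: "T0 \<union> set (q # p) = insert q ?T" by auto
  have "Z (insert q ?T) ?\<mu> \<longleftrightarrow> Z ?T (?\<mu>(?h := ?\<mu> ?h - ?\<mu> q))"
    using Z_leaf[OF _ q(1) nb nA] assms(1) by blast
  also have "\<dots> \<longleftrightarrow> Z ?T (\<lambda>v. (if v \<in> set p then 0 else \<nu> v) + (if v = ?h then - c else 0))"
  proof (rule Z_cong)
    fix v assume v: "v \<in> ?T"
    then have "v \<noteq> q" "?h \<noteq> q" using q hT by auto
    then show "(?\<mu>(?h := ?\<mu> ?h - ?\<mu> q)) v = (if v \<in> set p then 0 else \<nu> v) + (if v = ?h then - c else 0)"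
      by auto
  qed
  also have "\<dots> \<longleftrightarrow> Z T0 (\<lambda>v. \<nu> v + (if v = z then (-1) ^ length p * (- c) else 0))"
    using IH[of "- c"] Cons.prems by auto
  also have "(\<lambda>v. \<nu> v + (if v = z then (-1) ^ length p * (- c) else 0))
     = (\<lambda>v. \<nu> v + (if v = z then (-1) ^ length (q # p) * c else 0))" by auto
  finally have "Z (T0 \<union> set (q # p)) ?\<mu> \<longleftrightarrow> Z T0 (\<lambda>v. \<nu> v + (if v = z then (-1) ^ length (q # p) * c else 0))"
    unfolding T .
  moreover have "\<not> AT1 (T0 \<union> set (q # p))" unfolding T using AT1_leaf[OF q(1) _ nA] nb by simp
  ultimately show ?case by simp
qed

lemma card_rs_insert: "q \<notin> W \<Longrightarrow> card (rs (insert q W)) = card (nb W q) + card (rs W)"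
proof -
  assume q: "q \<notin> W"
  have "star W q \<inter> rs W = {}" using q by (auto simp: star_def rs_def)
  then show ?thesis
    using star_facts(1,2)[OF q] finite_rs bij_betw_same_card[OF star_facts(5)[OF q]]
    by (simp add: card_Un_disjoint)
qed

lemma card_rs_empty: "card (rs {}) = 0"
  by (simp add: rs_def)

text \<open>By degree count some exponent is at least 2, say at \<open>q\<close>. The term at
  \<open>q\<close> vanishes because a clique is not \<open>AT1\<close>. If the exponent is exactly
  2, the degree of \<open>q\<close>, the other two terms form the constant form on the opposite
  edge, whose alternating sum is 0; if it is larger, they exceed the degree.\<close>

lemma Z_triangle:
  assumes "z1 \<noteq> z2" "z1 \<noteq> z3" "z2 \<noteq> z3" "clq {z1, z2, z3}"
  shows "Z {z1, z2, z3} (\<lambda>_. c)"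
  unfolding Z_def
proof (intro allI impI)
  let ?T = "{z1, z2, z3}"
  fix d :: "'a \<Rightarrow> nat" assume d: "\<forall>v\<in>?T. 1 \<le> d v" "\<forall>v. v \<notin> ?T \<longrightarrow> d v = 0"
  have nA: "\<not> AT1 ?T" using not_AT1_clq[OF _ _ assms(4)] by blast
  have pair: "(\<Sum>u\<in>?T. c * cf (rs ?T) (d(u := d u - 1))) = 0"
    if q: "?T = {q, a, b}" "q \<noteq> a" "q \<noteq> b" "a \<noteq> b" "2 \<le> d q" for q a b
  proof -
    have adj: "adj q a" "adj q b" "adj a b" using assms(4) q unfolding q(1) by (auto simp: clq_def)
    have nb: "nb {a, b} q = {a, b}" using adj by (auto simp: nb_def)
    have q0: "cf (rs ?T) (d(q := d q - 1)) = 0"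
    proof -
      have "\<forall>v\<in>?T. 1 \<le> (d(q := d q - 1)) v" "\<forall>v. v \<notin> ?T \<longrightarrow> (d(q := d q - 1)) v = 0"
        using d q(5) unfolding q(1) by auto
      then show ?thesis using nA unfolding AT_def by blast
    qed
    have ab: "cf (rs ?T) (d(a := d a - 1)) + cf (rs ?T) (d(b := d b - 1)) = 0"
    proof (cases "d q = 2")
      case False
      then show ?thesis using q(2-5) nb cf_above_deg[of q "{a, b}" "d(a := d a - 1)"]
          cf_above_deg[of q "{a, b}" "d(b := d b - 1)"] unfolding q(1) by simp
    next
      case True
      let ?e = "d(q := 0)"
      have "nb {b} a = {b}" using adj by (auto simp: nb_def)
      then have ip: "ipath [a, b]" using q(4) by simp
      have "Z (set [a, b]) (\<lambda>_. 1)" using Z_ipath[OF ip, of "\<lambda>_. 1"] by simp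
      then have Zab: "Z {a, b} (\<lambda>_. 1)" by simp
      have "\<forall>v\<in>{a, b}. 1 \<le> ?e v" "\<forall>v. v \<notin> {a, b} \<longrightarrow> ?e v = 0" using d q(2-4) unfolding q(1) by auto
      then have "(\<Sum>u\<in>{a, b}. 1 * cf (rs {a, b}) (?e(u := ?e u - 1))) = 0"
        using Zab unfolding Z_def by blast
      then have s: "cf (rs {a, b}) (?e(a := ?e a - 1)) + cf (rs {a, b}) (?e(b := ?e b - 1)) = 0"
        using q(4) by simp
      have "(d(a := d a - 1))(q := 0) = ?e(a := ?e a - 1)" "(d(b := d b - 1))(q := 0) = ?e(b := ?e b - 1)"
        using q(2,3) by auto
      then have "cf (rs ?T) (d(a := d a - 1)) = sg {a, b} q * cf (rs {a, b}) (?e(a := ?e a - 1))"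
        "cf (rs ?T) (d(b := d b - 1)) = sg {a, b} q * cf (rs {a, b}) (?e(b := ?e b - 1))"
        using q(2-4) nb True cf_deg[of q "{a, b}" "d(a := d a - 1)"] cf_deg[of q "{a, b}" "d(b := d b - 1)"]
        unfolding q(1) by simp_all
      then show ?thesis using s by (metis distrib_left mult_zero_right)
    qed
    have "(\<Sum>u\<in>?T. c * cf (rs ?T) (d(u := d u - 1))) = c * cf (rs ?T) (d(q := d q - 1)) +
       (c * cf (rs ?T) (d(a := d a - 1)) + c * cf (rs ?T) (d(b := d b - 1)))"
      unfolding sum.cong[OF q(1) refl] using q(2-4) by simp
    also have "\<dots> = c * (cf (rs ?T) (d(a := d a - 1)) + cf (rs ?T) (d(b := d b - 1)))"
      unfolding q0 by (simp only: distrib_left mult_zero_right add_0)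
    finally show ?thesis unfolding ab by (simp only: mult_zero_right)
  qed
  show "(\<Sum>u\<in>?T. c * cf (rs ?T) (d(u := d u - 1))) = 0"
  proof (cases "\<exists>q\<in>?T. 2 \<le> d q")
    case True
    then consider "2 \<le> d z1" | "2 \<le> d z2" | "2 \<le> d z3" by blast
    then show ?thesis
    proof cases
      case 1
      then show ?thesis using pair[of z1 z2 z3] assms by blast
    next
      case 2
      have "{z1, z2, z3} = {z2, z1, z3}" by auto
      then show ?thesis using pair[of z2 z1 z3] assms 2 by blast
    next
      case 3
      have "{z1, z2, z3} = {z3, z1, z2}" by auto
      then show ?thesis using pair[of z3 z1 z2] assms 3 by blast
    qed
  next
    case False
    then have one: "d v = 1" if "v \<in> ?T" for v using d that by (metis One_nat_def Suc_1 le_antisym not_less_eq_eq)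
    have adj: "adj z1 z2" "adj z1 z3" "adj z2 z3" using assms by (auto simp: clq_def)
    have "nb {z2, z3} z1 = {z2, z3}" "nb {z3} z2 = {z3}" "nb {} z3 = {}" using adj by (auto simp: nb_def)
    then have c3: "card (rs ?T) = 3"
      using card_rs_insert[of z1 "{z2, z3}"] card_rs_insert[of z2 "{z3}"] card_rs_insert[of z3 "{}"] card_rs_empty assms
      by simp
    have "cf (rs ?T) (d(u := d u - 1)) = 0" if u: "u \<in> ?T" for u
    proof (rule ccontr)
      assume "cf (rs ?T) (d(u := d u - 1)) \<noteq> 0"
      then have "sum (d(u := d u - 1)) ?T = card (rs ?T)" by (intro cf_sum[OF finite_rs]) (auto simp: rs_def)
      moreover have "sum (d(u := d u - 1)) ?T = 2" using u one assms by auto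
      ultimately show False using c3 by simp
    qed
    then show ?thesis by (simp add: sum.neutral)
  qed
qed

text \<open>Constant weight on the triangle is pushed out along the three paths to weight 1 at each
  tip, which is the indicator of the neighbourhood of \<open>x\<close>. As \<open>x\<close> has
  degree 3, \<open>not_AT_of_Z\<close> decides.\<close>

lemma K4_not_AT:
  assumes G: "gr W = K4_paths x z1 z2 z3 p1 p2 p3" and d: "distinct ([x, z1, z2, z3] @ p1 @ p2 @ p3)"
    and par: "even (length p1) = even (length p2)" "even (length p1) = even (length p3)"
  shows "\<not> AT (demand x 2) W"
proof -
  let ?h1 = "hd (p1 @ [z1])" and ?h2 = "hd (p2 @ [z2])" and ?h3 = "hd (p3 @ [z3])"
  let ?R = "tri_edges z1 z2 z3 p1 p2 p3"
  define T where "T = {z1, z2, z3} \<union> set p1 \<union> set p2 \<union> set p3"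
  let ?F = "{(x, ?h1), (x, ?h2), (x, ?h3)} \<union> ?R"
  have F: "{(z1, z2), (z1, z3), (z2, z3)} \<union> path_edges (x # p1 @ [z1]) \<union>
        path_edges (x # p2 @ [z2]) \<union> path_edges (x # p3 @ [z3]) = ?F"
    unfolding tri_edges_def using path_edges_Cons[of "p1 @ [z1]" x] path_edges_Cons[of "p2 @ [z2]" x]
      path_edges_Cons[of "p3 @ [z3]" x] by auto
  have W: "W = insert x T" and xT: "x \<notin> T"
    using arg_cong[OF G, of pverts] d by (auto simp: K4_paths_def graph_of_def gr_def T_def)
  have arcs: "{(a, b). a \<in> W \<and> b \<in> W \<and> adj a b} = ?F \<union> ?F\<inverse>"
    using arg_cong[OF G, of parcs] unfolding K4_paths_def graph_of_def gr_def F by simp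
  have E: "a \<in> W \<and> b \<in> W \<and> adj a b \<longleftrightarrow> (a, b) \<in> ?F \<or> (b, a) \<in> ?F" for a b
  proof -
    have "a \<in> W \<and> b \<in> W \<and> adj a b \<longleftrightarrow> (a, b) \<in> {(a, b). a \<in> W \<and> b \<in> W \<and> adj a b}" by simp
    also have "\<dots> \<longleftrightarrow> (a, b) \<in> ?F \<or> (b, a) \<in> ?F" unfolding arcs by blast
    finally show ?thesis .
  qed
  have RT: "a \<in> T \<and> b \<in> T" if "(a, b) \<in> ?R" for a b
    using that path_edges_mem[of a b] unfolding tri_edges_def T_def by fastforce
  have ET: "adj a b \<longleftrightarrow> (a, b) \<in> ?R \<or> (b, a) \<in> ?R" if "a \<in> T" "b \<in> T" for a b
    using E[of a b] that xT unfolding W by auto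
  have h: "?h1 \<in> T" "?h2 \<in> T" "?h3 \<in> T" using hd_in_set[of "p1 @ [z1]"] hd_in_set[of "p2 @ [z2]"]
    hd_in_set[of "p3 @ [z3]"] by (auto simp: T_def)
  have nbx: "nb T x = {?h1, ?h2, ?h3}"
  proof -
    have "adj x u \<longleftrightarrow> u \<in> {?h1, ?h2, ?h3}" if "u \<in> T" for u
    proof -
      have "(x, u) \<notin> ?R" "(u, x) \<notin> ?R" using RT xT by blast+
      then show ?thesis using E[of x u] that xT unfolding W by auto
    qed
    then show ?thesis using h unfolding nb_def by blast
  qed
  have h1p: "?h1 \<in> insert z1 (set p1)" "?h2 \<in> insert z2 (set p2)" "?h3 \<in> insert z3 (set p3)"
    using hd_in_set[of "p1 @ [z1]"] hd_in_set[of "p2 @ [z2]"] hd_in_set[of "p3 @ [z3]"] by auto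
  have "insert z1 (set p1) \<inter> insert z2 (set p2) = {}" "insert z1 (set p1) \<inter> insert z3 (set p3) = {}"
    "insert z2 (set p2) \<inter> insert z3 (set p3) = {}" using d by auto
  then have hne: "?h1 \<noteq> ?h2" "?h1 \<noteq> ?h3" "?h2 \<noteq> ?h3" using h1p by (metis disjoint_iff)+
  let ?T0 = "{z1, z2, z3}"
  let ?T1 = "?T0 \<union> set p1" let ?T2 = "?T1 \<union> set p2"
  have T: "T = ?T2 \<union> set p3" by (auto simp: T_def)
  have zT: "z1 \<in> T" "z2 \<in> T" "z3 \<in> T" by (auto simp: T_def)
  have zs: "z1 \<noteq> z2" "z1 \<noteq> z3" "z2 \<noteq> z3" using d by auto
  have "(z1, z2) \<in> ?R" "(z1, z3) \<in> ?R" "(z2, z3) \<in> ?R" by (auto simp: tri_edges_def)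
  then have "adj z1 z2" "adj z1 z3" "adj z2 z3" using ET zT by blast+
  then have clq0: "clq ?T0" using adj_sym by (auto simp: clq_def)
  have a1: "adj a b \<longleftrightarrow> (a, b) \<in> path_edges (p1 @ [z1]) \<or> (b, a) \<in> path_edges (p1 @ [z1])"
    if "a \<in> set p1" "b \<in> T" for a b
  proof -
    have aT: "a \<in> T" using that by (auto simp: T_def)
    have "a \<notin> set (p2 @ [z2])" "a \<notin> set (p3 @ [z3])" "a \<notin> {z1, z2, z3}" using that d by auto
    then show ?thesis using ET[OF aT that(2)] path_edges_mem[of a b "p2 @ [z2]"] path_edges_mem[of a b "p3 @ [z3]"]
      path_edges_mem[of b a "p2 @ [z2]"] path_edges_mem[of b a "p3 @ [z3]"] unfolding tri_edges_def by blast
  qed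
  have a2: "adj a b \<longleftrightarrow> (a, b) \<in> path_edges (p2 @ [z2]) \<or> (b, a) \<in> path_edges (p2 @ [z2])"
    if "a \<in> set p2" "b \<in> T" for a b
  proof -
    have aT: "a \<in> T" using that by (auto simp: T_def)
    have "a \<notin> set (p1 @ [z1])" "a \<notin> set (p3 @ [z3])" "a \<notin> {z1, z2, z3}" using that d by auto
    then show ?thesis using ET[OF aT that(2)] path_edges_mem[of a b "p1 @ [z1]"] path_edges_mem[of a b "p3 @ [z3]"]
      path_edges_mem[of b a "p1 @ [z1]"] path_edges_mem[of b a "p3 @ [z3]"] unfolding tri_edges_def by blast
  qed
  have a3: "adj a b \<longleftrightarrow> (a, b) \<in> path_edges (p3 @ [z3]) \<or> (b, a) \<in> path_edges (p3 @ [z3])"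
    if "a \<in> set p3" "b \<in> T" for a b
  proof -
    have aT: "a \<in> T" using that by (auto simp: T_def)
    have "a \<notin> set (p1 @ [z1])" "a \<notin> set (p2 @ [z2])" "a \<notin> {z1, z2, z3}" using that d by auto
    then show ?thesis using ET[OF aT that(2)] path_edges_mem[of a b "p1 @ [z1]"] path_edges_mem[of a b "p2 @ [z2]"]
      path_edges_mem[of b a "p1 @ [z1]"] path_edges_mem[of b a "p2 @ [z2]"] unfolding tri_edges_def by blast
  qed
  define s :: int where "s = (-1) ^ length p1"
  have s: "(-1) ^ length p1 * (1::int) = s" "(-1) ^ length p2 * (1::int) = s" "(-1) ^ length p3 * (1::int) = s"
    using par by (auto simp: s_def minus_one_power_iff)
  \<comment> \<open>The weights to be kept while the first, second and third path is attached: 1 at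
    tips already reached, \<open>s\<close> at corners still waiting.\<close>
  let ?n0 = "\<lambda>v. (if v = z2 then s else 0) + (if v = z3 then s else 0)"
  let ?n1 = "\<lambda>v. (if v = ?h1 then 1 else 0) + (if v = z3 then s else 0)"
  let ?n2 = "\<lambda>v. (if v = ?h1 then 1 else 0) + (if v = ?h2 then 1 else (0::int))"
  have n0: "\<not> AT1 ?T0" using not_AT1_clq[OF _ _ clq0] by blast
  have "Z ?T0 (\<lambda>_. s)" using Z_triangle[OF zs clq0] .
  then have Z0: "Z ?T0 (\<lambda>v. ?n0 v + (if v = z1 then (-1) ^ length p1 * 1 else 0))"
    unfolding s by (rule Z_congD) (use zs in auto)
  have P1: "\<not> AT1 ?T1 \<and>
    (Z ?T1 (\<lambda>v. (if v \<in> set p1 then 0 else ?n0 v) + (if v = ?h1 then 1 else 0))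
      \<longleftrightarrow> Z ?T0 (\<lambda>v. ?n0 v + (if v = z1 then (-1) ^ length p1 * 1 else 0)))"
    by (rule pendant_path) (use n0 d a1 T in auto)
  have A1: "Z ?T1 (\<lambda>v. (if v \<in> set p1 then 0 else ?n0 v) + (if v = ?h1 then 1 else 0))"
    using P1 Z0 by blast
  have Z1: "Z ?T1 (\<lambda>v. ?n1 v + (if v = z2 then (-1) ^ length p2 * 1 else 0))"
    unfolding s by (rule Z_congD[OF A1]) (use d in auto)
  have P2: "\<not> AT1 ?T2 \<and>
    (Z ?T2 (\<lambda>v. (if v \<in> set p2 then 0 else ?n1 v) + (if v = ?h2 then 1 else 0))
      \<longleftrightarrow> Z ?T1 (\<lambda>v. ?n1 v + (if v = z2 then (-1) ^ length p2 * 1 else 0)))"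
    by (rule pendant_path) (use P1 d a2 T in auto)
  have A2: "Z ?T2 (\<lambda>v. (if v \<in> set p2 then 0 else ?n1 v) + (if v = ?h2 then 1 else 0))"
    using P2 Z1 by blast
  have Z2: "Z ?T2 (\<lambda>v. ?n2 v + (if v = z3 then (-1) ^ length p3 * 1 else 0))"
    unfolding s by (rule Z_congD[OF A2]) (use d h1p in auto)
  have P3: "\<not> AT1 (?T2 \<union> set p3) \<and>
    (Z (?T2 \<union> set p3) (\<lambda>v. (if v \<in> set p3 then 0 else ?n2 v) + (if v = ?h3 then 1 else 0))
      \<longleftrightarrow> Z ?T2 (\<lambda>v. ?n2 v + (if v = z3 then (-1) ^ length p3 * 1 else 0)))"
    by (rule pendant_path) (use P2 d a3 T in auto)
  then have "Z T (\<lambda>v. (if v \<in> set p3 then 0 else ?n2 v) + (if v = ?h3 then 1 else 0))"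
    using Z2 unfolding T by blast
  then have "Z T (ind (nb T x))"
    by (rule Z_congD) (use hne h1p d in \<open>auto simp: nbx ind_def\<close>)
  moreover have "\<not> AT1 T" using P3 T by simp
  moreover have "card (nb T x) \<le> Suc 2" unfolding nbx by (simp add: card_insert_if)
  moreover have "finite T" by (simp add: T_def)
  ultimately show ?thesis unfolding W using not_AT_of_Z xT by blast
qed

text \<open>Degree 4 at \<open>x\<close> leaves exponent 2 outside the reach of the linear form, so
  the admissible monomials are enumerated and their coefficients evaluated.\<close>

lemma moser_not_AT:
  assumes G: "gr W = moser_spindle x a b c a' b' c'" and dist: "distinct [x, a, b, c, a', b', c']"
  shows "\<not> AT (demand x 2) W"
proof
  assume "AT (demand x 2) W"
  then obtain d where dm: "\<forall>v\<in>W. demand x 2 v \<le> d v" and d0: "\<forall>v. v \<notin> W \<longrightarrow> d v = 0"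
    and nz: "cf (rs W) d \<noteq> 0" by (auto simp: AT_def)
  define l where "l = [x, a, b, c, a', b', c']"
  define E where "E = {(a, b), (b, c), (a, c), (a', b'), (b', c'), (a', c'), (a, a'),
        (x, b), (x, c), (x, b'), (x, c')}"
  have W: "W = {x, a, b, c, a', b', c'}"
    using arg_cong[OF G, of pverts] by (simp add: moser_spindle_def graph_of_def gr_def)
  have arcs: "{(u, v). u \<in> W \<and> v \<in> W \<and> adj u v} = E \<union> E\<inverse>"
    using arg_cong[OF G, of parcs] by (simp add: moser_spindle_def graph_of_def gr_def E_def)
  have adjE: "adj u v \<longleftrightarrow> (u, v) \<in> E \<or> (v, u) \<in> E" if "u \<in> W" "v \<in> W" for u v
  proof -
    have "adj u v \<longleftrightarrow> (u, v) \<in> {(u, v). u \<in> W \<and> v \<in> W \<and> adj u v}" using that by simp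
    then show ?thesis unfolding arcs by blast
  qed
  have img: "map_prod ((!) l) ((!) l) ` set moser_edges = E"
    unfolding moser_edges_def E_def l_def by (auto simp: numeral_eq_Suc)
  have lW: "(!) l ` {..<7} = W"
    unfolding W l_def by (auto simp: numeral_eq_Suc lessThan_Suc)
  have inj: "inj_on ((!) l) {..<7}" using inj_on_nth[of l "{..<7}"] dist by (auto simp: l_def)
  have nrs: "rs W \<union> (rs W)\<inverse> = E \<union> E\<inverse>"
    unfolding arcs[symmetric] by (auto simp: rs_def adj_def)
  have rsa: "rs W \<inter> (rs W)\<inverse> = {}" using asym_D by (auto simp: rs_def)
  have Ea: "E \<inter> E\<inverse> = {}" using dist unfolding E_def by auto
  have fE: "finite E" by (simp add: E_def)
  have abs: "\<bar>cf (rs W) d\<bar> = \<bar>cf E d\<bar>" by (rule cf_orientation_indep[OF finite_rs fE rsa Ea nrs])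
  then have nzE: "cf E d \<noteq> 0" using nz by simp
  have cE: "cf E d = cfl moser_edges (map d l)"
    unfolding img[symmetric]
  proof (rule cf_cfl[OF inj])
    show "distinct moser_edges" "set moser_edges \<subseteq> {..<7} \<times> {..<7}" by (auto simp: moser_edges_def)
    have len: "length l = 7" by (simp add: l_def)
    then show "length (map d l) = 7" by simp
    fix i :: nat assume "i < 7"
    then show "d (l ! i) = map d l ! i" using len by simp
  next
    fix v assume "v \<notin> (!) l ` {..<7}"
    then show "d v = 0" using d0 unfolding lW by blast
  qed
  have "card E = 11" unfolding E_def using dist by auto
  moreover have "sum d W = card E" using nzE by (intro cf_sum[OF fE]) (auto simp: E_def W)
  moreover have "sum d W = d x + d a + d b + d c + d a' + d b' + d c'" unfolding W using dist by simp
  ultimately have sum: "d x + d a + d b + d c + d a' + d b' + d c' = 11" by simp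
  have lo: "2 \<le> d x" "1 \<le> d a" "1 \<le> d b" "1 \<le> d c" "1 \<le> d a'" "1 \<le> d b'" "1 \<le> d c'"
    using dm dist unfolding W by (auto simp: demand_def)
  have ne: "x \<noteq> a" "x \<noteq> b" "x \<noteq> c" "x \<noteq> a'" "x \<noteq> b'" "x \<noteq> c'" "a \<noteq> b" "a \<noteq> c" "a \<noteq> a'" "a \<noteq> b'" "a \<noteq> c'"
    "b \<noteq> c" "b \<noteq> a'" "b \<noteq> b'" "b \<noteq> c'" "c \<noteq> a'" "c \<noteq> b'" "c \<noteq> c'" "a' \<noteq> b'" "a' \<noteq> c'" "b' \<noteq> c'"
    using dist by simp_all
  have mem: "x \<in> W" "a \<in> W" "b \<in> W" "c \<in> W" "a' \<in> W" "b' \<in> W" "c' \<in> W" unfolding W by auto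
  \<comment> \<open>\<open>b\<close> and \<open>c\<close> are adjacent twins, both joined to
    \<open>x\<close> and \<open>a\<close> only; equal exponents give coefficient 0.\<close>
  have bc: "d b \<noteq> d c"
  proof
    assume "d b = d c"
    moreover have "adj b c" using adjE[of b c] unfolding W by (simp add: E_def)
    moreover have "adj b w \<longleftrightarrow> adj c w" if "w \<in> W - {b, c}" for w
    proof -
      have "adj b x" "adj c x" "adj b a" "adj c a" "\<not> adj b a'" "\<not> adj c a'"
        "\<not> adj b b'" "\<not> adj c b'" "\<not> adj b c'" "\<not> adj c c'"
        by (simp_all add: adjE mem E_def ne ne[symmetric])
      moreover have "w = x \<or> w = a \<or> w = a' \<or> w = b' \<or> w = c'" using that unfolding W by blast
      ultimately show ?thesis by metis
    qed
    ultimately show False using cf_twins[of b W c d] nz unfolding W by blast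
  qed
  have bc': "d b' \<noteq> d c'"
  proof
    assume "d b' = d c'"
    moreover have "adj b' c'" using adjE[of b' c'] unfolding W by (simp add: E_def)
    moreover have "adj b' w \<longleftrightarrow> adj c' w" if "w \<in> W - {b', c'}" for w
    proof -
      have "adj b' x" "adj c' x" "adj b' a'" "adj c' a'" "\<not> adj b' a" "\<not> adj c' a"
        "\<not> adj b' b" "\<not> adj c' b" "\<not> adj b' c" "\<not> adj c' c"
        by (simp_all add: adjE mem E_def ne ne[symmetric])
      moreover have "w = x \<or> w = a' \<or> w = a \<or> w = b \<or> w = c" using that unfolding W by blast
      ultimately show ?thesis by metis
    qed
    ultimately show False using cf_twins[of b' W c' d] nz unfolding W by blast
  qed
  have P: "d b = 1 \<and> d c = 2 \<or> d b = 2 \<and> d c = 1" if "d b + d c = 3" using that lo by linarith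
  have P': "d b' = 1 \<and> d c' = 2 \<or> d b' = 2 \<and> d c' = 1" if "d b' + d c' = 3" using that lo by linarith
  have Q: "d b = 1 \<and> d c = 3 \<or> d b = 3 \<and> d c = 1" if "d b + d c = 4" using that lo bc by linarith
  have Q': "d b' = 1 \<and> d c' = 3 \<or> d b' = 3 \<and> d c' = 1" if "d b' + d c' = 4" using that lo bc' by linarith
  have s3: "3 \<le> d b + d c" "3 \<le> d b' + d c'" using lo bc bc' by linarith+
  consider
      (1) "d x = 3" "d a = 1" "d a' = 1" "d b + d c = 3" "d b' + d c' = 3"
    | (2) "d x = 2" "d a = 2" "d a' = 1" "d b + d c = 3" "d b' + d c' = 3"
    | (3) "d x = 2" "d a = 1" "d a' = 2" "d b + d c = 3" "d b' + d c' = 3"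
    | (4) "d x = 2" "d a = 1" "d a' = 1" "d b + d c = 4" "d b' + d c' = 3"
    | (5) "d x = 2" "d a = 1" "d a' = 1" "d b + d c = 3" "d b' + d c' = 4"
  proof (cases "d x = 2")
    case False
    have "d x = 3" "d a = 1" "d a' = 1" "d b + d c = 3" "d b' + d c' = 3"
      using False sum lo s3 by linarith+
    then show thesis by (rule that(1))
  next
    case x: True
    show thesis
    proof (cases "d a = 1")
      case False
      have "d a = 2" "d a' = 1" "d b + d c = 3" "d b' + d c' = 3" using False x sum lo s3 by linarith+
      then show thesis by (rule that(2)[OF x])
    next
      case a: True
      show thesis
      proof (cases "d a' = 1")
        case False
        have "d a' = 2" "d b + d c = 3" "d b' + d c' = 3" using False x a sum lo s3 by linarith+
        then show thesis by (rule that(3)[OF x a])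
      next
        case a': True
        show thesis
        proof (cases "d b + d c = 3")
          case False
          have "d b + d c = 4" "d b' + d c' = 3" using False x a a' sum lo s3 by linarith+
          then show thesis by (rule that(4)[OF x a a'])
        next
          case True
          have "d b' + d c' = 4" using True x a a' sum by linarith
          then show thesis by (rule that(5)[OF x a a' True])
        qed
      qed
    qed
  qed
  then have "cfl moser_edges [d x, d a, d b, d c, d a', d b', d c'] = 0"
  proof cases
    case 1
    then show ?thesis using P[OF 1(4)] P'[OF 1(5)] moser_cfl by (elim disjE conjE) simp_all
  next
    case 2
    then show ?thesis using P[OF 2(4)] P'[OF 2(5)] moser_cfl by (elim disjE conjE) simp_all
  next
    case 3
    then show ?thesis using P[OF 3(4)] P'[OF 3(5)] moser_cfl by (elim disjE conjE) simp_all
  next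
    case 4
    then show ?thesis using Q[OF 4(4)] P'[OF 4(5)] moser_cfl by (elim disjE conjE) simp_all
  next
    case 5
    then show ?thesis using P[OF 5(4)] Q'[OF 5(5)] moser_cfl by (elim disjE conjE) simp_all
  qed
  then show False using cE nzE by (simp add: l_def)
qed

lemma h_vert_inj: "h_vert x = h_vert y \<Longrightarrow> x = y"
  by (metis h_vert_def zero_neq_one)

lemma D_not_AT:
  assumes "(gr W, h_vert x) \<in> \<D>"
  shows "\<not> AT (demand x 2) W"
  using assms
proof (cases rule: \<D>.cases)
  case (odd_paths y z1 z2 z3 p1 p2 p3)
  then show ?thesis using K4_not_AT[of W x z1 z2 z3 p1 p2 p3] h_vert_inj[of x y] by auto
next
  case (even_paths y z1 z2 z3 p1 p2 p3)
  then show ?thesis using K4_not_AT[of W x z1 z2 z3 p1 p2 p3] h_vert_inj[of x y] by auto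
next
  case (moser y a b c a' b' c')
  then show ?thesis using moser_not_AT[of W x a b c a' b' c'] h_vert_inj[of x y] by auto
qed

section \<open>Lobes\<close>

definition comp :: "'a set \<Rightarrow> 'a set \<Rightarrow> bool" where
  "comp S C \<longleftrightarrow> C \<subseteq> S \<and> conn C \<and> (\<forall>u\<in>C. \<forall>v\<in>S - C. \<not> adj u v)"

lemma comp_exists:
  assumes "finite S" "v \<in> S"
  obtains C where "comp S C" "v \<in> C"
proof -
  let ?M = "{C. conn C \<and> v \<in> C \<and> C \<subseteq> S}"
  have fin: "finite ?M" using assms(1) by (intro finite_subset[of ?M "Pow S"]) auto
  have "{v} \<in> ?M" using assms conn_singleton by auto
  from finite_has_maximal2[OF fin this]
  obtain C where C: "C \<in> ?M" and max: "\<And>C'. C' \<in> ?M \<Longrightarrow> C \<subseteq> C' \<Longrightarrow> C = C'" by auto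
  have "\<not> adj a b" if "a \<in> C" "b \<in> S - C" for a b
  proof
    assume "adj a b"
    then have "insert b C \<in> ?M" using C that conn_insert[of C a b] adj_sym by auto
    then have "C = insert b C" using max[of "insert b C"] by blast
    then show False using that by blast
  qed
  then have "comp S C" using C by (auto simp: comp_def)
  then show thesis using that C by blast
qed

lemma comp_superset:
  assumes "comp S C" "conn C'" "C \<subseteq> C'" "C' \<subseteq> S"
  shows "C' = C"
proof (rule ccontr)
  assume "C' \<noteq> C"
  moreover have "C \<noteq> {}" using assms(1) conn_nonempty by (auto simp: comp_def)
  ultimately obtain u v where "u \<in> C" "v \<in> C' - C" "adj u v" using connE[OF assms(2,3)] by blast
  then show False using assms unfolding comp_def by blast
qed

lemma conn_comp:
  assumes "conn S"
  shows "comp S C \<longleftrightarrow> C = S"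
proof
  assume "comp S C"
  then have "C \<subseteq> S" by (simp add: comp_def)
  then show "C = S" using comp_superset[OF \<open>comp S C\<close> assms] by simp
qed (use assms in \<open>simp add: comp_def\<close>)

lemma conn_remove_closed:
  assumes "conn W" "v \<in> W" "R \<subseteq> W - {v}" "\<And>a b. a \<in> R \<Longrightarrow> b \<in> W - {v} - R \<Longrightarrow> \<not> adj a b"
  shows "conn (W - R)"
proof (rule connI[of v])
  show "v \<in> W - R" using assms by auto
  fix Q assume Q: "Q \<subseteq> W - R" "Q \<noteq> {}" "v \<notin> Q"
  obtain a b where ab: "a \<in> Q" "b \<in> W - Q" "adj a b" using connE[OF assms(1), of Q] Q assms(2) by blast
  have "b \<notin> R" using assms(4)[of b a] ab Q adj_sym by blast
  then show "\<exists>u\<in>Q. \<exists>v\<in>W - R - Q. adj u v" using ab by blast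
qed

text \<open>A minimal connected subset of \<open>C\<close> with two attachments could be added to the block.\<close>

lemma block_attachment:
  assumes "finite W" "blk W B" "C \<subseteq> W - B" "conn C"
    "b1 \<in> B" "b2 \<in> B" "u1 \<in> C" "u2 \<in> C" "adj u1 b1" "adj u2 b2"
  shows "b1 = b2"
proof (rule ccontr)
  assume ne: "b1 \<noteq> b2"
  define two where "two = (\<lambda>K. \<exists>c1\<in>B. \<exists>c2\<in>B. c1 \<noteq> c2 \<and> nb K c1 \<noteq> {} \<and> nb K c2 \<noteq> {})"
  have adj': "adj b1 u1" "adj b2 u2" using assms adj_sym by blast+
  let ?M = "{K. conn K \<and> K \<subseteq> C \<and> two K}"
  have "two C" unfolding two_def nb_def using ne assms adj' by blast
  then have "C \<in> ?M" using assms by auto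
  moreover have "finite ?M" using assms(1,3) by (intro finite_subset[of ?M "Pow W"]) auto
  ultimately obtain K where K: "K \<in> ?M" and min: "\<And>K'. K' \<in> ?M \<Longrightarrow> K' \<subseteq> K \<Longrightarrow> K = K'"
    using finite_has_minimal2[of ?M C] by auto
  have b: "B \<subseteq> W" "nonsep B" using assms(2) by (auto simp: blk_def)
  have cB: "conn B" using b nonsep_conn by blast
  have KB: "K \<inter> B = {}" "K \<subseteq> W" "conn K" using K assms(3) by auto
  obtain c1 c2 k1 k2 where c: "c1 \<in> B" "c2 \<in> B" "c1 \<noteq> c2" and k: "k1 \<in> K" "adj c1 k1" "k2 \<in> K" "adj c2 k2"
    using K unfolding two_def nb_def by blast
  have "nonsep (B \<union> K)"
    unfolding nonsep_def
  proof (intro conjI ballI)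
    show "conn (B \<union> K)" using conn_Un_edge[OF cB KB(3) c(1) k(1,2)] .
    fix v assume v: "v \<in> B \<union> K"
    show "B \<union> K = {v} \<or> conn (B \<union> K - {v})"
    proof (cases "v \<in> B")
      case True
      have cv: "conn (B - {v})" using nonsep_remove[OF b(2) True] c by blast
      obtain c' k' where "c' \<in> B - {v}" "k' \<in> K" "adj c' k'" using c k by blast
      then have "conn ((B - {v}) \<union> K)" using conn_Un_edge[OF cv KB(3)] by blast
      moreover have "(B - {v}) \<union> K = B \<union> K - {v}" using True KB by blast
      ultimately show ?thesis by simp
    next
      case False
      then have vK: "v \<in> K" using v by blast
      have "conn (B \<union> K - {v})"
      proof (rule connI[of c1])
        show "c1 \<in> B \<union> K - {v}" using c False by blast
        fix Q assume Q: "Q \<subseteq> B \<union> K - {v}" "Q \<noteq> {}" "c1 \<notin> Q"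
        show "\<exists>u\<in>Q. \<exists>w\<in>B \<union> K - {v} - Q. adj u w"
        proof (rule ccontr)
          assume no: "\<not> ?thesis"
          have "Q \<inter> B = {}"
          proof (rule ccontr)
            assume "Q \<inter> B \<noteq> {}"
            then obtain p q where "p \<in> Q \<inter> B" "q \<in> B - (Q \<inter> B)" "adj p q"
              using connE[OF cB, of "Q \<inter> B"] c Q by blast
            then show False using no False by blast
          qed
          then have QK: "Q \<subseteq> K - {v}" using Q by blast
          have "\<not> adj p q" if "p \<in> Q" "q \<in> K - {v} - Q" for p q using no that by blast
          then have "conn (K - Q)" using conn_remove_closed[OF KB(3) vK QK] by blast
          moreover have "two (K - Q)"
          proof -
            have "k \<notin> Q" if "adj c k" "c \<in> B" for c k
            proof
              assume kQ: "k \<in> Q"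
              have "c \<in> B \<union> K - {v} - Q" using that False \<open>Q \<inter> B = {}\<close> by blast
              then show False using no kQ adj_sym[OF that(1)] by blast
            qed
            then have "k1 \<in> nb (K - Q) c1" "k2 \<in> nb (K - Q) c2" using c k by (auto simp: nb_def)
            then show ?thesis using c unfolding two_def by blast
          qed
          ultimately have "K = K - Q" using min[of "K - Q"] K by blast
          then show False using QK Q by blast
        qed
      qed
      then show ?thesis ..
    qed
  qed
  then have "B \<union> K = B" using assms(2) b KB unfolding blk_def by blast
  then show False using KB k by blast
qed

text \<open>The components outside \<open>B\<close> are split off one at a time by
  \<open>AT_glue\<close>: each one together with its attaching vertex has no good monomial, so the
  remaining part keeps one.\<close>

lemma AT_glue_lobes:
  assumes "finite W" "B \<subseteq> W" "AT f W" "\<And>v. v \<in> W \<Longrightarrow> 1 \<le> f v"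
    "\<And>C. comp (W - B) C \<Longrightarrow> \<exists>b\<in>B. (\<forall>u\<in>C. \<forall>v\<in>B. adj u v \<longrightarrow> v = b) \<and> \<not> AT1 (insert b C)"
  shows "AT f B"
  using assms
proof (induction "card (W - B)" arbitrary: W rule: less_induct)
  case less
  show ?case
  proof (cases "W = B")
    case True
    then show ?thesis using less by simp
  next
    case False
    then obtain v where "v \<in> W - B" using less.prems by blast
    then obtain C where C: "comp (W - B) C" using comp_exists[of "W - B" v] less.prems(1) by blast
    obtain b where b: "b \<in> B" "\<forall>u\<in>C. \<forall>v\<in>B. adj u v \<longrightarrow> v = b" "\<not> AT1 (insert b C)"
      using less.prems(5)[OF C] by blast
    note c = C[unfolded comp_def]
    have bC: "b \<notin> C" using c b by blast
    have W: "W = (W - C) \<union> insert b C" using c b less.prems(2) by blast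
    have no: "\<not> adj p q" if p: "p \<in> (W - C) - insert b C" and q: "q \<in> insert b C - (W - C)" for p q
    proof -
      have qC: "q \<in> C" using q b less.prems(2) bC by blast
      show ?thesis
      proof (cases "p \<in> B")
        case True
        then show ?thesis using b qC p adj_sym by blast
      next
        case False
        then show ?thesis using c qC p adj_sym by blast
      qed
    qed
    have "AT f (W - C) \<or> AT1 (insert b C)"
    proof (rule AT_glue[of "W - C" "insert b C" b f, OF _ no])
      show "AT f (W - C \<union> insert b C)" using less.prems(3) W by simp
      fix v assume "v \<in> insert b C"
      then show "1 \<le> f v" using less.prems(2,4) b c by blast
    qed auto
    then have AT': "AT f (W - C)" using b by blast
    have sub: "comp (W - B) K" if "comp (W - C - B) K" for K
      using that c unfolding comp_def using adj_sym by blast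
    have "card (W - C - B) < card (W - B)"
    proof (rule psubset_card_mono)
      show "finite (W - B)" using less.prems(1) by simp
      show "W - C - B \<subset> W - B" using c conn_nonempty[of C] by blast
    qed
    moreover have "finite (W - C)" "B \<subseteq> W - C" using less.prems(1,2) c by auto
    ultimately show ?thesis using less.hyps[of "W - C"] AT' less.prems(4,5) sub by blast
  qed
qed

lemma comp_attached:
  assumes "conn W" "B \<subseteq> W" "B \<noteq> {}" "comp (W - B) C"
  obtains u b where "u \<in> C" "b \<in> B" "adj u b"
proof -
  note c = assms(4)[unfolded comp_def]
  have "C \<subseteq> W" "C \<noteq> {}" "C \<noteq> W" using c conn_nonempty[of C] assms(2,3) by auto
  from connE[OF assms(1) this] obtain u v where "u \<in> C" "v \<in> W - C" "adj u v" .
  then show thesis using that c by blast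
qed

lemma block_lobe:
  assumes "finite W" "conn W" "blk W B" "comp (W - B) C" "b \<in> B" "u \<in> C" "adj u b"
  shows "\<forall>u\<in>C. \<forall>v\<in>B. adj u v \<longrightarrow> v = b" "conn (insert b C)"
proof -
  note c = assms(4)[unfolded comp_def]
  show "\<forall>u\<in>C. \<forall>v\<in>B. adj u v \<longrightarrow> v = b"
    using block_attachment[OF assms(1,3), of C] c assms(5-7) by blast
  show "conn (insert b C)" using conn_insert[of C u b] c assms adj_sym by blast
qed

text \<open>The lobe condition on vertex sets: a component outside \<open>B\<close> together with a
  vertex of \<open>B\<close> to which it is attached. For a block this vertex is unique by
  \<open>block_attachment\<close>.\<close>

definition lobes_gal :: "'a set \<Rightarrow> 'a set \<Rightarrow> bool" where
  "lobes_gal W B \<longleftrightarrow> (\<forall>C b. comp (W - B) C \<longrightarrow> b \<in> B \<longrightarrow> (\<exists>u\<in>C. adj u b) \<longrightarrow> gal (insert b C))"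

lemma not_AT_of_lobes:
  assumes "finite W" "conn W" "blk W B" "x \<in> B" "(gr B, h_vert x) \<in> \<D>" "lobes_gal W B"
  shows "\<not> AT (demand x 2) W"
proof
  assume AT: "AT (demand x 2) W"
  have b: "B \<subseteq> W" "B \<noteq> {}" using assms by (auto simp: blk_def)
  have "AT (demand x 2) B"
  proof (rule AT_glue_lobes[OF assms(1) b(1) AT])
    fix v show "1 \<le> demand x 2 v" by (simp add: demand_def)
  next
    fix C assume C: "comp (W - B) C"
    obtain u c where u: "u \<in> C" "c \<in> B" "adj u c" using comp_attached[OF assms(2) b C] .
    have "gal (insert c C)" using assms(6) C u unfolding lobes_gal_def by blast
    moreover have "finite (insert c C)" using C assms(1) finite_subset[of C W] by (auto simp: comp_def)
    ultimately have "\<not> AT1 (insert c C)" using gal_iff by blast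
    then show "\<exists>b\<in>B. (\<forall>u\<in>C. \<forall>v\<in>B. adj u v \<longrightarrow> v = b) \<and> \<not> AT1 (insert b C)"
      using block_lobe(1)[OF assms(1,2,3) C u(2,1,3)] u by blast
  qed
  then show False using D_not_AT[OF assms(5)] by blast
qed

text \<open>A lobe is one side of a separation at its attaching vertex, so its blocks are blocks of
  the whole graph, and none of them is \<open>B\<close>.\<close>

lemma lobes_of_blocks:
  assumes "finite W" "conn W" "blk W B" "B \<noteq> {x}" "x \<in> B"
    "\<And>B'. blk W B' \<Longrightarrow> B' \<noteq> B \<Longrightarrow> clq B' \<or> oddcyc B'"
  shows "lobes_gal W B"
  unfolding lobes_gal_def
proof (intro allI impI)
  fix C b assume C: "comp (W - B) C" and b: "b \<in> B" and "\<exists>u\<in>C. adj u b"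
  then obtain u where u: "u \<in> C" "adj u b" by blast
  note c = C[unfolded comp_def]
  note lobe = block_lobe[OF assms(1-3) C b u]
  have bW: "B \<subseteq> W" using assms(3) by (auto simp: blk_def)
  have bC: "b \<notin> C" using c b by blast
  have cut: "\<not> adj p q" if "p \<in> C" "q \<in> W - {b} - C" for p q
    using that c lobe(1) by blast
  have two: "B \<noteq> {b}" using assms(4,5) by blast
  have s: "sep W b (insert b C) (W - C)"
    unfolding sep_def
  proof (intro conjI ballI)
    show "insert b C \<union> (W - C) = W" using c b bW by blast
    show "insert b C \<inter> (W - C) = {b}" using bC b bW by blast
    show "conn (insert b C)" by (rule lobe(2))
    show "conn (W - C)" using conn_remove_closed[OF assms(2), of b C] cut c b bW bC by blast
    show "insert b C \<noteq> {b}" using u bC by blast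
    show "W - C \<noteq> {b}" using two b bW c by blast
    fix p q assume "p \<in> insert b C - {b}" "q \<in> W - C - {b}"
    then show "\<not> adj p q" using cut by blast
  qed
  have "clq B' \<or> oddcyc B'" if B': "blk (insert b C) B'" for B'
  proof (rule assms(6))
    show "blk W B'" using blk_side[OF s B'] .
    have "B' \<subseteq> insert b C" using B' by (auto simp: blk_def)
    then show "B' \<noteq> B" using two b c by blast
  qed
  then show "gal (insert b C)" using lobe(2) by (simp add: gal_def)
qed

section \<open>The degree of x and the block containing it\<close>

lemma AT2_of_AT1:
  assumes "x \<in> W" "AT1 (W - {x})" "2 \<le> card (nb W x)"
  shows "AT (demand x 2) W"
proof -
  have "AT (demand x 2) (W - {x})" using AT_mono_demand[OF assms(2)] by (auto simp: demand_def)
  moreover have "nb (W - {x}) x = nb W x" using adj_irrefl by (auto simp: nb_def)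
  ultimately have "AT (demand x 2) (insert x (W - {x}))" using assms(3) by (intro AT_insert) (auto simp: demand_def)
  then show ?thesis using assms(1) by (simp add: insert_absorb)
qed

text \<open>A neighbour outside the block would lie in a component attached to the block at x alone,
  and deleting x would cut that component off.\<close>

lemma block_of_noncut:
  assumes "finite W" "conn W" "x \<in> W" "conn (W - {x})" "nb W x \<noteq> {}"
  obtains B where "blk W B" "x \<in> B" "nb W x \<subseteq> B"
proof -
  obtain n0 where n0: "n0 \<in> W" "adj x n0" using assms(5) by (auto simp: nb_def)
  obtain B where B: "blk W B" "{x, n0} \<subseteq> B" using blk_exists[OF assms(1) _ nonsep_pair[OF n0(2)]] assms(3) n0 by blast
  have "nb W x \<subseteq> B"
  proof (rule ccontr)
    assume "\<not> nb W x \<subseteq> B"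
    then obtain n1 where n1: "n1 \<in> W - B" "adj x n1" by (auto simp: nb_def)
    obtain C where C: "comp (W - B) C" "n1 \<in> C" using comp_exists[of "W - B" n1] assms(1) n1 by blast
    note c = C(1)[unfolded comp_def]
    have only: "\<forall>u\<in>C. \<forall>v\<in>B. adj u v \<longrightarrow> v = x"
      using block_lobe(1)[OF assms(1,2) B(1) C(1) _ C(2)] B(2) adj_sym[OF n1(2)] by blast
    have xn: "n0 \<in> W - {x}" using n0 adj_irrefl by auto
    have "C \<subseteq> W - {x}" "C \<noteq> {}" "C \<noteq> W - {x}" using c B(2) conn_nonempty[of C] xn by auto
    from connE[OF assms(4) this] obtain p q where "p \<in> C" "q \<in> W - {x} - C" "adj p q" .
    then show False using c only by blast
  qed
  then show thesis using that B by blast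
qed

text \<open>All edges at x lie in its block \<open>B\<close>, which inherits the failure and is
  classified by \<open>nonsep_not_AT_imp\<close>. Everything else lives in the graph without x,
  which is a Gallai tree. The last clause is phrased for vertex sets \<open>S\<close> that meet
  \<open>B\<close> once, as B-lobes do.\<close>

lemma noncut_forward:
  assumes "finite W" "conn W" "x \<in> W" "conn (W - {x})" "3 \<le> card (nb W x)" "\<not> AT (demand x 2) W"
  shows "\<not> AT1 (W - {x})"
    and "gal W \<or> (\<exists>B. blk W B \<and> x \<in> B \<and> (gr B, h_vert x) \<in> \<D> \<and>
      (\<forall>B'. blk W B' \<and> B' \<noteq> B \<longrightarrow> clq B' \<or> oddcyc B') \<and>
      (\<forall>S. S \<subseteq> W \<longrightarrow> conn S \<longrightarrow> (\<exists>b. S \<inter> B = {b}) \<longrightarrow> S - B \<noteq> {} \<longrightarrow> gal S))"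
proof -
  show nA: "\<not> AT1 (W - {x})" using AT2_of_AT1[OF assms(3)] assms(5,6) by auto
  have galT: "gal (W - {x})" using gal_iff assms(1,4) nA by blast
  have "nb W x \<noteq> {}" using assms(5) by auto
  then obtain B where B: "blk W B" "x \<in> B" "nb W x \<subseteq> B" using block_of_noncut[OF assms(1-4)] by blast
  have b: "B \<subseteq> W" "nonsep B" using B by (auto simp: blk_def)
  have nbB: "nb (B - {x}) x = nb W x" using B b adj_irrefl by (auto simp: nb_def)
  have Bx: "insert x (B - {x}) = B" using B by auto
  have "B - {x} \<noteq> {}" using nbB \<open>nb W x \<noteq> {}\<close> by (auto simp: nb_def)
  then have nB: "\<not> AT1 (B - {x})"
    using AT1_superset[OF assms(4), of "B - {x}"] assms(1) nA b by auto
  have "\<not> AT (demand x 2) B"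
  proof
    assume a: "AT (demand x 2) B"
    have "B \<noteq> {}" "\<And>v. v \<in> W - B \<Longrightarrow> demand x 2 v \<le> 1" using B(2) by (auto simp: demand_def)
    then show False using AT_superset[OF assms(2,1) b(1) _ a] assms(6) by blast
  qed
  then have core: "clq B \<or> (gr B, h_vert x) \<in> \<D>"
    using nonsep_not_AT_imp[of "B - {x}" x] nB b assms(1,5) Bx nbB finite_subset[OF b(1)] by auto
  have other: "clq B' \<or> oddcyc B'" if B': "blk W B'" "B' \<noteq> B" for B'
  proof -
    note b' = B'(1)[unfolded blk_def]
    \<comment> \<open>Otherwise \<open>B'\<close> contains x and a neighbour \<open>y\<close>, both
      in \<open>B\<close>, as well as a vertex in a component \<open>C\<close> outside
      \<open>B\<close>. This component is attached at one vertex \<open>t\<close>, and x or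
      \<open>y\<close> differs from \<open>t\<close>; so deleting \<open>t\<close> would disconnect
      \<open>B'\<close>.\<close>
    have "x \<notin> B'"
    proof
      assume x: "x \<in> B'"
      have "B' \<noteq> {x}"
      proof
        assume "B' = {x}"
        then have "B' \<subseteq> B" using B(2) by blast
        then show False using b' b B'(2) by blast
      qed
      moreover have cB': "conn B'" using b' nonsep_conn[of B'] by blast
      ultimately obtain y where y: "y \<in> B'" "adj x y" using conn_nb_nonempty[of B' x] x unfolding nb_def by blast
      then have yB: "y \<in> B" using B(3) b' by (auto simp: nb_def)
      have "\<not> B' \<subseteq> B" using B'(2) b' b by blast
      then obtain z where z: "z \<in> B'" "z \<notin> B" by blast
      then obtain C where C: "comp (W - B) C" "z \<in> C" using comp_exists[of "W - B" z] assms(1) b' by blast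
      note c = C(1)[unfolded comp_def]
      have xy: "x \<noteq> y" using y adj_irrefl by auto
      obtain t where t: "t \<in> B" "\<forall>u\<in>C. \<forall>v\<in>B. adj u v \<longrightarrow> v = t"
      proof -
        have "B \<noteq> {}" using B(2) by blast
        then obtain u t where "u \<in> C" "t \<in> B" "adj u t" using comp_attached[OF assms(2) b(1) _ C(1)] by blast
        then show ?thesis using that block_lobe(1)[OF assms(1,2) B(1) C(1)] by blast
      qed
      have ct: "conn (B' - {t})"
      proof (cases "t \<in> B'")
        case True
        then show ?thesis using nonsep_remove[of B' t] b' xy x y by blast
      next
        case False
        then show ?thesis using nonsep_conn[of B'] b' by simp
      qed
      have zt: "z \<noteq> t" using z t by blast
      obtain w where w: "w \<in> {x, y}" "w \<noteq> t" using xy by blast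
      have wC: "w \<in> B" "w \<in> B'" using w x y yB B(2) by auto
      have "C \<inter> (B' - {t}) \<subseteq> B' - {t}" "C \<inter> (B' - {t}) \<noteq> {}" "C \<inter> (B' - {t}) \<noteq> B' - {t}"
        using z C zt w wC c by blast+
      from connE[OF ct this]
      obtain p q where "p \<in> C \<inter> (B' - {t})" "q \<in> B' - {t} - (C \<inter> (B' - {t}))" "adj p q" .
      then have "p \<in> C" "q \<in> W - C" "q \<noteq> t" "adj p q" using b' by auto
      then show False using c t by blast
    qed
    then have "blk (W - {x}) B'" using b' unfolding blk_def by blast
    then show ?thesis using galT by (simp add: gal_def)
  qed
  show "gal W \<or> (\<exists>B. blk W B \<and> x \<in> B \<and> (gr B, h_vert x) \<in> \<D> \<and>
      (\<forall>B'. blk W B' \<and> B' \<noteq> B \<longrightarrow> clq B' \<or> oddcyc B') \<and>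
      (\<forall>S. S \<subseteq> W \<longrightarrow> conn S \<longrightarrow> (\<exists>b. S \<inter> B = {b}) \<longrightarrow> S - B \<noteq> {} \<longrightarrow> gal S))"
  proof (cases "clq B")
    case True
    then have "gal W" using other assms(2) unfolding gal_def by blast
    then show ?thesis ..
  next
    case False
    have "gal S" if S: "S \<subseteq> W" "conn S" "S \<inter> B = {b}" "S - B \<noteq> {}" for S b
    proof -
      have bS: "b \<in> S" "b \<in> B" "S \<noteq> {b}" using S by blast+
      obtain y where y: "y \<in> S" "adj b y" "y \<noteq> b" using connE[OF S(2), of "{b}"] bS by blast
      have "b \<noteq> x"
      proof
        assume "b = x"
        then have "y \<in> nb W x" using y S by (auto simp: nb_def)
        then show False using B(3) y S by blast
      qed
      moreover have "x \<in> S \<Longrightarrow> x \<in> S \<inter> B" using B(2) by blast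
      ultimately have "S \<subseteq> W - {x}" using S(1,3) by auto
      then have "\<not> AT1 S" using AT1_superset[OF assms(4)] assms(1) nA conn_nonempty[OF S(2)] by blast
      then show ?thesis using gal_iff[of S] S assms(1) finite_subset by blast
    qed
    then have S: "\<forall>S. S \<subseteq> W \<longrightarrow> conn S \<longrightarrow> (\<exists>b. S \<inter> B = {b}) \<longrightarrow> S - B \<noteq> {} \<longrightarrow> gal S" by blast
    have D: "(gr B, h_vert x) \<in> \<D>" using core False by blast
    have O: "\<forall>B'. blk W B' \<and> B' \<noteq> B \<longrightarrow> clq B' \<or> oddcyc B'" using other by simp
    show ?thesis by (rule disjI2, rule exI[of _ B]) (intro conjI B(1,2) D O S)
  qed
qed

lemma not_AT_deg1: "x \<in> W \<Longrightarrow> card (nb W x) \<le> 1 \<Longrightarrow> \<not> AT (demand x 2) W"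
proof
  assume a: "x \<in> W" "card (nb W x) \<le> 1" "AT (demand x 2) W"
  have "nb (W - {x}) x = nb W x" using adj_irrefl by (auto simp: nb_def)
  then have "demand x 2 x = card (nb (W - {x}) x)"
    using AT_insert_deg(2)[of "demand x 2" x "W - {x}"] a by (auto simp: insert_absorb demand_def)
  then show False using a \<open>nb (W - {x}) x = nb W x\<close> by (simp add: demand_def)
qed

text \<open>The demand 2 equals the degree, so only the leading coefficient in the variable of
  \<open>x\<close> counts.\<close>

lemma AT_deg2:
  assumes "x \<in> W" "card (nb W x) = 2"
  shows "AT (demand x 2) W \<longleftrightarrow> AT1 (W - {x})"
proof
  assume a: "AT (demand x 2) W"
  have nb: "nb (W - {x}) x = nb W x" using adj_irrefl by (auto simp: nb_def)
  have "AT (demand x 2) (W - {x})"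
    using AT_insert_deg(1)[of "demand x 2" x "W - {x}"] a assms nb by (auto simp: insert_absorb demand_def)
  then show "AT1 (W - {x})" by (rule AT_mono_demand) (auto simp: demand_def)
next
  assume "AT1 (W - {x})"
  then show "AT (demand x 2) W" using AT2_of_AT1 assms by simp
qed

end

section \<open>Induced subgraphs as vertex sets\<close>

text \<open>The cut formulation of \<open>conn\<close> for an arbitrary arc set, since subgraphs in
  the maximality conditions need not be induced.\<close>

definition cconn :: "('a \<times> 'a) set \<Rightarrow> 'a set \<Rightarrow> bool" where
  "cconn E W \<longleftrightarrow> W \<noteq> {} \<and>
     (\<forall>S. S \<subseteq> W \<longrightarrow> S \<noteq> {} \<longrightarrow> S \<noteq> W \<longrightarrow> (\<exists>u\<in>S. \<exists>v\<in>W - S. (u, v) \<in> E))"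

definition restr :: "'a pair_pre_digraph \<Rightarrow> 'a set \<Rightarrow> 'a pair_pre_digraph" where
  "restr K S = \<lparr> pverts = S, parcs = {(u, v) \<in> parcs K. u \<in> S \<and> v \<in> S} \<rparr>"

lemma cconn_mono:
  assumes "cconn E W" "E \<inter> W \<times> W \<subseteq> E'"
  shows "cconn E' W"
  unfolding cconn_def
proof (intro conjI allI impI)
  show "W \<noteq> {}" using assms by (simp add: cconn_def)
  fix S assume S: "S \<subseteq> W" "S \<noteq> {}" "S \<noteq> W"
  then obtain u v where "u \<in> S" "v \<in> W - S" "(u, v) \<in> E" using assms(1) unfolding cconn_def by meson
  then show "\<exists>u\<in>S. \<exists>v\<in>W - S. (u, v) \<in> E'" using assms(2) S(1) by blast
qed

lemma cconn_restr:
  assumes "S' \<subseteq> S"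
  shows "cconn (parcs (restr K S)) S' \<longleftrightarrow> cconn (parcs K) S'"
proof
  assume "cconn (parcs (restr K S)) S'"
  then show "cconn (parcs K) S'" by (rule cconn_mono) (auto simp: restr_def)
next
  assume "cconn (parcs K) S'"
  then show "cconn (parcs (restr K S)) S'" by (rule cconn_mono) (use assms in \<open>auto simp: restr_def\<close>)
qed

lemma pair_graph_iff:
  "pair_graph H \<longleftrightarrow> finite (pverts H) \<and> parcs H \<subseteq> pverts H \<times> pverts H \<and>
     (\<forall>u v. (u, v) \<in> parcs H \<longrightarrow> (v, u) \<in> parcs H \<and> u \<noteq> v)"
proof
  assume "pair_graph H"
  then interpret pair_graph H .
  show "finite (pverts H) \<and> parcs H \<subseteq> pverts H \<times> pverts H \<and>
     (\<forall>u v. (u, v) \<in> parcs H \<longrightarrow> (v, u) \<in> parcs H \<and> u \<noteq> v)"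
    using pair_finite_verts in_arcsD1 in_arcsD2 arcs_symmetric no_loops' by auto
next
  assume a: "finite (pverts H) \<and> parcs H \<subseteq> pverts H \<times> pverts H \<and>
     (\<forall>u v. (u, v) \<in> parcs H \<longrightarrow> (v, u) \<in> parcs H \<and> u \<noteq> v)"
  then have "finite (parcs H)" by (meson finite_SigmaI finite_subset)
  then show "pair_graph H" using a by unfold_locales (auto simp: symmetric_def intro: symI)
qed

lemma connected_iff_cconn:
  assumes "pair_graph H"
  shows "connected (with_proj H) \<longleftrightarrow> cconn (parcs H) (pverts H)"
proof -
  interpret pair_graph H by fact
  have "mk_symmetric (with_proj H) = H"
    using assms by (auto simp: mk_symmetric_def pair_graph_iff intro!: pair_pre_digraph.equality)
  then have "connected (with_proj H) \<longleftrightarrow> pverts H \<noteq> {} \<and>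
      (\<forall>u\<in>pverts H. \<forall>v\<in>pverts H. (u, v) \<in> rtrancl_on (pverts H) (parcs H))"
    by (simp add: connected_def strongly_connected_def reachable_def)
  also have "\<dots> \<longleftrightarrow> cconn (parcs H) (pverts H)"
  proof
    assume a: "pverts H \<noteq> {} \<and> (\<forall>u\<in>pverts H. \<forall>v\<in>pverts H. (u, v) \<in> rtrancl_on (pverts H) (parcs H))"
    show "cconn (parcs H) (pverts H)"
      unfolding cconn_def
    proof (intro conjI allI impI)
      fix S assume S: "S \<subseteq> pverts H" "S \<noteq> {}" "S \<noteq> pverts H"
      then obtain s t where st: "s \<in> S" "t \<in> pverts H - S" by blast
      have "(s, t) \<in> rtrancl_on (pverts H) (parcs H)" using a st S by blast
      then have "t \<in> S \<or> (\<exists>u\<in>S. \<exists>v\<in>pverts H - S. (u, v) \<in> parcs H)"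
        by (induction rule: rtrancl_on_induct) (use st in auto)
      then show "\<exists>u\<in>S. \<exists>v\<in>pverts H - S. (u, v) \<in> parcs H" using st by blast
    qed (use a in blast)
  next
    assume c: "cconn (parcs H) (pverts H)"
    show "pverts H \<noteq> {} \<and> (\<forall>u\<in>pverts H. \<forall>v\<in>pverts H. (u, v) \<in> rtrancl_on (pverts H) (parcs H))"
    proof (intro conjI ballI)
      show "pverts H \<noteq> {}" using c by (simp add: cconn_def)
      fix u v assume uv: "u \<in> pverts H" "v \<in> pverts H"
      let ?R = "{w \<in> pverts H. (u, w) \<in> rtrancl_on (pverts H) (parcs H)}"
      have "?R = pverts H"
      proof (rule ccontr)
        assume "?R \<noteq> pverts H"
        moreover have "u \<in> ?R" using uv by simp
        ultimately obtain p q where "p \<in> ?R" "q \<in> pverts H - ?R" "(p, q) \<in> parcs H"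
          using c unfolding cconn_def by (metis (no_types, lifting) empty_iff mem_Collect_eq subsetI)
        then show False by (auto intro: rtrancl_on_into_rtrancl_on)
      qed
      then show "(u, v) \<in> rtrancl_on (pverts H) (parcs H)" using uv by blast
    qed
  qed
  finally show ?thesis .
qed

lemma subgraph_pair_iff:
  assumes "pair_graph H" "pair_graph K"
  shows "subgraph (with_proj H) (with_proj K) \<longleftrightarrow> pverts H \<subseteq> pverts K \<and> parcs H \<subseteq> parcs K"
proof -
  interpret H: pair_graph H by fact
  interpret K: pair_graph K by fact
  show ?thesis using H.wf_digraph K.wf_digraph by (auto simp: subgraph_def compatible_def)
qed

lemma pair_graph_restr: "pair_graph K \<Longrightarrow> S \<subseteq> pverts K \<Longrightarrow> pair_graph (restr K S)"
  unfolding pair_graph_iff restr_def by (auto intro: finite_subset)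

lemma restr_self: "pair_graph K \<Longrightarrow> restr K (pverts K) = K"
  unfolding pair_graph_iff restr_def by (auto intro!: pair_pre_digraph.equality)

text \<open>If the property survives adding all edges between the vertices present, a maximal
  subgraph is induced, so maximality can be tested on vertex sets.\<close>

lemma maximal_subgraph_iff:
  assumes K: "pair_graph K"
    and up: "\<And>H. pair_graph H \<Longrightarrow> pverts H \<subseteq> pverts K \<Longrightarrow> parcs H \<subseteq> parcs K \<Longrightarrow> P H \<Longrightarrow> P (restr K (pverts H))"
  shows "maximal_subgraph K P C \<longleftrightarrow> (\<exists>S\<subseteq>pverts K. C = restr K S \<and> P (restr K S) \<and>
    (\<forall>S'. S \<subseteq> S' \<longrightarrow> S' \<subseteq> pverts K \<longrightarrow> P (restr K S') \<longrightarrow> S' = S))" (is "_ \<longleftrightarrow> ?R")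
proof
  assume m: "maximal_subgraph K P C"
  then have C: "pair_graph C" "P C" by (auto simp: maximal_subgraph_def)
  have CK: "pverts C \<subseteq> pverts K" "parcs C \<subseteq> parcs K"
    using m subgraph_pair_iff[OF C(1) K] by (auto simp: maximal_subgraph_def)
  have max: "H = C" if "pair_graph H" "pverts H \<subseteq> pverts K" "parcs H \<subseteq> parcs K" "P H"
      "pverts C \<subseteq> pverts H" "parcs C \<subseteq> parcs H" for H
  proof -
    have "subgraph (with_proj H) (with_proj K)" "subgraph (with_proj C) (with_proj H)"
      using subgraph_pair_iff[OF that(1) K] subgraph_pair_iff[OF C(1) that(1)] that by auto
    then show ?thesis using m that(1,4) unfolding maximal_subgraph_def by metis
  qed
  have le: "parcs C \<subseteq> parcs (restr K S')" if "pverts C \<subseteq> S'" for S'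
    using that C(1) CK unfolding pair_graph_iff restr_def by auto
  have r: "pverts (restr K S') = S'" "parcs (restr K S') \<subseteq> parcs K" for S' by (auto simp: restr_def)
  have eq: "restr K (pverts C) = C"
    by (rule max) (use pair_graph_restr[OF K] CK up[OF C(1) CK C(2)] le r in auto)
  show ?R
  proof (intro exI conjI allI impI)
    show "pverts C \<subseteq> pverts K" by (rule CK)
    show "C = restr K (pverts C)" using eq by simp
    show "P (restr K (pverts C))" using up[OF C(1) CK C(2)] .
    fix S' assume S': "pverts C \<subseteq> S'" "S' \<subseteq> pverts K" "P (restr K S')"
    then have "restr K S' = C" using max[of "restr K S'"] pair_graph_restr[OF K] le r by auto
    then show "S' = pverts C" using r(1) by metis
  qed
next
  assume ?R
  then obtain S where S: "S \<subseteq> pverts K" "C = restr K S" "P (restr K S)"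
    and max: "\<And>S'. S \<subseteq> S' \<Longrightarrow> S' \<subseteq> pverts K \<Longrightarrow> P (restr K S') \<Longrightarrow> S' = S" by blast
  have C: "pair_graph C" using pair_graph_restr[OF K S(1)] S(2) by simp
  show "maximal_subgraph K P C"
    unfolding maximal_subgraph_def
  proof (intro conjI allI impI)
    show "pair_graph C" by (rule C)
    show "subgraph (with_proj C) (with_proj K)"
      using subgraph_pair_iff[OF C K] S by (auto simp: restr_def)
    show "P C" using S by simp
    fix H assume h: "pair_graph H \<and> subgraph (with_proj H) (with_proj K) \<and> P H \<and> subgraph (with_proj C) (with_proj H)"
    then have H: "pair_graph H" "pverts H \<subseteq> pverts K" "parcs H \<subseteq> parcs K" "P H" "S \<subseteq> pverts H" "parcs C \<subseteq> parcs H"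
      using subgraph_pair_iff[of H K] subgraph_pair_iff[of C H] K C S(2) by (auto simp: restr_def)
    then have pv: "pverts H = S" using max[of "pverts H"] up[of H] by blast
    have "parcs H \<subseteq> parcs C" using H pv unfolding pair_graph_iff S(2) restr_def by auto
    then show "H = C" using H pv S(2) by (auto simp: restr_def intro!: pair_pre_digraph.equality)
  qed
qed

lemma component_iff:
  assumes K: "pair_graph K"
  shows "component K C \<longleftrightarrow> (\<exists>S\<subseteq>pverts K. C = restr K S \<and> cconn (parcs K) S \<and>
    (\<forall>S'. S \<subseteq> S' \<longrightarrow> S' \<subseteq> pverts K \<longrightarrow> cconn (parcs K) S' \<longrightarrow> S' = S))"
proof -
  have eq: "connected (with_proj (restr K S)) \<longleftrightarrow> cconn (parcs K) S" if "S \<subseteq> pverts K" for S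
    using connected_iff_cconn[OF pair_graph_restr[OF K that]] cconn_restr[of S S K]
    by (simp add: restr_def)
  have "component K C \<longleftrightarrow> (\<exists>S\<subseteq>pverts K. C = restr K S \<and> connected (with_proj (restr K S)) \<and>
    (\<forall>S'. S \<subseteq> S' \<longrightarrow> S' \<subseteq> pverts K \<longrightarrow> connected (with_proj (restr K S')) \<longrightarrow> S' = S))"
    unfolding component_def
  proof (rule maximal_subgraph_iff[OF K])
    fix H assume H: "pair_graph H" "pverts H \<subseteq> pverts K" "parcs H \<subseteq> parcs K" "connected (with_proj H)"
    then have "cconn (parcs H) (pverts H)" using connected_iff_cconn by blast
    then have "cconn (parcs K) (pverts H)" using H(3) by (auto elim!: cconn_mono)
    then show "connected (with_proj (restr K (pverts H)))" using eq[OF H(2)] by blast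
  qed
  then show ?thesis by (simp add: eq cong: conj_cong imp_cong)
qed

lemma component_exists:
  assumes K: "pair_graph K" and v: "v \<in> pverts K"
  obtains S where "v \<in> S" "component K (restr K S)"
proof -
  let ?M = "{S. S \<subseteq> pverts K \<and> v \<in> S \<and> cconn (parcs K) S}"
  have "finite (pverts K)" using K by (simp add: pair_graph_iff)
  then have fin: "finite ?M" by (intro finite_subset[of ?M "Pow (pverts K)"]) auto
  have "{v} \<in> ?M" using v by (auto simp: cconn_def)
  from finite_has_maximal2[OF fin this]
  obtain S where S: "S \<in> ?M" and max: "\<And>S'. S' \<in> ?M \<Longrightarrow> S \<subseteq> S' \<Longrightarrow> S = S'" by auto
  have "component K (restr K S)"
    unfolding component_iff[OF K]
  proof (intro exI conjI allI impI)
    fix S' assume "S \<subseteq> S'" "S' \<subseteq> pverts K" "cconn (parcs K) S'"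
    then show "S' = S" using max[of S'] S by blast
  qed (use S in auto)
  then show thesis using that S by blast
qed

lemma finite_components: "pair_graph K \<Longrightarrow> finite {C. component K C}"
proof -
  assume K: "pair_graph K"
  then have "finite (pverts K)" by (simp add: pair_graph_iff)
  moreover have "{C. component K C} \<subseteq> restr K ` Pow (pverts K)" using component_iff[OF K] by auto
  ultimately show ?thesis by (meson finite_Pow_iff finite_imageI finite_subset)
qed

lemma components_connected:
  assumes K: "pair_graph K" and c: "cconn (parcs K) (pverts K)"
  shows "{C. component K C} = {K}"
proof -
  have "component K C \<longleftrightarrow> C = K" for C
  proof
    assume "component K C"
    then obtain S where "S \<subseteq> pverts K" "C = restr K S"
      "\<forall>S'. S \<subseteq> S' \<longrightarrow> S' \<subseteq> pverts K \<longrightarrow> cconn (parcs K) S' \<longrightarrow> S' = S"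
      unfolding component_iff[OF K] by blast
    then show "C = K" using c restr_self[OF K] by (metis subset_refl)
  next
    assume "C = K"
    then show "component K C" unfolding component_iff[OF K]
      using c restr_self[OF K] by (intro exI[of _ "pverts K"]) auto
  qed
  then show ?thesis by auto
qed

text \<open>A connected graph has one component, so the count grows exactly if deletion leaves at
  least two; deleting the only vertex leaves none.\<close>

lemma cutvertex_iff:
  assumes H: "pair_graph H" and c: "cconn (parcs H) (pverts H)"
  shows "cutvertex H v \<longleftrightarrow> v \<in> pverts H \<and> pverts H \<noteq> {v} \<and> \<not> cconn (parcs H) (pverts H - {v})"
proof (cases "v \<in> pverts H")
  case False
  then show ?thesis by (simp add: cutvertex_def)
next
  case True
  let ?K = "del_verts H {v}"
  have Kr: "?K = restr H (pverts H - {v})"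
    using H unfolding pair_graph_iff del_verts_def restr_def by auto
  have K: "pair_graph ?K" unfolding Kr by (rule pair_graph_restr[OF H]) auto
  have one: "card {C. component H C} = 1" using components_connected[OF H c] by simp
  have pK: "pverts ?K = pverts H - {v}" by (simp add: del_verts_def)
  have cK: "cconn (parcs ?K) S \<longleftrightarrow> cconn (parcs H) S" if "S \<subseteq> pverts H - {v}" for S
    unfolding Kr using cconn_restr[OF that] .
  have cv: "cutvertex H v \<longleftrightarrow> 1 < card {C. component ?K C}" using True one by (simp add: cutvertex_def)
  show ?thesis
  proof (cases "pverts H = {v}")
    case True
    have "\<not> component ?K C" for C
      unfolding component_iff[OF K] using pK True by (auto simp: cconn_def)
    then show ?thesis using cv True by simp
  next
    case ne: False
    show ?thesis
    proof (cases "cconn (parcs H) (pverts H - {v})")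
      case True
      then have "cconn (parcs ?K) (pverts ?K)" using cK pK by simp
      then show ?thesis using components_connected[OF K] cv True by simp
    next
      case False
      then have nc: "\<not> cconn (parcs ?K) (pverts ?K)" using cK pK by simp
      obtain a where a: "a \<in> pverts ?K" using ne True pK by auto
      obtain S where S: "a \<in> S" "component ?K (restr ?K S)" using component_exists[OF K a] .
      have pS: "pverts (restr ?K T) = T" for T by (simp add: restr_def)
      have Sc: "S \<subseteq> pverts ?K" "cconn (parcs ?K) S"
        using S(2) pS unfolding component_iff[OF K] by metis+
      then have "S \<noteq> pverts ?K" using nc by auto
      then obtain b where b: "b \<in> pverts ?K" "b \<notin> S" using Sc by blast
      obtain S' where S': "b \<in> S'" "component ?K (restr ?K S')" using component_exists[OF K b(1)] .
      have "restr ?K S \<noteq> restr ?K S'" using b S' pS by metis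
      then have "card {restr ?K S, restr ?K S'} = 2" by simp
      moreover have "{restr ?K S, restr ?K S'} \<subseteq> {C. component ?K C}" using S S' by auto
      ultimately have "2 \<le> card {C. component ?K C}" using card_mono[OF finite_components[OF K]] by metis
      then show ?thesis using cv False ne True \<open>v \<in> pverts H\<close> by simp
    qed
  qed
qed

section \<open>Orientations and Eulerian subgraphs\<close>

lemma orientation_exists:
  assumes "pair_graph G"
  obtains D where "finite D" "D \<union> D\<inverse> = parcs G" "D \<inter> D\<inverse> = {}"
proof -
  have G: "finite (pverts G)" "parcs G \<subseteq> pverts G \<times> pverts G"
     "\<And>u v. (u, v) \<in> parcs G \<Longrightarrow> (v, u) \<in> parcs G \<and> u \<noteq> v"
    using assms unfolding pair_graph_iff by auto
  obtain f :: "'a \<Rightarrow> nat" where f: "inj_on f (pverts G)" using finite_imp_inj_to_nat_seg[OF G(1)] by blast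
  define D where "D = {(u, v) \<in> parcs G. f u < f v}"
  have "finite (parcs G)" using G(1,2) by (meson finite_SigmaI finite_subset)
  then have "finite D" by (rule rev_finite_subset) (auto simp: D_def)
  moreover have "D \<union> D\<inverse> = parcs G"
  proof (rule subset_antisym; rule subrelI)
    fix u v assume "(u, v) \<in> D \<union> D\<inverse>"
    then show "(u, v) \<in> parcs G" using G(3) by (auto simp: D_def)
  next
    fix u v assume uv: "(u, v) \<in> parcs G"
    then have "u \<in> pverts G" "v \<in> pverts G" "u \<noteq> v" "(v, u) \<in> parcs G" using G(2,3) by auto
    then have "f u \<noteq> f v" using inj_onD[OF f, of u v] by auto
    then show "(u, v) \<in> D \<union> D\<inverse>" using uv \<open>(v, u) \<in> parcs G\<close> by (auto simp: D_def)
  qed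
  moreover have "D \<inter> D\<inverse> = {}" by (auto simp: D_def)
  ultimately show thesis by (rule that)
qed

text \<open>\<open>expo\<close> is the outdegree after reversing the arcs of \<open>A\<close>; it
  equals the original outdegree everywhere exactly if \<open>A\<close> is balanced at every vertex.
  So the terms of this coefficient are the spanning Eulerian subgraphs, signed by the parity of
  their size.\<close>

lemma EE_EO_cf:
  assumes "finite (parcs D)" "parcs D \<subseteq> pverts D \<times> pverts D"
  shows "int (EE D) - int (EO D) = cf (parcs D) (\<lambda>v. card {e \<in> parcs D. fst e = v})"
proof -
  let ?A = "parcs D"
  define Eu where "Eu = {A. A \<subseteq> ?A \<and> expo ?A A = (\<lambda>v. card {e \<in> ?A. fst e = v})}"
  have fE: "finite Eu" using assms(1) by (intro finite_subset[of Eu "Pow ?A"]) (auto simp: Eu_def)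
  have eu: "expo ?A A = (\<lambda>v. card {e \<in> ?A. fst e = v}) \<longleftrightarrow>
      (\<forall>v\<in>pverts D. card {e \<in> A. snd e = v} = card {e \<in> A. fst e = v})" if A: "A \<subseteq> ?A" for A
  proof -
    have fA: "finite A" using A assms(1) finite_subset by blast
    have pt: "expo ?A A v = card {e \<in> ?A. fst e = v} \<longleftrightarrow> card {e \<in> A. snd e = v} = card {e \<in> A. fst e = v}" for v
    proof -
      have "{e \<in> ?A. fst e = v} = {e \<in> ?A - A. fst e = v} \<union> {e \<in> A. fst e = v}" using A by auto
      then have "card {e \<in> ?A. fst e = v} = card {e \<in> ?A - A. fst e = v} + card {e \<in> A. fst e = v}"
        using assms(1) fA by (simp add: card_Un_disjoint disjoint_iff)
      then show ?thesis by (simp add: expo_def)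
    qed
    have off: "card {e \<in> A. snd e = v} = card {e \<in> A. fst e = v}" if "v \<notin> pverts D" for v
    proof -
      have "{e \<in> A. snd e = v} = {}" "{e \<in> A. fst e = v} = {}" using A assms(2) that by auto
      then show ?thesis by (simp only:)
    qed
    show ?thesis unfolding fun_eq_iff pt using off by blast
  qed
  have mem: "H \<in> eulerian_subgraphs D \<longleftrightarrow> pverts H = pverts D \<and> parcs H \<in> Eu" for H
  proof -
    have wf: "wf_digraph (with_proj H)" if "pverts H = pverts D" "parcs H \<subseteq> parcs D"
      using that assms(2) by (auto simp: wf_digraph_def)
    have wD: "wf_digraph (with_proj D)" using assms(2) by (auto simp: wf_digraph_def)
    have "spanning (with_proj H) (with_proj D) \<longleftrightarrow> pverts H = pverts D \<and> parcs H \<subseteq> parcs D"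
      using wf wD by (auto simp: spanning_def subgraph_def compatible_def)
    then show ?thesis
      unfolding eulerian_subgraphs_def Eu_def mem_Collect_eq
      using eu[of "parcs H"] by (auto simp: in_degree_def out_degree_def in_arcs_def out_arcs_def)
  qed
  have card_eq: "card {H \<in> eulerian_subgraphs D. Q (card (parcs H))} = card {A \<in> Eu. Q (card A)}" for Q
  proof (rule bij_betw_same_card[of parcs])
    show "bij_betw parcs {H \<in> eulerian_subgraphs D. Q (card (parcs H))} {A \<in> Eu. Q (card A)}"
      by (rule bij_betw_byWitness[where f' = "\<lambda>A. \<lparr>pverts = pverts D, parcs = A\<rparr>"]) (auto simp: mem)
  qed
  have "cf ?A (\<lambda>v. card {e \<in> ?A. fst e = v}) = (\<Sum>A\<in>Eu. (-1) ^ card A)"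
    unfolding cf_def using assms(1)
    by (intro sum.mono_neutral_cong_right) (auto simp: Eu_def)
  also have "\<dots> = (\<Sum>A\<in>{A \<in> Eu. even (card A)}. (-1) ^ card A) + (\<Sum>A\<in>{A \<in> Eu. odd (card A)}. (-1) ^ card A)"
  proof -
    have "Eu = {A \<in> Eu. even (card A)} \<union> {A \<in> Eu. odd (card A)}" by auto
    then show ?thesis using fE by (subst sum.union_disjoint[symmetric]) auto
  qed
  also have "\<dots> = int (card {A \<in> Eu. even (card A)}) - int (card {A \<in> Eu. odd (card A)})"
    by (simp add: sum_negf)
  finally show ?thesis unfolding EE_def EO_def using card_eq[of even] card_eq[of odd] by simp
qed

text \<open>The link between graphs and vertex sets: \<open>D\<close> is some orientation of
  \<open>G\<close>, and \<open>gr W\<close> is the subgraph induced on \<open>W\<close>. The lemmas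
  below turn each graph notion into its set version.\<close>

locale oriented_graph = ograph D for D :: "('a \<times> 'a) set" +
  fixes G :: "'a pair_pre_digraph"
  assumes pgG: "pair_graph G" and DG: "D \<union> D\<inverse> = parcs G"
begin

abbreviation V :: "'a set" where "V \<equiv> pverts G"

lemma adjG: "adj a b \<longleftrightarrow> (a, b) \<in> parcs G"
  unfolding adj_def DG[symmetric] by blast

lemma finV: "finite V" using pgG by (simp add: pair_graph_iff)

lemma adjV: "adj a b \<Longrightarrow> a \<in> V \<and> b \<in> V"
  using pgG unfolding adjG pair_graph_iff by auto

lemma gr_restr: "gr S = restr G S"
  by (auto simp: gr_def restr_def adjG)

lemma gr_V: "gr V = G"
  unfolding gr_restr by (rule restr_self[OF pgG])

lemma pg_gr: "S \<subseteq> V \<Longrightarrow> pair_graph (gr S)"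
  unfolding gr_restr by (rule pair_graph_restr[OF pgG])

lemma restr_gr: "S \<subseteq> W \<Longrightarrow> restr (gr W) S = gr S"
  by (auto simp: gr_def restr_def)

lemma pverts_gr: "pverts (gr S) = S" by (simp add: gr_def)

lemma parcs_gr: "parcs (gr S) = {(a, b). a \<in> S \<and> b \<in> S \<and> adj a b}" by (simp add: gr_def)

lemma del_gr: "del_verts (gr W) X = gr (W - X)"
  by (auto simp: gr_def del_verts_def)

lemma gr_inj: "gr S = gr S' \<longleftrightarrow> S = S'"
  by (metis pverts_gr)

lemma cconn_gr: "cconn (parcs (gr S)) S' \<longleftrightarrow> conn S'" if "S' \<subseteq> S"
proof -
  have e: "adj = (\<lambda>a b. (a, b) \<in> parcs G)" using adjG by blast
  have "conn S' \<longleftrightarrow> cconn (parcs G) S'" unfolding conn_def cconn_def e ..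
  then show ?thesis unfolding gr_restr using cconn_restr[OF that] by blast
qed

lemma connected_gr: "S \<subseteq> V \<Longrightarrow> connected (with_proj (gr S)) \<longleftrightarrow> conn S"
  using connected_iff_cconn[OF pg_gr] cconn_gr[of S S] by (simp add: pverts_gr)

lemma cconn_sub: "cconn E S \<Longrightarrow> E \<subseteq> parcs (gr W) \<Longrightarrow> conn S"
proof -
  assume a: "cconn E S" "E \<subseteq> parcs (gr W)"
  have "cconn (parcs (gr S)) S" using a(1) by (rule cconn_mono) (use a(2) in \<open>auto simp: gr_def\<close>)
  then show ?thesis using cconn_gr by blast
qed

lemma component_gr:
  assumes W: "W \<subseteq> V"
  shows "component (gr W) C \<longleftrightarrow> (\<exists>S. C = gr S \<and> comp W S)"
proof -
  have fW: "finite W" using W finV finite_subset by blast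
  have "component (gr W) C \<longleftrightarrow> (\<exists>S\<subseteq>W. C = gr S \<and> conn S \<and>
    (\<forall>S'. S \<subseteq> S' \<longrightarrow> S' \<subseteq> W \<longrightarrow> conn S' \<longrightarrow> S' = S))"
    unfolding component_iff[OF pg_gr[OF W]] pverts_gr
    by (simp add: restr_gr cconn_gr cong: conj_cong imp_cong)
  also have "\<dots> \<longleftrightarrow> (\<exists>S. C = gr S \<and> comp W S)"
  proof
    assume "\<exists>S\<subseteq>W. C = gr S \<and> conn S \<and> (\<forall>S'. S \<subseteq> S' \<longrightarrow> S' \<subseteq> W \<longrightarrow> conn S' \<longrightarrow> S' = S)"
    then obtain S where S: "S \<subseteq> W" "C = gr S" "conn S"
      and max: "\<And>S'. S \<subseteq> S' \<Longrightarrow> S' \<subseteq> W \<Longrightarrow> conn S' \<Longrightarrow> S' = S" by blast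
    have "\<not> adj u v" if uv: "u \<in> S" "v \<in> W - S" for u v
    proof
      assume "adj u v"
      then have "conn (insert v S)" using conn_insert[OF S(3) uv(1)] adj_sym by blast
      then show False using max[of "insert v S"] S(1) uv by blast
    qed
    then show "\<exists>S. C = gr S \<and> comp W S" using S unfolding comp_def by blast
  next
    assume "\<exists>S. C = gr S \<and> comp W S"
    then obtain S where S: "C = gr S" "comp W S" by blast
    then have "S \<subseteq> W" "conn S" by (auto simp: comp_def)
    then show "\<exists>S\<subseteq>W. C = gr S \<and> conn S \<and> (\<forall>S'. S \<subseteq> S' \<longrightarrow> S' \<subseteq> W \<longrightarrow> conn S' \<longrightarrow> S' = S)"
      using S comp_superset[OF S(2)] by blast
  qed
  finally show ?thesis .
qed

lemma cutvertex_gr: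
  assumes W: "W \<subseteq> V" "conn W"
  shows "cutvertex (gr W) v \<longleftrightarrow> v \<in> W \<and> W \<noteq> {v} \<and> \<not> conn (W - {v})"
  using cutvertex_iff[OF pg_gr[OF W(1)]] W(2) cconn_gr[of _ W] by (simp add: pverts_gr)

lemma block_gr:
  assumes W: "W \<subseteq> V"
  shows "block (gr W) C \<longleftrightarrow> (\<exists>S. C = gr S \<and> blk W S)"
proof -
  let ?P = "\<lambda>B. connected (with_proj B) \<and> (\<forall>v. \<not> cutvertex B v)"
  have eq: "?P (gr S) \<longleftrightarrow> nonsep S" if "S \<subseteq> W" for S
    using connected_gr[of S] cutvertex_gr[of S] W that unfolding nonsep_def by blast
  have "block (gr W) C \<longleftrightarrow> (\<exists>S\<subseteq>W. C = gr S \<and> ?P (gr S) \<and>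
    (\<forall>S'. S \<subseteq> S' \<longrightarrow> S' \<subseteq> W \<longrightarrow> ?P (gr S') \<longrightarrow> S' = S))"
  proof -
    have "block (gr W) C \<longleftrightarrow> (\<exists>S\<subseteq>pverts (gr W). C = restr (gr W) S \<and> ?P (restr (gr W) S) \<and>
      (\<forall>S'. S \<subseteq> S' \<longrightarrow> S' \<subseteq> pverts (gr W) \<longrightarrow> ?P (restr (gr W) S') \<longrightarrow> S' = S))"
      unfolding block_def
    proof (rule maximal_subgraph_iff[OF pg_gr[OF W]])
      fix H assume H: "pair_graph H" "pverts H \<subseteq> pverts (gr W)" "parcs H \<subseteq> parcs (gr W)"
        and P: "connected (with_proj H) \<and> (\<forall>v. \<not> cutvertex H v)"
      have HW: "pverts H \<subseteq> W" using H(2) by (simp add: pverts_gr)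
      have c: "cconn (parcs H) (pverts H)" using P connected_iff_cconn[OF H(1)] by blast
      have "conn (pverts H)" using cconn_sub[OF c H(3)] .
      moreover have "pverts H = {v} \<or> conn (pverts H - {v})" if "v \<in> pverts H" for v
        using P cutvertex_iff[OF H(1) c, of v] that cconn_sub[OF _ H(3)] by blast
      ultimately have "nonsep (pverts H)" by (simp add: nonsep_def)
      then have "?P (gr (pverts H))" using eq[OF HW] by blast
      then show "connected (with_proj (restr (gr W) (pverts H))) \<and> (\<forall>v. \<not> cutvertex (restr (gr W) (pverts H)) v)"
        using restr_gr[OF HW] by simp
    qed
    then show ?thesis unfolding pverts_gr by (simp add: restr_gr cong: conj_cong imp_cong)
  qed
  also have "\<dots> \<longleftrightarrow> (\<exists>S. C = gr S \<and> blk W S)"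
  proof
    assume "\<exists>S\<subseteq>W. C = gr S \<and> ?P (gr S) \<and> (\<forall>S'. S \<subseteq> S' \<longrightarrow> S' \<subseteq> W \<longrightarrow> ?P (gr S') \<longrightarrow> S' = S)"
    then obtain S where S: "S \<subseteq> W" "C = gr S" "?P (gr S)"
      and max: "\<And>S'. S \<subseteq> S' \<Longrightarrow> S' \<subseteq> W \<Longrightarrow> ?P (gr S') \<Longrightarrow> S' = S" by blast
    have "blk W S" unfolding blk_def
    proof (intro conjI allI impI)
      fix B' assume "S \<subseteq> B'" "B' \<subseteq> W" "nonsep B'"
      then show "B' = S" using max[of B'] eq[of B'] by blast
    qed (use S eq in auto)
    then show "\<exists>S. C = gr S \<and> blk W S" using S by blast
  next
    assume "\<exists>S. C = gr S \<and> blk W S"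
    then obtain S where S: "C = gr S" "blk W S" by blast
    show "\<exists>S\<subseteq>W. C = gr S \<and> ?P (gr S) \<and> (\<forall>S'. S \<subseteq> S' \<longrightarrow> S' \<subseteq> W \<longrightarrow> ?P (gr S') \<longrightarrow> S' = S)"
    proof (intro exI conjI allI impI)
      show SW: "S \<subseteq> W" using S by (auto simp: blk_def)
      show "C = gr S" by (rule S(1))
      have "?P (gr S)" using eq[OF SW] S by (auto simp: blk_def)
      then show "connected (with_proj (gr S))" "\<And>v. \<not> cutvertex (gr S) v" by auto
      fix S' assume S': "S \<subseteq> S'" "S' \<subseteq> W" "connected (with_proj (gr S')) \<and> (\<forall>v. \<not> cutvertex (gr S') v)"
      then have "nonsep S'" using eq[of S'] by blast
      then show "S' = S" using S(2) S' unfolding blk_def by blast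
    qed
  qed
  finally show ?thesis .
qed

lemma complete_gr:
  assumes "S \<subseteq> V"
  shows "complete_graph (gr S) \<longleftrightarrow> clq S"
proof -
  have "finite S" using assms finV finite_subset by blast
  then have "complete_graph (gr S) \<longleftrightarrow>
      {(a, b). a \<in> S \<and> b \<in> S \<and> adj a b} = {(u, v). (u, v) \<in> S \<times> S \<and> u \<noteq> v}"
    unfolding complete_graph_def complete_digraph_pair_def pverts_gr parcs_gr by simp
  also have "\<dots> \<longleftrightarrow> clq S"
  proof
    assume e: "{(a, b). a \<in> S \<and> b \<in> S \<and> adj a b} = {(u, v). (u, v) \<in> S \<times> S \<and> u \<noteq> v}"
    show "clq S" unfolding clq_def
    proof (intro ballI impI)
      fix u v assume "u \<in> S" "v \<in> S" "u \<noteq> v"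
      then have "(u, v) \<in> {(a, b). a \<in> S \<and> b \<in> S \<and> adj a b}" unfolding e by simp
      then show "adj u v" by simp
    qed
  next
    assume "clq S"
    then show "{(a, b). a \<in> S \<and> b \<in> S \<and> adj a b} = {(u, v). (u, v) \<in> S \<times> S \<and> u \<noteq> v}"
      using adj_irrefl by (auto simp: clq_def)
  qed
  finally show ?thesis .
qed

lemma cycle_gr: "cycle_graph n (gr S) \<longleftrightarrow> (\<exists>f. cyc n f S)"
proof -
  have "parcs (gr S) = (\<Union>i<n. {(f i, f (Suc i mod n)), (f (Suc i mod n), f i)}) \<longleftrightarrow>
      (\<forall>i<n. \<forall>j<n. adj (f i) (f j) \<longleftrightarrow> j = Suc i mod n \<or> i = Suc j mod n)"
    if n: "3 \<le> n" and f: "bij_betw f {..<n} S" for f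
  proof -
    let ?U = "\<Union>i<n. {(f i, f (Suc i mod n)), (f (Suc i mod n), f i)}"
    have inj: "\<And>i j. i < n \<Longrightarrow> j < n \<Longrightarrow> f i = f j \<longleftrightarrow> i = j" and S: "S = f ` {..<n}"
      using f by (auto simp: bij_betw_def inj_on_def)
    have md: "Suc i mod n < n" for i using n by simp
    have U: "(f i, f j) \<in> ?U \<longleftrightarrow> j = Suc i mod n \<or> i = Suc j mod n" if "i < n" "j < n" for i j
    proof
      assume "(f i, f j) \<in> ?U"
      then obtain k where "k < n" "f i = f k \<and> f j = f (Suc k mod n) \<or> f i = f (Suc k mod n) \<and> f j = f k" by auto
      then have "i = k \<and> j = Suc k mod n \<or> i = Suc k mod n \<and> j = k"
        using inj[OF that(1), of k] inj[OF that(2) md, of k] inj[OF that(1) md, of k] inj[OF that(2), of k] by simp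
      then show "j = Suc i mod n \<or> i = Suc j mod n" by auto
    next
      assume "j = Suc i mod n \<or> i = Suc j mod n"
      then show "(f i, f j) \<in> ?U" using that by auto
    qed
    have PS: "(f i, f j) \<in> parcs (gr S) \<longleftrightarrow> adj (f i) (f j)" if "i < n" "j < n" for i j
      using that S by (auto simp: parcs_gr)
    have US: "?U \<subseteq> S \<times> S" unfolding S using md by auto
    show ?thesis
    proof
      assume e: "parcs (gr S) = ?U"
      show "\<forall>i<n. \<forall>j<n. adj (f i) (f j) \<longleftrightarrow> j = Suc i mod n \<or> i = Suc j mod n"
      proof (intro allI impI)
        fix i j assume ij: "i < n" "j < n"
        show "adj (f i) (f j) \<longleftrightarrow> j = Suc i mod n \<or> i = Suc j mod n"
          using U[OF ij] PS[OF ij, unfolded e] by (simp only:)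
      qed
    next
      assume a: "\<forall>i<n. \<forall>j<n. adj (f i) (f j) \<longleftrightarrow> j = Suc i mod n \<or> i = Suc j mod n"
      show "parcs (gr S) = ?U"
      proof (rule subset_antisym; rule subrelI)
        fix u v assume uv: "(u, v) \<in> parcs (gr S)"
        then obtain i j where ij: "u = f i" "v = f j" "i < n" "j < n" unfolding S parcs_gr by auto
        have "j = Suc i mod n \<or> i = Suc j mod n" using uv PS[OF ij(3,4)] a ij by simp
        then show "(u, v) \<in> ?U" unfolding ij(1,2) U[OF ij(3,4)] .
      next
        fix u v assume uv: "(u, v) \<in> ?U"
        then have "u \<in> S" "v \<in> S" using US by blast+
        then obtain i j where ij: "u = f i" "v = f j" "i < n" "j < n" unfolding S by auto
        have "j = Suc i mod n \<or> i = Suc j mod n" using uv U[OF ij(3,4)] unfolding ij(1,2) by (simp only:)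
        then show "(u, v) \<in> parcs (gr S)" unfolding ij(1,2) PS[OF ij(3,4)] using a ij by simp
      qed
    qed
  qed
  then show ?thesis unfolding cycle_graph_def cyc_def pverts_gr by blast
qed

lemma odd_cycle_gr: "odd_cycle (gr S) \<longleftrightarrow> oddcyc S"
  unfolding odd_cycle_def oddcyc_def cycle_gr by blast

lemma gallai_gr:
  assumes "W \<subseteq> V"
  shows "gallai_tree (gr W) \<longleftrightarrow> gal W"
proof -
  have sub: "S \<subseteq> V" if "blk W S" for S using that assms by (auto simp: blk_def)
  have "(\<forall>B. block (gr W) B \<longrightarrow> complete_graph B \<or> odd_cycle B) \<longleftrightarrow> (\<forall>S. blk W S \<longrightarrow> clq S \<or> oddcyc S)"
    unfolding block_gr[OF assms] using complete_gr[OF sub] odd_cycle_gr by blast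
  then show ?thesis unfolding gallai_tree_def gal_def using pg_gr[OF assms] connected_gr[OF assms] by blast
qed

lemma deg_gr: "x \<in> W \<Longrightarrow> deg (gr W) x = card (nb W x)"
  unfolding deg_def nb_def by (simp add: gr_def)

text \<open>Adding x never changes what is left after deleting x, so maximality puts x into every
  lobe and makes the rest a component.\<close>

lemma x_lobe_gr:
  assumes x: "x \<in> V"
  shows "x_lobe G x A \<longleftrightarrow> (\<exists>C. comp (V - {x}) C \<and> A = gr (insert x C))"
proof -
  let ?P = "\<lambda>A. connected (with_proj (del_verts A {x}))"
  have eq: "?P (gr S) \<longleftrightarrow> conn (S - {x})" if "S \<subseteq> V" for S
    unfolding del_gr using connected_gr[of "S - {x}"] that by blast
  have "x_lobe G x A \<longleftrightarrow> (\<exists>S\<subseteq>V. A = restr G S \<and> ?P (restr G S) \<and>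
    (\<forall>S'. S \<subseteq> S' \<longrightarrow> S' \<subseteq> V \<longrightarrow> ?P (restr G S') \<longrightarrow> S' = S))"
    unfolding x_lobe_def
  proof (rule maximal_subgraph_iff[OF pgG])
    fix H assume H: "pair_graph H" "pverts H \<subseteq> V" "parcs H \<subseteq> parcs G"
      and P: "connected (with_proj (del_verts H {x}))"
    have d: "del_verts H {x} = restr H (pverts H - {x})"
      using H(1) unfolding pair_graph_iff del_verts_def restr_def by auto
    have "pair_graph (del_verts H {x})" unfolding d by (rule pair_graph_restr[OF H(1)]) auto
    then have "cconn (parcs (del_verts H {x})) (pverts H - {x})"
      using P connected_iff_cconn by (fastforce simp: del_verts_def)
    moreover have "parcs (del_verts H {x}) \<subseteq> parcs (gr V)" using H(3) by (auto simp: del_verts_def gr_V)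
    ultimately have "conn (pverts H - {x})" by (rule cconn_sub)
    then show "connected (with_proj (del_verts (restr G (pverts H)) {x}))"
      using eq[OF H(2)] by (simp add: gr_restr)
  qed
  also have "\<dots> \<longleftrightarrow> (\<exists>S\<subseteq>V. A = gr S \<and> conn (S - {x}) \<and>
    (\<forall>S'. S \<subseteq> S' \<longrightarrow> S' \<subseteq> V \<longrightarrow> conn (S' - {x}) \<longrightarrow> S' = S))"
    unfolding gr_restr[symmetric] by (simp add: eq cong: conj_cong imp_cong)
  also have "\<dots> \<longleftrightarrow> (\<exists>C. comp (V - {x}) C \<and> A = gr (insert x C))"
  proof
    assume "\<exists>S\<subseteq>V. A = gr S \<and> conn (S - {x}) \<and> (\<forall>S'. S \<subseteq> S' \<longrightarrow> S' \<subseteq> V \<longrightarrow> conn (S' - {x}) \<longrightarrow> S' = S)"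
    then obtain S where S: "S \<subseteq> V" "A = gr S" "conn (S - {x})"
      and max: "\<And>S'. S \<subseteq> S' \<Longrightarrow> S' \<subseteq> V \<Longrightarrow> conn (S' - {x}) \<Longrightarrow> S' = S" by blast
    have "insert x S = S" by (rule max) (use S x in auto)
    then have Sx: "insert x (S - {x}) = S" by auto
    have "\<not> adj u v" if uv: "u \<in> S - {x}" "v \<in> V - {x} - (S - {x})" for u v
    proof
      assume "adj u v"
      then have "conn (insert v (S - {x}))" using conn_insert[OF S(3) uv(1)] adj_sym by blast
      moreover have "insert v (S - {x}) = insert v S - {x}" using uv by auto
      ultimately have "insert v S = S" using max[of "insert v S"] S uv by auto
      then show False using uv by blast
    qed
    then have "comp (V - {x}) (S - {x})" using S unfolding comp_def by blast
    then show "\<exists>C. comp (V - {x}) C \<and> A = gr (insert x C)" using Sx S(2) by metis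
  next
    assume "\<exists>C. comp (V - {x}) C \<and> A = gr (insert x C)"
    then obtain C where C: "comp (V - {x}) C" "A = gr (insert x C)" by blast
    have Cx: "insert x C - {x} = C" "C \<subseteq> V - {x}" "conn C" using C(1) by (auto simp: comp_def)
    show "\<exists>S\<subseteq>V. A = gr S \<and> conn (S - {x}) \<and> (\<forall>S'. S \<subseteq> S' \<longrightarrow> S' \<subseteq> V \<longrightarrow> conn (S' - {x}) \<longrightarrow> S' = S)"
    proof (intro exI conjI allI impI)
      show "insert x C \<subseteq> V" using Cx x by auto
      show "A = gr (insert x C)" by (rule C(2))
      show "conn (insert x C - {x})" using Cx by simp
      fix S' assume S': "insert x C \<subseteq> S'" "S' \<subseteq> V" "conn (S' - {x})"
      then have "S' - {x} = C" using comp_superset[OF C(1) S'(3)] Cx by blast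
      then show "S' = insert x C" using S' by blast
    qed
  qed
  finally show ?thesis .
qed

lemma B_lobe_grD:
  assumes W: "W \<subseteq> V" "B \<subseteq> W" and L: "B_lobe (gr W) (gr B) L"
  obtains S b where "L = gr S" "S \<subseteq> W" "conn S" "S \<inter> B = {b}" "S - B \<noteq> {}"
proof -
  have l: "pair_graph L" "pverts L \<subseteq> W" "parcs L \<subseteq> parcs (gr W)" "connected (with_proj L)"
    "connected (with_proj (del_verts L B))" "card (pverts L \<inter> B) = 1"
    and max: "\<And>H. pair_graph H \<Longrightarrow> pverts H \<subseteq> W \<Longrightarrow> parcs H \<subseteq> parcs (gr W) \<Longrightarrow> connected (with_proj H) \<Longrightarrow>
      connected (with_proj (del_verts H B)) \<Longrightarrow> card (pverts H \<inter> B) = 1 \<Longrightarrow>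
      pverts L \<subseteq> pverts H \<Longrightarrow> parcs L \<subseteq> parcs H \<Longrightarrow> H = L"
  proof -
    note m = L[unfolded B_lobe_def maximal_subgraph_def pverts_gr]
    show pl: "pair_graph L" using m by blast
    show "pverts L \<subseteq> W" "parcs L \<subseteq> parcs (gr W)"
      using m subgraph_pair_iff[OF pl pg_gr[OF W(1)]] by (auto simp: pverts_gr)
    show "connected (with_proj L)" "connected (with_proj (del_verts L B))" "card (pverts L \<inter> B) = 1" using m by blast+
    fix H assume H: "pair_graph H" "pverts H \<subseteq> W" "parcs H \<subseteq> parcs (gr W)" "connected (with_proj H)"
      "connected (with_proj (del_verts H B))" "card (pverts H \<inter> B) = 1" "pverts L \<subseteq> pverts H" "parcs L \<subseteq> parcs H"
    have "subgraph (with_proj H) (with_proj (gr W))" "subgraph (with_proj L) (with_proj H)"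
      using subgraph_pair_iff[OF H(1) pg_gr[OF W(1)]] subgraph_pair_iff[OF pl H(1)] H by (auto simp: pverts_gr)
    then show "H = L" using m H by blast
  qed
  let ?S = "pverts L"
  have SV: "?S \<subseteq> V" using l W by blast
  have "cconn (parcs L) ?S" using l(4) connected_iff_cconn[OF l(1)] by blast
  then have cS: "conn ?S" using cconn_sub l(3) by blast
  have d: "del_verts L B = restr L (?S - B)"
    using l(1) unfolding pair_graph_iff del_verts_def restr_def by auto
  have pd: "pair_graph (del_verts L B)" unfolding d by (rule pair_graph_restr[OF l(1)]) auto
  then have "cconn (parcs (del_verts L B)) (pverts (del_verts L B))"
    using l(5) connected_iff_cconn by blast
  moreover have "parcs (del_verts L B) \<subseteq> parcs (gr W)" using l(3) by (auto simp: del_verts_def)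
  ultimately have cSB: "conn (?S - B)" using cconn_sub by (fastforce simp: del_verts_def)
  have "gr ?S = L"
  proof (rule max)
    show "pair_graph (gr ?S)" by (rule pg_gr[OF SV])
    show "pverts (gr ?S) \<subseteq> W" "parcs (gr ?S) \<subseteq> parcs (gr W)" using l(2) by (auto simp: gr_def)
    show "connected (with_proj (gr ?S))" using connected_gr[OF SV] cS by blast
    have "?S - B \<subseteq> V" using SV by blast
    then show "connected (with_proj (del_verts (gr ?S) B))" unfolding del_gr using connected_gr cSB by blast
    show "card (pverts (gr ?S) \<inter> B) = 1" using l(6) by (simp add: pverts_gr)
    show "?S \<subseteq> pverts (gr ?S)" by (simp add: pverts_gr)
    show "parcs L \<subseteq> parcs (gr ?S)" using l(1,3) unfolding pair_graph_iff by (auto simp: gr_def)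
  qed
  moreover obtain b where "?S \<inter> B = {b}" using l(6) by (auto simp: card_1_singleton_iff)
  ultimately show thesis using that[of ?S b] l(2) cS conn_nonempty[OF cSB] by simp
qed

lemma B_lobe_grI:
  assumes W: "W \<subseteq> V" "B \<subseteq> W" and C: "comp (W - B) C" and b: "b \<in> B" "u \<in> C" "adj u b"
  shows "B_lobe (gr W) (gr B) (gr (insert b C))"
proof -
  note c = C[unfolded comp_def]
  let ?S = "insert b C"
  have SW: "?S \<subseteq> W" using c b W by blast
  have SB: "?S - B = C" "?S \<inter> B = {b}" using c b by blast+
  have cS: "conn ?S" using conn_insert[of C u b] c b adj_sym by blast
  have pS: "pair_graph (gr ?S)" using pg_gr SW W by blast
  show ?thesis
    unfolding B_lobe_def maximal_subgraph_def pverts_gr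
  proof (intro conjI allI impI)
    show "pair_graph (gr ?S)" by (rule pS)
    show "subgraph (with_proj (gr ?S)) (with_proj (gr W))"
      using subgraph_pair_iff[OF pS pg_gr[OF W(1)]] SW by (auto simp: gr_def)
    show "connected (with_proj (gr ?S))" using connected_gr[of ?S] SW W cS by blast
    have "C \<subseteq> V" using c W by blast
    then show "connected (with_proj (del_verts (gr ?S) B))" unfolding del_gr SB using connected_gr c by blast
    show "card (?S \<inter> B) = 1" unfolding SB by simp
    fix H assume h: "pair_graph H \<and> subgraph (with_proj H) (with_proj (gr W)) \<and>
      (connected (with_proj H) \<and> connected (with_proj (del_verts H B)) \<and> card (pverts H \<inter> B) = 1) \<and>
      subgraph (with_proj (gr ?S)) (with_proj H)"
    then have H: "pair_graph H" by blast
    have sub: "pverts H \<subseteq> W" "parcs H \<subseteq> parcs (gr W)" "?S \<subseteq> pverts H" "parcs (gr ?S) \<subseteq> parcs H"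
      using h subgraph_pair_iff[OF H pg_gr[OF W(1)]] subgraph_pair_iff[OF pS H] by (auto simp: pverts_gr)
    have d: "del_verts H B = restr H (pverts H - B)"
      using H unfolding pair_graph_iff del_verts_def restr_def by auto
    have pd: "pair_graph (del_verts H B)" unfolding d by (rule pair_graph_restr[OF H]) auto
    then have "cconn (parcs (del_verts H B)) (pverts (del_verts H B))"
      using h connected_iff_cconn by blast
    moreover have "parcs (del_verts H B) \<subseteq> parcs (gr W)" using sub(2) by (auto simp: del_verts_def)
    ultimately have "conn (pverts H - B)" using cconn_sub by (fastforce simp: del_verts_def)
    then have HB: "pverts H - B = C"
      using comp_superset[OF C, of "pverts H - B"] sub SB by blast
    obtain b' where b': "pverts H \<inter> B = {b'}" using h by (auto simp: card_1_singleton_iff)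
    moreover have "b \<in> pverts H \<inter> B" using sub(3) b by blast
    ultimately have "b' = b" by simp
    then have pH: "pverts H = ?S" using HB b' by blast
    have "parcs H \<subseteq> parcs (gr ?S)" using H sub(2) pH unfolding pair_graph_iff by (auto simp: gr_def)
    then show "H = gr ?S" using sub(4) pH by (auto simp: pverts_gr intro!: pair_pre_digraph.equality)
  qed
qed

end

section \<open>The classification\<close>

lemma deg_orientation:
  assumes "finite A" "A \<union> A\<inverse> = parcs G" "A \<inter> A\<inverse> = {}"
  shows "deg G v = card {e \<in> A. fst e = v} + card {e \<in> A. snd e = v}"
proof -
  let ?O = "{e \<in> A. fst e = v}" and ?I = "{e \<in> A. snd e = v}"
  have "{u. (v, u) \<in> parcs G} = snd ` ?O \<union> fst ` ?I"
    unfolding assms(2)[symmetric] by force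
  moreover have "snd ` ?O \<inter> fst ` ?I = {}" using assms(3) by auto
  moreover have "card (snd ` ?O) = card ?O" by (rule card_image) (auto simp: inj_on_def)
  moreover have "card (fst ` ?I) = card ?I" by (rule card_image) (auto simp: inj_on_def)
  ultimately show ?thesis unfolding deg_def using assms(1) by (simp add: card_Un_disjoint)
qed

lemma D_not_singleton: "(H, h_vert x) \<in> \<D> \<Longrightarrow> pverts H \<noteq> {x}"
  by (erule \<D>.cases) (auto simp: K4_paths_def moser_spindle_def graph_of_def)

context oriented_graph begin

lemma D_mem: "(a, b) \<in> D \<Longrightarrow> a \<in> V \<and> b \<in> V"
  using adjV[of a b] by (simp add: adj_def)

lemma rs_V: "rs V = D"
  using D_mem by (auto simp: rs_def)

lemma D_antisym: "D \<inter> D\<inverse> = {}"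
  using asym_D by auto

lemma D_wf: "D \<subseteq> V \<times> V"
  using D_mem by auto

text \<open>Outdegree at most degree minus h minus 1 means indegree at least h + 1. The indegrees
  form the complement of the outdegree monomial, so \<open>EE_EO_cf\<close>,
  \<open>cf_complement\<close> and independence of the orientation connect the two sides.\<close>

lemma AT_pair_iff: "AT_pair (G, h_vert x) \<longleftrightarrow> AT (demand x 2) V"
proof
  assume "AT_pair (G, h_vert x)"
  then obtain D' where D': "orientation G D'" "AT_digraph D'"
    and out: "\<forall>v\<in>V. int (out_degree (with_proj D') v) \<le> int (deg G v) - int (h_vert x v) - 1"
    by (auto simp: AT_pair_def)
  let ?A = "parcs D'"
  let ?o = "\<lambda>v. card {e \<in> ?A. fst e = v}" and ?i = "\<lambda>v. card {e \<in> ?A. snd e = v}"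
  have A: "pverts D' = V" "?A \<union> ?A\<inverse> = parcs G" "?A \<inter> ?A\<inverse> = {}" using D' by (auto simp: orientation_def)
  have fG: "finite (parcs G)" unfolding DG[symmetric] using finite_D by simp
  then have fA: "finite ?A" using A(2) by (metis finite_Un)
  have AV: "?A \<subseteq> pverts D' \<times> pverts D'" using A pgG unfolding pair_graph_iff by blast
  have "int (EE D') - int (EO D') \<noteq> 0" using D'(2) by (simp add: AT_digraph_def)
  then have nz: "cf ?A ?o \<noteq> 0" using EE_EO_cf[OF fA AV] by simp
  have "cf ?A (\<lambda>v. ?o v + ?i v - ?o v) = (-1) ^ card ?A * cf ?A ?o"
    by (rule cf_complement[OF fA]) (auto simp: le_fun_def)
  then have "cf ?A ?i \<noteq> 0" using nz by simp
  then have nzD: "cf (rs V) ?i \<noteq> 0"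
    unfolding rs_V using cf_orientation_indep[OF fA finite_D A(3) D_antisym, of ?i] A(2) DG by simp
  have "demand x 2 v \<le> ?i v" if v: "v \<in> V" for v
  proof -
    have "out_degree (with_proj D') v = ?o v" by (simp add: out_degree_def out_arcs_def)
    then have "int (?o v) \<le> int (?o v + ?i v) - int (h_vert x v) - 1"
      using bspec[OF out v] deg_orientation[OF fA A(2,3), of v] by simp
    then show ?thesis by (auto simp: demand_def h_vert_def split: if_splits)
  qed
  moreover have "?i v = 0" if "v \<notin> V" for v
  proof -
    have "{e \<in> ?A. snd e = v} = {}" using AV A(1) that by auto
    then show ?thesis by (simp only: card.empty)
  qed
  ultimately show "AT (demand x 2) V" unfolding AT_def using nzD by (intro exI[of _ ?i] conjI ballI allI impI)
next
  assume "AT (demand x 2) V"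
  then obtain d where d: "\<forall>v\<in>V. demand x 2 v \<le> d v" "\<forall>v. v \<notin> V \<longrightarrow> d v = 0" "cf D d \<noteq> 0"
    unfolding AT_def rs_V by blast
  let ?deg = "\<lambda>v. card {e \<in> D. fst e = v} + card {e \<in> D. snd e = v}"
  have le: "d \<le> ?deg"
  proof -
    obtain A where A: "A \<subseteq> D" "expo D A = d" using d(3) by (rule cf_nonzeroE)
    have "card {e \<in> D - A. fst e = v} \<le> card {e \<in> D. fst e = v}"
      "card {e \<in> A. snd e = v} \<le> card {e \<in> D. snd e = v}" for v
      using finite_D A(1) by (auto intro!: card_mono)
    then show ?thesis unfolding A(2)[symmetric] le_fun_def expo_def by (simp add: add_mono)
  qed
  have nz: "cf D (\<lambda>v. ?deg v - d v) \<noteq> 0" using cf_complement[OF finite_D le] d(3) by simp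
  then obtain A where A: "A \<subseteq> D" "expo D A = (\<lambda>v. ?deg v - d v)" by (rule cf_nonzeroE)
  have fA: "finite A" using A finite_D finite_subset by blast
  \<comment> \<open>Reversing the arcs of the chosen \<open>A\<close> realises the complementary
    exponents as outdegrees.\<close>
  define D' where "D' = \<lparr>pverts = V, parcs = (D - A) \<union> A\<inverse>\<rparr>"
  have or: "parcs D' \<union> (parcs D')\<inverse> = parcs G" "parcs D' \<inter> (parcs D')\<inverse> = {}"
  proof -
    show "parcs D' \<union> (parcs D')\<inverse> = parcs G" unfolding DG[symmetric] D'_def using A(1) by auto
    show "parcs D' \<inter> (parcs D')\<inverse> = {}" unfolding D'_def using A(1) asym_D by auto
  qed
  have fD': "finite (parcs D')" unfolding D'_def using finite_D fA by simp
  have out: "card {e \<in> parcs D'. fst e = v} = expo D A v" for v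
  proof -
    have eq: "{e \<in> parcs D'. fst e = v} = {e \<in> D - A. fst e = v} \<union> prod.swap ` {e \<in> A. snd e = v}"
      unfolding D'_def by force
    have "{e \<in> D - A. fst e = v} \<inter> prod.swap ` {e \<in> A. snd e = v} = {}" using A(1) asym_D by auto
    then have "card {e \<in> parcs D'. fst e = v} = card {e \<in> D - A. fst e = v} + card (prod.swap ` {e \<in> A. snd e = v})"
      unfolding eq using finite_D fA by (simp add: card_Un_disjoint)
    also have "card (prod.swap ` {e \<in> A. snd e = v}) = card {e \<in> A. snd e = v}"
      by (rule card_image) auto
    finally show ?thesis by (simp add: expo_def)
  qed
  have "\<bar>cf (parcs D') (\<lambda>v. ?deg v - d v)\<bar> = \<bar>cf D (\<lambda>v. ?deg v - d v)\<bar>"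
    by (rule cf_orientation_indep[OF fD' finite_D or(2) D_antisym]) (use or(1) DG in simp)
  then have "cf (parcs D') (\<lambda>v. card {e \<in> parcs D'. fst e = v}) \<noteq> 0"
    using nz unfolding out A(2) by simp
  moreover have "parcs D' \<subseteq> pverts D' \<times> pverts D'" using D_wf A(1) by (auto simp: D'_def)
  ultimately have "AT_digraph D'" using EE_EO_cf[OF fD'] by (auto simp: AT_digraph_def)
  moreover have "orientation G D'" using or by (simp add: orientation_def D'_def)
  moreover have "int (out_degree (with_proj D') v) \<le> int (deg G v) - int (h_vert x v) - 1" if v: "v \<in> V" for v
  proof -
    have "out_degree (with_proj D') v = ?deg v - d v"
      using out[of v] A(2) by (simp add: out_degree_def out_arcs_def)
    moreover have "deg G v = ?deg v" by (rule deg_orientation[OF finite_D DG D_antisym])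
    moreover have "d v \<le> ?deg v" using le by (simp add: le_fun_def)
    moreover have "int (h_vert x v) + 1 \<le> int (d v)" using d(1) v by (auto simp: demand_def h_vert_def split: if_splits)
    ultimately show ?thesis by linarith
  qed
  ultimately show "AT_pair (G, h_vert x)" unfolding AT_pair_def by auto
qed

lemma not_AT_of_gal:
  assumes "gal W" "finite W"
  shows "\<not> AT (demand x 2) W"
proof
  assume "AT (demand x 2) W"
  then have "AT1 W" by (rule AT_mono_demand) (simp add: demand_def)
  then show False using assms gal_iff by blast
qed

lemma lobe_conn:
  assumes "conn V" "x \<in> V" "comp (V - {x}) C"
  shows "conn (insert x C)" "insert x C \<subseteq> V" "finite (insert x C)"
proof -
  have "{x} \<subseteq> V" "{x} \<noteq> {}" using assms(2) by auto
  from comp_attached[OF assms(1) this assms(3)] obtain u b where "u \<in> C" "b \<in> {x}" "adj u b" .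
  then show "conn (insert x C)" using conn_insert[of C u x] assms(3) adj_sym by (auto simp: comp_def)
  show "insert x C \<subseteq> V" using assms(2,3) by (auto simp: comp_def)
  then show "finite (insert x C)" by (rule finite_subset[OF _ finV])
qed

text \<open>The other lobes are Gallai trees glued on at x, so they can be split off without losing
  the demand 2 at x.\<close>

lemma lobe_reduce:
  assumes "conn V" "x \<in> V" "comp (V - {x}) C"
    and gal: "\<And>C'. comp (V - {x}) C' \<Longrightarrow> C' \<noteq> C \<Longrightarrow> gal (insert x C')"
    and AT: "AT (demand x 2) V"
  shows "AT (demand x 2) (insert x C)"
proof (rule AT_glue_lobes[OF finV lobe_conn(2)[OF assms(1-3)] AT])
  fix v show "1 \<le> demand x 2 v" by (simp add: demand_def)
next
  note c = assms(3)[unfolded comp_def]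
  fix K assume K: "comp (V - insert x C) K"
  note k = K[unfolded comp_def]
  have "comp (V - {x}) K" unfolding comp_def
  proof (intro conjI ballI)
    show "K \<subseteq> V - {x}" "conn K" using k by auto
    fix u v assume uv: "u \<in> K" "v \<in> V - {x} - K"
    show "\<not> adj u v"
    proof (cases "v \<in> C")
      case True
      then show ?thesis using c k uv adj_sym by blast
    next
      case False
      then show ?thesis using k uv by blast
    qed
  qed
  moreover have "K \<noteq> C" using k conn_nonempty[of K] by blast
  ultimately have "gal (insert x K)" using gal by blast
  moreover have "finite (insert x K)" using k finV finite_subset[of K V] by auto
  ultimately have "\<not> AT1 (insert x K)" using gal_iff by blast
  moreover have "v = x" if "u \<in> K" "v \<in> insert x C" "adj u v" for u v
  proof (rule ccontr)
    assume "v \<noteq> x"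
    then show False using c k that adj_sym by blast
  qed
  ultimately show "\<exists>b\<in>insert x C. (\<forall>u\<in>K. \<forall>v\<in>insert x C. adj u v \<longrightarrow> v = b) \<and> \<not> AT1 (insert b K)"
    by blast
qed

lemma gal_of_lobes:
  assumes "conn V" "x \<in> V" "\<And>C. comp (V - {x}) C \<Longrightarrow> gal (insert x C)"
  shows "gal V"
proof -
  have "\<not> AT1 V"
  proof
    assume AT: "AT1 V"
    have "AT1 {x}"
    proof (rule AT_glue_lobes[OF finV _ AT])
      show "{x} \<subseteq> V" using assms(2) by simp
      fix C assume C: "comp (V - {x}) C"
      have "\<not> AT1 (insert x C)" using assms(3)[OF C] gal_iff lobe_conn(3)[OF assms(1,2) C] by blast
      then show "\<exists>b\<in>{x}. (\<forall>u\<in>C. \<forall>v\<in>{x}. adj u v \<longrightarrow> v = b) \<and> \<not> AT1 (insert b C)" by blast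
    qed simp
    then show False using not_AT1_singleton by blast
  qed
  then show ?thesis using gal_iff[OF finV] assms(1) by blast
qed

text \<open>Each of the two lobes has a monomial with exponent at least 1 at x; multiplied, they
  give 2. This is why at most one lobe is exceptional.\<close>

lemma two_bad_lobes:
  assumes "conn V" "x \<in> V" "comp (V - {x}) C" "comp (V - {x}) C'" "C \<noteq> C'"
    "\<not> gal (insert x C)" "\<not> gal (insert x C')"
  shows "AT (demand x 2) V"
proof -
  note c = assms(3)[unfolded comp_def] and c' = assms(4)[unfolded comp_def]
  note l = lobe_conn[OF assms(1,2,3)] and l' = lobe_conn[OF assms(1,2,4)]
  have disj: "C \<inter> C' = {}"
  proof (rule ccontr)
    assume "C \<inter> C' \<noteq> {}"
    then have "conn (C \<union> C')" using conn_Un c c' by blast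
    then have "C \<union> C' = C" "C \<union> C' = C'"
      using comp_superset[OF assms(3), of "C \<union> C'"] comp_superset[OF assms(4), of "C \<union> C'"] c c' by blast+
    then show False using assms(5) by blast
  qed
  have A: "AT1 (insert x C)" "AT1 (insert x C')"
    using assms(6,7) gal_iff l l' by blast+
  have no: "\<not> adj p q" if "p \<in> insert x C - insert x C'" "q \<in> insert x C' - insert x C" for p q
  proof -
    have "p \<in> C" "q \<in> V - {x} - C" using that c c' disj by blast+
    then show ?thesis using c by blast
  qed
  have "AT (demand x 2) (insert x C \<union> insert x C')"
  proof (rule AT_product[OF l(3) l'(3) _ no A])
    show "insert x C \<inter> insert x C' \<subseteq> {x}" using disj by blast
  qed (auto simp: demand_def)
  moreover have "insert x C \<union> insert x C' \<subseteq> V" using l l' by blast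
  ultimately show ?thesis
    using AT_superset[OF assms(1) finV, of "insert x C \<union> insert x C'" "demand x 2"] by (auto simp: demand_def)
qed

text \<open>The degree of x decides: 1, 2, or at least 3. The statement serves both the whole graph
  with x not a cutvertex and the exceptional lobe, so its last alternative records the other blocks
  as well as the lobes.\<close>

lemma lobe_cases:
  assumes "finite W" "conn W" "x \<in> W" "W \<noteq> {x}" "conn (W - {x})" "W \<subseteq> V" "\<not> AT (demand x 2) W"
  shows "gallai_tree (gr W) \<or> deg (gr W) x = 1 \<or> (deg (gr W) x = 2 \<and> gallai_tree (gr (W - {x})))
    \<or> (\<exists>B. block (gr W) B \<and> x \<in> pverts B \<and> (B, h_vert x) \<in> \<D> \<and>
         (\<forall>B'. block (gr W) B' \<and> B' \<noteq> B \<longrightarrow> complete_graph B' \<or> odd_cycle B') \<and>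
         (\<forall>L. B_lobe (gr W) B L \<longrightarrow> gallai_tree L))"
proof -
  have "nb W x \<noteq> {}" using conn_nb_nonempty assms by blast
  then have "1 \<le> card (nb W x)" using finite_nb by (simp add: card_gt_0_iff Suc_leI)
  then consider "card (nb W x) = 1" | "card (nb W x) = 2" | "3 \<le> card (nb W x)" by linarith
  then show ?thesis
  proof cases
    case 1
    then show ?thesis using deg_gr[OF assms(3)] by simp
  next
    case 2
    then have "\<not> AT1 (W - {x})" using AT_deg2[OF assms(3) 2] assms(7) by blast
    then have "gal (W - {x})" using gal_iff assms(1,5) by blast
    moreover have "W - {x} \<subseteq> V" using assms(6) by blast
    ultimately show ?thesis using 2 deg_gr[OF assms(3)] gallai_gr by simp
  next
    case 3
    show ?thesis
    proof (cases "gal W")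
      case True
      then show ?thesis using gallai_gr[OF assms(6)] by blast
    next
      case False
      then obtain B where B: "blk W B" "x \<in> B" "(gr B, h_vert x) \<in> \<D>"
        and other: "\<forall>B'. blk W B' \<and> B' \<noteq> B \<longrightarrow> clq B' \<or> oddcyc B'"
        and lob: "\<forall>S. S \<subseteq> W \<longrightarrow> conn S \<longrightarrow> (\<exists>b. S \<inter> B = {b}) \<longrightarrow> S - B \<noteq> {} \<longrightarrow> gal S"
        using noncut_forward(2)[OF assms(1,2,3,5) 3 assms(7)] by blast
      have BW: "B \<subseteq> W" using B by (auto simp: blk_def)
      have "block (gr W) (gr B)" using block_gr[OF assms(6)] B by blast
      moreover have "complete_graph B' \<or> odd_cycle B'" if B': "block (gr W) B'" "B' \<noteq> gr B" for B'
      proof -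
        obtain S where S: "B' = gr S" "blk W S" using B'(1) block_gr[OF assms(6)] by blast
        then have "clq S \<or> oddcyc S" using other B'(2) gr_inj by blast
        moreover have "S \<subseteq> V" using S(2) assms(6) by (auto simp: blk_def)
        ultimately show ?thesis using S complete_gr odd_cycle_gr by blast
      qed
      moreover have "gallai_tree L" if L: "B_lobe (gr W) (gr B) L" for L
      proof -
        obtain S b where S: "L = gr S" "S \<subseteq> W" "conn S" "S \<inter> B = {b}" "S - B \<noteq> {}"
          using B_lobe_grD[OF assms(6) BW L] .
        then have "gal S" using lob by blast
        then show ?thesis using gallai_gr[of S] S assms(6) by blast
      qed
      ultimately show ?thesis using B by (intro disjI2 exI[of _ "gr B"]) (simp add: pverts_gr)
    qed
  qed
qed

lemma not_AT_pair_iff: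
  assumes cV: "conn V" and x: "x \<in> V"
  shows "\<not> AT_pair (G, h_vert x) \<longleftrightarrow>
      gallai_tree G
    \<or> deg G x = 1
    \<or> (deg G x = 2 \<and> (\<exists>C. component (del_verts G {x}) C \<and> gallai_tree C))
    \<or> (\<not> cutvertex G x \<and>
        (\<exists>B. block G B \<and> x \<in> pverts B \<and> (B, h_vert x) \<in> \<D> \<and>
          (\<forall>B'. block G B' \<and> B' \<noteq> B \<longrightarrow> complete_graph B' \<or> odd_cycle B')))
    \<or> (cutvertex G x \<and>
        (\<exists>A. x_lobe G x A \<and> (\<forall>A'. x_lobe G x A' \<and> A' \<noteq> A \<longrightarrow> gallai_tree A') \<and>
          (deg A x = 1
           \<or> (deg A x = 2 \<and> gallai_tree (del_verts A {x}))
           \<or> (\<exists>B. block A B \<and> x \<in> pverts B \<and> (B, h_vert x) \<in> \<D> \<and>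
                (\<forall>L. B_lobe A B L \<longrightarrow> gallai_tree L)))))"
    (is "_ \<longleftrightarrow> ?C1 \<or> ?C2 \<or> ?C3 \<or> ?C4 \<or> ?C5")
proof -
  have gV: "gallai_tree G \<longleftrightarrow> gal V" using gallai_gr[of V] gr_V by simp
  have dV: "deg G x = card (nb V x)" using deg_gr[OF x] gr_V by simp
  have cut: "cutvertex G x \<longleftrightarrow> V \<noteq> {x} \<and> \<not> conn (V - {x})"
    using cutvertex_gr[of V x] cV x gr_V by simp
  have delV: "del_verts G {x} = gr (V - {x})" using del_gr[of V "{x}"] gr_V by simp
  have cmp: "component (del_verts G {x}) C \<longleftrightarrow> (\<exists>S. C = gr S \<and> comp (V - {x}) S)" for C
    unfolding delV by (rule component_gr) blast
  have blkV: "block G B \<longleftrightarrow> (\<exists>S. B = gr S \<and> blk V S)" for B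
    using block_gr[of V] gr_V by simp
  have lobe: "x_lobe G x A \<longleftrightarrow> (\<exists>C. comp (V - {x}) C \<and> A = gr (insert x C))" for A
    by (rule x_lobe_gr[OF x])
  have delC: "insert x C - {x} = C" if "comp (V - {x}) C" for C using that by (auto simp: comp_def)
  show ?thesis
    unfolding AT_pair_iff
  proof
    assume nA: "\<not> AT (demand x 2) V"
    show "?C1 \<or> ?C2 \<or> ?C3 \<or> ?C4 \<or> ?C5"
    proof (cases "V = {x}")
      case True
      have "gal V" using gal_iff[OF finV] cV not_AT1_singleton True by simp
      then show ?thesis using gV by blast
    next
      case ne: False
      show ?thesis
      proof (cases "conn (V - {x})")
        case True
        then have nc: "\<not> cutvertex G x" using cut by blast
        have "component (del_verts G {x}) (gr (V - {x}))" using cmp conn_comp[OF True] by blast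
        then show ?thesis
          using lobe_cases[OF finV cV x ne True subset_refl nA] nc unfolding gr_V by blast
      next
        case False
        then have c: "cutvertex G x" using cut ne by blast
        show ?thesis
        proof (cases "\<forall>C. comp (V - {x}) C \<longrightarrow> gal (insert x C)")
          case True
          then show ?thesis using gal_of_lobes[OF cV x] gV by blast
        next
          case False
          \<comment> \<open>The exceptional lobe is a lobe that is not a Gallai tree; a second one
            is excluded by \<open>two_bad_lobes\<close>.\<close>
          then obtain C where C: "comp (V - {x}) C" "\<not> gal (insert x C)" by blast
          note l = lobe_conn[OF cV x C(1)]
          have others: "gallai_tree A'" if A': "x_lobe G x A'" "A' \<noteq> gr (insert x C)" for A'
          proof -
            obtain C' where C': "comp (V - {x}) C'" "A' = gr (insert x C')" using A' lobe by blast
            then have "C' \<noteq> C" using A' by blast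
            then have "gal (insert x C')" using two_bad_lobes[OF cV x C(1) C'(1)] C(2) nA by blast
            then show ?thesis using gallai_gr[OF lobe_conn(2)[OF cV x C'(1)]] C'(2) by blast
          qed
          have ng: "\<not> gallai_tree (gr (insert x C))" using gallai_gr[OF l(2)] C by blast
          have nA': "\<not> AT (demand x 2) (insert x C)"
            using AT_superset[OF cV finV l(2), of "demand x 2"] nA by (auto simp: demand_def)
          have "conn C" "C \<noteq> {}" "x \<notin> C" using C conn_nonempty by (auto simp: comp_def)
          then have "insert x C \<noteq> {x}" "conn (insert x C - {x})" using delC[OF C(1)] by auto
          from lobe_cases[OF l(3,1) insertI1 this l(2) nA']
          have "deg (gr (insert x C)) x = 1 \<or> (deg (gr (insert x C)) x = 2 \<and> gallai_tree (del_verts (gr (insert x C)) {x}))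
           \<or> (\<exists>B. block (gr (insert x C)) B \<and> x \<in> pverts B \<and> (B, h_vert x) \<in> \<D> \<and>
                (\<forall>L. B_lobe (gr (insert x C)) B L \<longrightarrow> gallai_tree L))"
            unfolding del_gr using ng by blast
          moreover have "x_lobe G x (gr (insert x C))" using lobe C by blast
          ultimately have "?C5" using c others by blast
          then show ?thesis by blast
        qed
      qed
    qed
  next
    assume "?C1 \<or> ?C2 \<or> ?C3 \<or> ?C4 \<or> ?C5"
    then consider ?C1 | ?C2 | ?C3 | ?C4 | ?C5 by blast
    then show "\<not> AT (demand x 2) V"
    proof cases
      case 1
      then show ?thesis using gV not_AT_of_gal finV by blast
    next
      case 2
      then show ?thesis using not_AT_deg1[OF x] dV by simp
    next
      case 3
      then obtain S where S: "comp (V - {x}) S" "gallai_tree (gr S)" and two: "card (nb V x) = 2" using cmp dV by auto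
      note s = S(1)[unfolded comp_def]
      have SV: "S \<subseteq> V" using s by blast
      then have "\<not> AT1 S" using S(2) gallai_gr gal_iff finV finite_subset by blast
      moreover have "AT1 S" if "AT1 (V - {x})"
      proof (rule AT_disjoint[of "V - {x} - S"])
        show "(V - {x} - S) \<inter> S = {}" by blast
        have "V - {x} - S \<union> S = V - {x}" using s by blast
        then show "AT1 (V - {x} - S \<union> S)" using that by simp
        fix u v assume "u \<in> V - {x} - S" "v \<in> S"
        then show "\<not> adj u v" using s adj_sym by blast
      qed
      ultimately show ?thesis using AT_deg2[OF x two] by blast
    next
      case 4
      then obtain B where B: "blk V B" "x \<in> B" "(gr B, h_vert x) \<in> \<D>"
        and other: "\<And>B'. block G B' \<Longrightarrow> B' \<noteq> gr B \<Longrightarrow> complete_graph B' \<or> odd_cycle B'"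
        using blkV pverts_gr by auto
      have "lobes_gal V B"
      proof (rule lobes_of_blocks[OF finV cV B(1) _ B(2)])
        show "B \<noteq> {x}" using D_not_singleton[OF B(3)] by (simp add: pverts_gr)
        fix B' assume B': "blk V B'" "B' \<noteq> B"
        have "block G (gr B')" "gr B' \<noteq> gr B" using B' blkV gr_inj by auto
        then have "complete_graph (gr B') \<or> odd_cycle (gr B')" using other by blast
        moreover have "B' \<subseteq> V" using B' by (auto simp: blk_def)
        ultimately show "clq B' \<or> oddcyc B'" using complete_gr odd_cycle_gr by blast
      qed
      then show ?thesis using not_AT_of_lobes[OF finV cV B] by blast
    next
      case 5
      then obtain A0 where A0: "x_lobe G x A0"
        and others0: "\<forall>A'. x_lobe G x A' \<and> A' \<noteq> A0 \<longrightarrow> gallai_tree A'"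
        and cases0: "deg A0 x = 1 \<or> (deg A0 x = 2 \<and> gallai_tree (del_verts A0 {x}))
           \<or> (\<exists>B. block A0 B \<and> x \<in> pverts B \<and> (B, h_vert x) \<in> \<D> \<and>
                (\<forall>L. B_lobe A0 B L \<longrightarrow> gallai_tree L))" by blast
      obtain C where C: "comp (V - {x}) C" and A0C: "A0 = gr (insert x C)" using A0 lobe by blast
      have others: "\<And>A'. x_lobe G x A' \<Longrightarrow> A' \<noteq> gr (insert x C) \<Longrightarrow> gallai_tree A'"
        using others0 A0C by blast
      have A: "deg (gr (insert x C)) x = 1
           \<or> (deg (gr (insert x C)) x = 2 \<and> gallai_tree (del_verts (gr (insert x C)) {x}))
           \<or> (\<exists>B. block (gr (insert x C)) B \<and> x \<in> pverts B \<and> (B, h_vert x) \<in> \<D> \<and>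
                (\<forall>L. B_lobe (gr (insert x C)) B L \<longrightarrow> gallai_tree L))"
        using cases0 unfolding A0C .
      let ?W = "insert x C"
      note l = lobe_conn[OF cV x C]
      have "gal (insert x C')" if C': "comp (V - {x}) C'" "C' \<noteq> C" for C'
      proof -
        have "insert x C' \<noteq> insert x C" using C' delC[OF C'(1)] delC[OF C] by metis
        then have "gr (insert x C') \<noteq> gr (insert x C)" by (simp add: gr_inj)
        moreover have "x_lobe G x (gr (insert x C'))" using C'(1) lobe by blast
        ultimately have "gallai_tree (gr (insert x C'))" using others by blast
        then show ?thesis using gallai_gr[OF lobe_conn(2)[OF cV x C'(1)]] by blast
      qed
      then have red: "AT (demand x 2) V \<Longrightarrow> AT (demand x 2) ?W" using lobe_reduce[OF cV x C] by blast
      have d: "deg (gr ?W) x = card (nb ?W x)" by (rule deg_gr) simp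
      have "\<not> AT (demand x 2) ?W"
        using A
      proof (elim disjE conjE exE)
        assume "deg (gr ?W) x = 1"
        then show ?thesis using not_AT_deg1[of x ?W] d by simp
      next
        assume "deg (gr ?W) x = 2" and g: "gallai_tree (del_verts (gr ?W) {x})"
        then have two: "card (nb ?W x) = 2" using d by simp
        have "?W - {x} \<subseteq> V" using l by blast
        then have "gal (?W - {x})" using g gallai_gr unfolding del_gr by blast
        then have "\<not> AT1 (?W - {x})" using gal_iff[of "?W - {x}"] l(3) by simp
        then show ?thesis using AT_deg2[OF insertI1 two] by blast
      next
        fix B assume b: "block (gr ?W) B" "x \<in> pverts B" "(B, h_vert x) \<in> \<D>"
          and lob: "\<forall>L. B_lobe (gr ?W) B L \<longrightarrow> gallai_tree L"
        obtain S where S: "B = gr S" "blk ?W S" using b(1) block_gr[OF l(2)] by blast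
        have SW: "S \<subseteq> ?W" using S by (auto simp: blk_def)
        have "lobes_gal ?W S" unfolding lobes_gal_def
        proof (intro allI impI)
          fix K b assume K: "comp (?W - S) K" and bS: "b \<in> S" and "\<exists>u\<in>K. adj u b"
          then obtain u where u: "u \<in> K" "adj u b" by blast
          have "gallai_tree (gr (insert b K))" using lob B_lobe_grI[OF l(2) SW K bS u] S(1) by blast
          moreover have "insert b K \<subseteq> V" using K bS SW l(2) by (auto simp: comp_def)
          ultimately show "gal (insert b K)" using gallai_gr by blast
        qed
        moreover have "x \<in> S" "(gr S, h_vert x) \<in> \<D>" using b S by (auto simp: pverts_gr)
        ultimately show ?thesis using not_AT_of_lobes[OF l(3,1) S(2)] by blast
      qed
      then show ?thesis using red by blast
    qed
  qed
qed

end

theorem theorem10: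
  fixes G :: "'a pair_pre_digraph" and x :: 'a
  assumes "pair_graph G" and "connected (with_proj G)" and "x \<in> pverts G"
  shows "\<not> AT_pair (G, h_vert x) \<longleftrightarrow>
      gallai_tree G
    \<or> deg G x = 1
    \<or> (deg G x = 2 \<and> (\<exists>C. component (del_verts G {x}) C \<and> gallai_tree C))
    \<or> (\<not> cutvertex G x \<and>
        (\<exists>B. block G B \<and> x \<in> pverts B \<and> (B, h_vert x) \<in> \<D> \<and>
          (\<forall>B'. block G B' \<and> B' \<noteq> B \<longrightarrow> complete_graph B' \<or> odd_cycle B')))
    \<or> (cutvertex G x \<and>
        (\<exists>A. x_lobe G x A \<and> (\<forall>A'. x_lobe G x A' \<and> A' \<noteq> A \<longrightarrow> gallai_tree A') \<and>
          (deg A x = 1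
           \<or> (deg A x = 2 \<and> gallai_tree (del_verts A {x}))
           \<or> (\<exists>B. block A B \<and> x \<in> pverts B \<and> (B, h_vert x) \<in> \<D> \<and>
                (\<forall>L. B_lobe A B L \<longrightarrow> gallai_tree L)))))"
proof -
  obtain D where D: "finite D" "D \<union> D\<inverse> = parcs G" "D \<inter> D\<inverse> = {}" using orientation_exists[OF assms(1)] .
  interpret oriented_graph D G
  proof (intro oriented_graph.intro ograph.intro oriented_graph_axioms.intro)
    show "(v, u) \<notin> D" if "(u, v) \<in> D" for u v using D(3) that by blast
  qed (fact D assms(1))+
  have "conn (pverts G)" using connected_gr[of "pverts G"] assms(2) gr_V by simp
  then show ?thesis using not_AT_pair_iff assms(3) by blast
qed

end
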